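(* Let $(A_1,B_1,\mathfrak H_1)$ and $(A_2,B_2,\mathfrak H_2)$ be two diffuse and finite dimensional P-modules with associated representations $\sigma_1^X:X\curvearrowright\mathscr H_1$ and $\sigma_2^X:X\curvearrowright\mathscr H_2$, where $X=F,T,V,\mathcal O$. Let $\mathfrak H_{i,\mathrm{small}}$, $i=1,2$, be the smallest complete sub-module of $\mathscr H_i$ (the intersection of all complete sub-modules of $\mathscr H_i$, which is itself a complete sub-module). The following assertions are true for each $X\in\{F,T,V,\mathcal O\}$. (1) The representation $\sigma_1^X$ is irreducible if and only if $\mathfrak H_1$ is indecomposable. (2) If a bounded linear map $\Theta:\mathscr H_1\to\mathscr H_2$ intertwines $\sigma_1^X$ and $\sigma_2^X$, then $\Theta$ restricts to a P-module morphism $\theta:\mathfrak H_{1,\mathrm{small}}\to\mathfrak H_{2,\mathrm{small}}$. In particular, the representations $\sigma_1^X$ and $\sigma_2^X$ are unitarily equivalent if and only if the P-modules $\mathfrak H_{1,\mathrm{small}}$ and $\mathfrak H_{2,\mathrm{small}}$ are unitarily equivalent.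
   Context: All Hilbert spaces are complex, direct sums are orthogonal, group representations are unitary, and representations of C*-algebras are unital and $*$-preserving. $F\subset T\subset V$ are Richard Thompson's groups: $V$ is the group of homeomorphisms of the Cantor space $\{0,1\}^{\mathbf N^*}$ of the form $\mu_j\cdot w\mapsto\nu_j\cdot w$ ($1\le j\le n$, $w$ infinite word), where $(\mu_j)$, $(\nu_j)$ are lists of finite binary words each defining a standard partition of the Cantor space; $T$, resp. $F$, is the subgroup of elements preserving the cyclic, resp. linear, (lexicographic) order of the pieces. The Cuntz algebra $\mathcal O$ is the universal C*-algebra generated by $s_0,s_1$ with $s_0s_0^*+s_1s_1^*=s_0^*s_0=s_1^*s_1=1$; $V$ is identified with a group of unitaries of $\mathcal O$ by sending the homeomorphism $\mu_j\cdot w\mapsto\nu_j\cdot w$ ($1\le j\le n$, $w$ infinite word) to $\sum_j s_{\nu_j}s_{\mu_j}^*$. P-modules. A P-module is a triple $(A,B,\mathfrak H)$ where $\mathfrak H$ is a Hilbert space and $A,B\in B(\mathfrak H)$ satisfy $A^*A+B^*B=\mathrm{id}_{\mathfrak H}$; it is finite dimensional if $\dim(\mathfrak H)<\infty$. A morphism $(A,B,\mathfrak H)\to(A',B',\mathfrak H')$ is a bounded linear $\theta:\mathfrak H\to\mathfrak H'$ with $\theta A=A'\theta$, $\theta B=B'\theta$; unitary equivalence means existence of a unitary morphism. A sub-module is a closed subspace stable under $A$ and $B$ (with restricted operators). A sub-module $\mathfrak H_0\subset\mathfrak H$ is complete if its orthogonal complement contains no nonzero sub-module of $\mathfrak H$.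 A P-module is decomposable if it contains the orthogonal direct sum of two nonzero sub-modules, and indecomposable otherwise. It is diffuse if $\lim_{n\to\infty}x_n\cdots x_2x_1\xi=0$ for every $\xi\in\mathfrak H$ and every infinite sequence $(x_n)_{n\ge1}$ in $\{A,B\}$. Associated representations. Given a P-module $(A,B,\mathfrak H)$, for each finite rooted binary tree $t$ (each vertex has $0$ or $2$ children) let $\mathfrak H_t:=\bigoplus_{\ell\in \mathrm{Leaf}(t)}\mathfrak H$. If $s$ is obtained from $t$ by attaching one caret at the leaf $\ell$, the isometry $\mathfrak H_t\to\mathfrak H_s$ replaces $\xi_\ell$ by $A\xi_\ell$ at the new left leaf and $B\xi_\ell$ at the new right leaf, leaving other components unchanged; compositions of these give a directed system, and $\mathscr H$ is the Hilbert space completion of the direct limit. The class of $\xi\in\mathfrak H_t$ is written $[t,\xi]$, and $\mathfrak H$ is identified with $\mathfrak H_I\subset\mathscr H$ for $I$ the trivial tree. For $t$ nontrivial with left and right subtrees $t_0,t_1$ at the children of the root, set $\tau_i([t,\xi]):=[t_i,\xi|_{\mathrm{Leaf}(t_i)}]$, $i=0,1$, extended to $\mathscr H$. Then $\sigma^{\mathcal O}:s_i\mapsto\tau_i^*$ is the associated representation of $\mathcal O$ on $\mathscr H$, and $\sigma^V,\sigma^T,\sigma^F$ are its restrictions to $V,T,F$. The triple $(\tau_0,\tau_1,\mathscr H)$ is a P-module containing $(A,B,\mathfrak H)$ as a sub-module; sub-modules and complete sub-modules of $\mathscr H$ refer to this P-module structure. *)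

theory Defs
  imports "HOL-Analysis.Analysis" "HOL-Library.Stream"
begin

section \<open>Complex Hilbert spaces and C*-algebras\<close>

class scaleC =
  fixes scaleC :: "complex \<Rightarrow> 'a \<Rightarrow> 'a" (infixr "*\<^sub>C" 75)

class complex_vector = real_vector + scaleC +
  assumes scaleC_add_right: "c *\<^sub>C (x + y) = c *\<^sub>C x + c *\<^sub>C y"
    and scaleC_add_left: "(c + d) *\<^sub>C x = c *\<^sub>C x + d *\<^sub>C x"
    and scaleC_scaleC: "c *\<^sub>C d *\<^sub>C x = (c * d) *\<^sub>C x"
    and scaleR_scaleC: "r *\<^sub>R x = complex_of_real r *\<^sub>C x"

lemma scaleC_one [simp]: "1 *\<^sub>C x = (x::'a::complex_vector)"
  using scaleR_scaleC[of 1 x] by simp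

global_interpretation complex_vec: vector_space "scaleC :: complex \<Rightarrow> 'a \<Rightarrow> 'a::complex_vector"
  by unfold_locales (simp_all add: scaleC_add_right scaleC_add_left scaleC_scaleC)

abbreviation csubspace :: "'a::complex_vector set \<Rightarrow> bool"
  where "csubspace \<equiv> complex_vec.subspace"

abbreviation cspan :: "'a::complex_vector set \<Rightarrow> 'a set"
  where "cspan \<equiv> complex_vec.span"

class complex_normed_vector = complex_vector + real_normed_vector +
  assumes norm_scaleC: "norm (c *\<^sub>C x) = cmod c * norm x"

text \<open>The inner product is linear in its first argument.\<close>

class complex_inner = complex_normed_vector +
  fixes cinner :: "'a \<Rightarrow> 'a \<Rightarrow> complex"
  assumes cinner_commute: "cinner x y = cnj (cinner y x)"
    and cinner_add_left: "cinner (x + y) z = cinner x z + cinner y z"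
    and cinner_scaleC_left: "cinner (c *\<^sub>C x) y = c * cinner x y"
    and cinner_self: "cinner x x = complex_of_real ((norm x)\<^sup>2)"

class complex_hilbert = complex_inner + complete_space

definition bounded_clinear :: "('a::complex_normed_vector \<Rightarrow> 'b::complex_normed_vector) \<Rightarrow> bool"
  where "bounded_clinear f \<longleftrightarrow> bounded_linear f \<and> (\<forall>c x. f (c *\<^sub>C x) = c *\<^sub>C f x)"

class star_algebra = complex_vector + ring + monoid_mult +
  fixes star :: "'a \<Rightarrow> 'a"
  assumes mult_scaleC_left: "(c *\<^sub>C x) * y = c *\<^sub>C (x * y)"
    and mult_scaleC_right: "x * (c *\<^sub>C y) = c *\<^sub>C (x * y)"
    and star_star: "star (star x) = x"
    and star_add: "star (x + y) = star x + star y"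
    and star_scaleC: "star (c *\<^sub>C x) = cnj c *\<^sub>C star x"
    and star_mult: "star (x * y) = star y * star x"

class pre_cstar_algebra = star_algebra + complex_normed_vector +
  assumes norm_mult_le: "norm (x * y) \<le> norm x * norm y"
    and norm_star_mult: "norm (star x * x) = (norm x)\<^sup>2"

class cstar_algebra = pre_cstar_algebra + complete_space

subsection \<open>Elementary consequences\<close>

instance pre_cstar_algebra \<subseteq> real_normed_algebra
  by standard (simp_all add: scaleR_scaleC mult_scaleC_left mult_scaleC_right norm_mult_le)

instance complex_hilbert \<subseteq> banach ..

lemma cinner_add_right: "cinner x (y + z) = cinner x y + cinner (x::'a::complex_inner) z"
  by (metis cinner_add_left cinner_commute complex_cnj_add)

lemma cinner_scaleC_right: "cinner x (c *\<^sub>C y) = cnj c * cinner (x::'a::complex_inner) y"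
  by (metis cinner_commute cinner_scaleC_left complex_cnj_mult)

lemma cinner_zero_left [simp]: "cinner 0 (x::'a::complex_inner) = 0"
  using cinner_scaleC_left[of 0 0 x] by simp

lemma cinner_zero_right [simp]: "cinner (x::'a::complex_inner) 0 = 0"
  using cinner_scaleC_right[of x 0 0] by simp

lemma cinner_minus_left: "cinner (- x) (y::'a::complex_inner) = - cinner x y"
  using cinner_scaleC_left[of "-1" x y] by simp

lemma cinner_minus_right: "cinner x (- y::'a::complex_inner) = - cinner x y"
  using cinner_scaleC_right[of x "-1" y] by simp

lemma cinner_diff_left: "cinner (x - y) (z::'a::complex_inner) = cinner x z - cinner y z"
  using cinner_add_left[of x "- y" z] by (simp add: cinner_minus_left)

lemma cinner_diff_right: "cinner z (x - y::'a::complex_inner) = cinner z x - cinner z y"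
  using cinner_add_right[of z x "- y"] by (simp add: cinner_minus_right)

lemma Cauchy_Schwarz: "cmod (cinner x y) \<le> norm x * norm (y::'a::complex_inner)"
proof (cases "y = 0")
  case False
  define c where "c = cinner x y"
  define n where "n = (norm y)\<^sup>2"
  have n: "n > 0" using False by (simp add: n_def)
  have yx: "cinner y x = cnj c" using cinner_commute[of y x] by (simp add: c_def)
  have xx: "cinner x x = complex_of_real ((norm x)\<^sup>2)" and yy: "cinner y y = complex_of_real n"
    by (simp_all only: cinner_self n_def)
  have cc: "c * cnj c = complex_of_real ((cmod c)\<^sup>2)"
    by (rule complex_norm_square[symmetric, unfolded of_real_power[symmetric]])
  let ?z = "complex_of_real n *\<^sub>C x - c *\<^sub>C y"
  have "complex_of_real ((norm ?z)\<^sup>2) = cinner ?z ?z"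
    by (simp only: cinner_self)
  also have "\<dots> = of_real n * of_real n * cinner x x - of_real n * (c * cnj c) - of_real n * (c * cnj c)
      + c * cnj c * cinner y y"
    unfolding cinner_diff_left cinner_diff_right cinner_scaleC_left cinner_scaleC_right yx c_def[symmetric]
    by (simp add: algebra_simps del: complex_mult_cnj)
  also have "\<dots> = complex_of_real (n * (n * (norm x)\<^sup>2 - (cmod c)\<^sup>2))"
    unfolding xx yy cc by (simp add: algebra_simps)
  finally have "complex_of_real ((norm ?z)\<^sup>2) = complex_of_real (n * (n * (norm x)\<^sup>2 - (cmod c)\<^sup>2))" .
  then have "0 \<le> n * (n * (norm x)\<^sup>2 - (cmod c)\<^sup>2)"
    by (metis of_real_eq_iff zero_le_power2)
  then have "(cmod c)\<^sup>2 \<le> (norm x * norm y)\<^sup>2"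
    using n by (simp add: zero_le_mult_iff n_def power_mult_distrib mult.commute)
  then show ?thesis
    unfolding c_def by (rule power2_le_imp_le) simp
qed simp

lemma bounded_clinear_add: "bounded_clinear f \<Longrightarrow> f (x + y) = f x + f y"
  by (simp add: bounded_clinear_def bounded_linear.linear linear_add)

lemma bounded_clinear_scaleC: "bounded_clinear f \<Longrightarrow> f (c *\<^sub>C x) = c *\<^sub>C f x"
  by (simp add: bounded_clinear_def)

lemma bounded_clinearI:
  assumes "\<And>x y. f (x + y) = f x + f y" "\<And>c x. f (c *\<^sub>C x) = c *\<^sub>C f x"
    and "\<And>x. norm (f x) \<le> norm x * K"
  shows "bounded_clinear f"
  unfolding bounded_clinear_def
  using assms by (auto intro!: bounded_linear_intro[where K=K] simp: scaleR_scaleC)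

section \<open>Completion of a normed space\<close>

lemma Cauchy_const [simp]: "Cauchy (\<lambda>n. c :: 'e::real_normed_vector)"
  by (rule LIMSEQ_imp_Cauchy[OF tendsto_const])

lemma Cauchy_minus: "Cauchy X \<Longrightarrow> Cauchy (\<lambda>n. - (X n :: 'e::real_normed_vector))"
  unfolding Cauchy_iff by (simp add: norm_minus_commute)

lemma Cauchy_add:
  assumes "Cauchy X" "Cauchy Y" shows "Cauchy (\<lambda>n. X n + (Y n :: 'e::real_normed_vector))"
proof (rule CauchyI)
  fix e :: real assume e: "e > 0"
  obtain M where M: "\<forall>m\<ge>M. \<forall>n\<ge>M. norm (X m - X n) < e / 2"
    using CauchyD[OF assms(1), of "e / 2"] e by auto
  obtain N where N: "\<forall>m\<ge>N. \<forall>n\<ge>N. norm (Y m - Y n) < e / 2"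
    using CauchyD[OF assms(2), of "e / 2"] e by auto
  have "norm (X m + Y m - (X n + Y n)) < e" if "m \<ge> max M N" "n \<ge> max M N" for m n
  proof -
    have "norm (X m - X n) < e / 2" "norm (Y m - Y n) < e / 2" using M N that by auto
    then show ?thesis using norm_triangle_ineq[of "X m - X n" "Y m - Y n"] by (simp add: algebra_simps)
  qed
  then show "\<exists>M. \<forall>m\<ge>M. \<forall>n\<ge>M. norm (X m + Y m - (X n + Y n)) < e" by blast
qed

lemma Cauchy_diff: "Cauchy X \<Longrightarrow> Cauchy Y \<Longrightarrow> Cauchy (\<lambda>n. X n - (Y n :: 'e::real_normed_vector))"
  using Cauchy_add[of X "\<lambda>n. - Y n"] by (simp add: Cauchy_minus)

quotient_type (overloaded) 'e completion = "nat \<Rightarrow> 'e::real_normed_vector" / partial: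
  "\<lambda>X Y. Cauchy X \<and> Cauchy Y \<and> (\<lambda>n. X n - Y n) \<longlonglongrightarrow> 0"
proof (rule part_equivpI)
  show "\<exists>X::nat \<Rightarrow> 'e. Cauchy X \<and> Cauchy X \<and> (\<lambda>n. X n - X n) \<longlonglongrightarrow> 0"
    by (rule exI[of _ "\<lambda>_. 0"]) simp
  show "symp (\<lambda>X Y::nat \<Rightarrow> 'e. Cauchy X \<and> Cauchy Y \<and> (\<lambda>n. X n - Y n) \<longlonglongrightarrow> 0)"
    by (rule sympI) (auto simp: LIMSEQ_def norm_minus_commute)
  show "transp (\<lambda>X Y::nat \<Rightarrow> 'e. Cauchy X \<and> Cauchy Y \<and> (\<lambda>n. X n - Y n) \<longlonglongrightarrow> 0)"
  proof (rule transpI, elim conjE, intro conjI)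
    fix X Y Z :: "nat \<Rightarrow> 'e"
    assume "(\<lambda>n. X n - Y n) \<longlonglongrightarrow> 0" "(\<lambda>n. Y n - Z n) \<longlonglongrightarrow> 0"
    from tendsto_add[OF this] show "(\<lambda>n. X n - Z n) \<longlonglongrightarrow> 0" by simp
  qed
qed

lemma Cauchy_scaleC: "Cauchy X \<Longrightarrow> Cauchy (\<lambda>n. c *\<^sub>C (X n :: 'e::complex_normed_vector))"
  by (rule bounded_linear.Cauchy[of "\<lambda>x. c *\<^sub>C x"])
    (auto intro!: bounded_linear_intro[where K="cmod c"] simp: scaleR_scaleC scaleC_add_right scaleC_scaleC
      norm_scaleC mult.commute)

lemma tendsto_scaleC: "X \<longlonglongrightarrow> L \<Longrightarrow> (\<lambda>n. c *\<^sub>C (X n :: 'e::complex_normed_vector)) \<longlonglongrightarrow> c *\<^sub>C L"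
  by (rule bounded_linear.tendsto[of "\<lambda>x. c *\<^sub>C x"])
    (auto intro!: bounded_linear_intro[where K="cmod c"] simp: scaleR_scaleC scaleC_add_right scaleC_scaleC
      norm_scaleC mult.commute)

lemma Cauchy_norm: "Cauchy X \<Longrightarrow> Cauchy (\<lambda>n. norm (X n :: 'e::real_normed_vector))"
  unfolding Cauchy_def dist_norm real_norm_def by (meson norm_triangle_ineq3 order_le_less_trans)

lemma norm_diff_tendsto_zero:
  "(\<lambda>n. X n - Y n :: 'e::real_normed_vector) \<longlonglongrightarrow> 0 \<Longrightarrow> (\<lambda>n. norm (X n) - norm (Y n)) \<longlonglongrightarrow> 0"
  by (rule Lim_null_comparison[where g="\<lambda>n. norm (X n - Y n)"])
    (auto intro!: always_eventually tendsto_norm_zero norm_triangle_ineq3)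

lemma lim_eq_if_diff:
  assumes "Cauchy f" "Cauchy g" "(\<lambda>n. f n - g n) \<longlonglongrightarrow> (0::'b::banach)"
  shows "lim f = lim g"
proof -
  obtain l m where "f \<longlonglongrightarrow> l" "g \<longlonglongrightarrow> m"
    using assms by (meson Cauchy_convergent_iff convergent_def)
  moreover have "l = m"
    using tendsto_diff[OF calculation] assms(3) LIMSEQ_unique by (metis eq_iff_diff_eq_0)
  ultimately show ?thesis by (simp add: limI)
qed

lift_definition embed :: "'e::real_normed_vector \<Rightarrow> 'e completion" is "\<lambda>x n. x"
  by simp

instantiation completion :: (real_normed_vector) real_normed_vector
begin

lift_definition zero_completion :: "'a completion" is "\<lambda>n. 0"
  by simp

lift_definition plus_completion :: "'a completion \<Rightarrow> 'a completion \<Rightarrow> 'a completion"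
  is "\<lambda>X Y n. X n + Y n"
proof (elim conjE, intro conjI)
  fix X X' Y Y' :: "nat \<Rightarrow> 'a"
  assume "(\<lambda>n. X n - X' n) \<longlonglongrightarrow> 0" "(\<lambda>n. Y n - Y' n) \<longlonglongrightarrow> 0"
  from tendsto_add[OF this] show "(\<lambda>n. X n + Y n - (X' n + Y' n)) \<longlonglongrightarrow> 0"
    by (simp add: algebra_simps)
qed (simp_all add: Cauchy_add)

lift_definition uminus_completion :: "'a completion \<Rightarrow> 'a completion" is "\<lambda>X n. - X n"
proof (elim conjE, intro conjI)
  fix X X' :: "nat \<Rightarrow> 'a"
  assume "(\<lambda>n. X n - X' n) \<longlonglongrightarrow> 0"
  from tendsto_minus[OF this] show "(\<lambda>n. - X n - - X' n) \<longlonglongrightarrow> 0"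
    by (simp add: algebra_simps)
qed (simp_all add: Cauchy_minus)

lift_definition scaleR_completion :: "real \<Rightarrow> 'a completion \<Rightarrow> 'a completion" is "\<lambda>r X n. r *\<^sub>R X n"
proof (elim conjE, intro conjI)
  fix X X' :: "nat \<Rightarrow> 'a" and r :: real
  assume "(\<lambda>n. X n - X' n) \<longlonglongrightarrow> 0"
  from tendsto_scaleR[OF tendsto_const this, of r] show "(\<lambda>n. r *\<^sub>R X n - r *\<^sub>R X' n) \<longlonglongrightarrow> 0"
    by (simp add: algebra_simps)
qed (simp_all add: bounded_linear.Cauchy[OF bounded_linear_scaleR_right])

lift_definition norm_completion :: "'a completion \<Rightarrow> real" is "\<lambda>X. lim (\<lambda>n. norm (X n))"
  by (auto intro!: lim_eq_if_diff Cauchy_norm norm_diff_tendsto_zero)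

definition minus_completion :: "'a completion \<Rightarrow> 'a completion \<Rightarrow> 'a completion"
  where "minus_completion x y = x + - y"

definition dist_completion :: "'a completion \<Rightarrow> 'a completion \<Rightarrow> real"
  where "dist_completion x y = norm (x - y)"

definition sgn_completion :: "'a completion \<Rightarrow> 'a completion"
  where "sgn_completion x = inverse (norm x) *\<^sub>R x"

definition uniformity_completion :: "('a completion \<times> 'a completion) filter"
  where "uniformity_completion = (INF e\<in>{0<..}. principal {(x, y). dist x y < e})"

definition open_completion :: "'a completion set \<Rightarrow> bool"
  where "open_completion U \<longleftrightarrow> (\<forall>x\<in>U. \<forall>\<^sub>F (x', y) in uniformity. x' = x \<longrightarrow> y \<in> U)"

lemma norm_completion_lim:
  assumes "Cauchy X" shows "(\<lambda>n. norm (X n :: 'a)) \<longlonglongrightarrow> lim (\<lambda>n. norm (X n))"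
  using Cauchy_norm[OF assms] Cauchy_convergent convergent_LIMSEQ_iff by blast

instance
proof
  fix x y z :: "'a completion" and a b :: real
  show "x + y + z = x + (y + z)" by transfer (simp add: algebra_simps Cauchy_add)
  show "x + y = y + x" by transfer (simp add: algebra_simps Cauchy_add)
  show "0 + x = x" by transfer simp
  show "- x + x = 0" by transfer simp
  show "x - y = x + - y" by (simp add: minus_completion_def)
  show "a *\<^sub>R (x + y) = a *\<^sub>R x + a *\<^sub>R y"
    by transfer (simp add: scaleR_add_right Cauchy_add bounded_linear.Cauchy[OF bounded_linear_scaleR_right])
  show "(a + b) *\<^sub>R x = a *\<^sub>R x + b *\<^sub>R x"
    by transfer (simp add: scaleR_add_left Cauchy_add bounded_linear.Cauchy[OF bounded_linear_scaleR_right])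
  show "a *\<^sub>R b *\<^sub>R x = (a * b) *\<^sub>R x"
    by transfer (simp add: bounded_linear.Cauchy[OF bounded_linear_scaleR_right])
  show "1 *\<^sub>R x = x" by transfer simp
  show "dist x y = norm (x - y)" by (simp add: dist_completion_def)
  show "sgn x = inverse (norm x) *\<^sub>R x" by (simp add: sgn_completion_def)
  show "uniformity = (INF e\<in>{0<..}. principal {(x::'a completion, y). dist x y < e})"
    by (simp add: uniformity_completion_def)
  show "open U \<longleftrightarrow> (\<forall>x\<in>U. \<forall>\<^sub>F (x', y) in uniformity. x' = x \<longrightarrow> y \<in> U)" for U :: "'a completion set"
    by (simp add: open_completion_def)
  show "norm x = 0 \<longleftrightarrow> x = 0"
  proof (transfer, elim conjE)
    fix X :: "nat \<Rightarrow> 'a" assume X: "Cauchy X"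
    have "lim (\<lambda>n. norm (X n)) = 0 \<longleftrightarrow> (\<lambda>n. norm (X n)) \<longlonglongrightarrow> 0"
      using norm_completion_lim[OF X] limI by metis
    also have "\<dots> \<longleftrightarrow> X \<longlonglongrightarrow> 0" by (rule tendsto_norm_zero_iff)
    finally show "(lim (\<lambda>n. norm (X n)) = 0) = (Cauchy X \<and> Cauchy (\<lambda>n. 0::'a) \<and> (\<lambda>n. X n - 0) \<longlonglongrightarrow> 0)"
      using X by simp
  qed
  show "norm (x + y) \<le> norm x + norm y"
  proof (transfer, elim conjE)
    fix X Y :: "nat \<Rightarrow> 'a" assume "Cauchy X" "Cauchy Y"
    then show "lim (\<lambda>n. norm (X n + Y n)) \<le> lim (\<lambda>n. norm (X n)) + lim (\<lambda>n. norm (Y n))"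
      by (intro LIMSEQ_le[OF norm_completion_lim tendsto_add[OF norm_completion_lim norm_completion_lim]])
        (auto simp: Cauchy_add norm_triangle_ineq)
  qed
  show "norm (a *\<^sub>R x) = \<bar>a\<bar> * norm x"
  proof (transfer, elim conjE)
    fix X :: "nat \<Rightarrow> 'a" and a :: real assume X: "Cauchy X"
    have "(\<lambda>n. norm (a *\<^sub>R X n)) \<longlonglongrightarrow> \<bar>a\<bar> * lim (\<lambda>n. norm (X n))"
      using tendsto_mult[OF tendsto_const norm_completion_lim[OF X], of "\<bar>a\<bar>"] by simp
    then show "lim (\<lambda>n. norm (a *\<^sub>R X n)) = \<bar>a\<bar> * lim (\<lambda>n. norm (X n))" by (rule limI)
  qed
qed

end

lemma norm_embed [simp]: "norm (embed x) = norm x"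
  by transfer simp

lemma embed_add: "embed (x + y) = embed x + embed y"
  by transfer simp

lemma embed_minus: "embed (- x) = - embed x"
  by transfer simp

lemma embed_diff: "embed (x - y) = embed x - embed y"
  using embed_add[of x "- y"] by (simp add: embed_minus)

lemma embed_tendsto_abs:
  assumes "Cauchy X" shows "(\<lambda>n. embed (X n)) \<longlonglongrightarrow> abs_completion X"
proof (rule LIMSEQ_I)
  fix e :: real assume e: "e > 0"
  then obtain N where N: "\<And>m n. m \<ge> N \<Longrightarrow> n \<ge> N \<Longrightarrow> norm (X m - X n) < e / 2"
    using assms unfolding Cauchy_iff by (metis half_gt_zero)
  have "norm (embed (X n) - abs_completion X) < e" if n: "n \<ge> N" for n
  proof -
    have C: "Cauchy (\<lambda>k. X n - X k)"
      using Cauchy_diff[of "\<lambda>_. X n" X] assms by simp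
    have "embed (X n) - abs_completion X = abs_completion (\<lambda>k. X n - X k)"
      using assms by (simp add: minus_completion_def embed.abs_eq uminus_completion.abs_eq
          plus_completion.abs_eq eq_onp_def Cauchy_minus)
    then have "norm (embed (X n) - abs_completion X) = lim (\<lambda>k. norm (X n - X k))"
      using C by (simp add: norm_completion.abs_eq eq_onp_def)
    also have "\<dots> \<le> e / 2"
      by (rule LIMSEQ_le_const2[OF norm_completion_lim[OF C]]) (use N n in \<open>auto intro!: exI[of _ N] less_imp_le\<close>)
    finally show ?thesis using e by simp
  qed
  then show "\<exists>N. \<forall>n\<ge>N. norm (embed (X n) - abs_completion X) < e" by blast
qed

lemma completion_seq:
  obtains X where "Cauchy X" "x = abs_completion X" "(\<lambda>n. embed (X n)) \<longlonglongrightarrow> x"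
proof -
  have "Cauchy (rep_completion x)" using Quotient_rep_reflp[OF Quotient_completion, of x] by blast
  moreover have "abs_completion (rep_completion x) = x"
    by (rule Quotient_abs_rep[OF Quotient_completion])
  ultimately show ?thesis using embed_tendsto_abs that by metis
qed

lemma embed_dense: "closure (range embed) = (UNIV :: 'a::real_normed_vector completion set)"
proof -
  have "x \<in> closure (range embed)" for x :: "'a completion"
    by (rule completion_seq[of x]) (metis closure_sequential rangeI)
  then show ?thesis by blast
qed

instance completion :: (real_normed_vector) banach
proof
  fix X :: "nat \<Rightarrow> 'a completion" assume X: "Cauchy X"
  have "\<exists>y. dist (embed y) (X n) < inverse (real (Suc n))" for n
  proof -
    have "X n \<in> closure (range embed)" by (simp add: embed_dense)
    then show ?thesis unfolding closure_approachable by fastforce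
  qed
  then obtain Y where Y: "\<And>n. dist (embed (Y n)) (X n) < inverse (real (Suc n))" by metis
  have lim0: "(\<lambda>n. embed (Y n) - X n) \<longlonglongrightarrow> 0"
    by (rule Lim_null_comparison[OF _ LIMSEQ_inverse_real_of_nat])
      (use Y in \<open>auto intro!: always_eventually less_imp_le simp: dist_norm\<close>)
  have "Cauchy (\<lambda>n. (embed (Y n) - X n) + X n)"
    by (intro Cauchy_add X convergent_Cauchy convergentI[OF lim0])
  then have "Cauchy Y"
    by (simp add: Cauchy_iff embed_diff[symmetric])
  from tendsto_diff[OF embed_tendsto_abs[OF this] lim0] show "convergent X"
    by (auto simp: convergent_def)
qed

instantiation completion :: (complex_normed_vector) complex_normed_vector
begin

lift_definition scaleC_completion :: "complex \<Rightarrow> 'a completion \<Rightarrow> 'a completion" is "\<lambda>c X n. c *\<^sub>C X n"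
proof (elim conjE, intro conjI)
  fix X X' :: "nat \<Rightarrow> 'a" and c :: complex
  assume "(\<lambda>n. X n - X' n) \<longlonglongrightarrow> 0"
  from tendsto_scaleC[OF this, of c] show "(\<lambda>n. c *\<^sub>C X n - c *\<^sub>C X' n) \<longlonglongrightarrow> 0"
    by (simp add: complex_vec.scale_right_diff_distrib)
qed (simp_all add: Cauchy_scaleC)

instance
proof
  fix x y :: "'a completion" and c d :: complex and r :: real
  show "c *\<^sub>C (x + y) = c *\<^sub>C x + c *\<^sub>C y"
    by transfer (simp add: scaleC_add_right Cauchy_add Cauchy_scaleC)
  show "(c + d) *\<^sub>C x = c *\<^sub>C x + d *\<^sub>C x"
    by transfer (simp add: scaleC_add_left Cauchy_add Cauchy_scaleC)
  show "c *\<^sub>C d *\<^sub>C x = (c * d) *\<^sub>C x"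
    by transfer (simp add: Cauchy_scaleC)
  show "r *\<^sub>R x = complex_of_real r *\<^sub>C x"
    by transfer (simp add: Cauchy_scaleC scaleR_scaleC)
  show "norm (c *\<^sub>C x) = cmod c * norm x"
  proof (transfer, elim conjE)
    fix X :: "nat \<Rightarrow> 'a" and c :: complex assume X: "Cauchy X"
    have "(\<lambda>n. norm (c *\<^sub>C X n)) \<longlonglongrightarrow> cmod c * lim (\<lambda>n. norm (X n))"
      using tendsto_mult[OF tendsto_const norm_completion_lim[OF X], of "cmod c"] by (simp add: norm_scaleC)
    then show "lim (\<lambda>n. norm (c *\<^sub>C X n)) = cmod c * lim (\<lambda>n. norm (X n))" by (rule limI)
  qed
qed

end

lemma embed_scaleC: "embed (c *\<^sub>C x) = c *\<^sub>C embed x"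
  by transfer simp

lemma Cauchy_bounded_bilinear:
  assumes B: "\<And>x y x' y'. norm (B x y - B x' y' :: 'c::real_normed_vector)
      \<le> norm (x - x') * norm y + norm x' * norm (y - y')"
    and X: "Cauchy (X :: nat \<Rightarrow> 'a::real_normed_vector)" and Y: "Cauchy (Y :: nat \<Rightarrow> 'b::real_normed_vector)"
  shows "Cauchy (\<lambda>n. B (X n) (Y n))"
proof -
  obtain K where K: "\<And>n. norm (X n) \<le> K" "K > 0"
    using Cauchy_Bseq[OF X] by (metis BseqE)
  obtain M where M: "\<And>n. norm (Y n) \<le> M" "M > 0"
    using Cauchy_Bseq[OF Y] by (metis BseqE)
  show ?thesis
  proof (rule CauchyI)
    fix e :: real assume e: "e > 0"
    obtain N1 where N1: "\<And>m n. m \<ge> N1 \<Longrightarrow> n \<ge> N1 \<Longrightarrow> norm (X m - X n) < e / (2 * M)"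
      using X e M(2) unfolding Cauchy_iff by (metis divide_pos_pos mult_pos_pos zero_less_numeral)
    obtain N2 where N2: "\<And>m n. m \<ge> N2 \<Longrightarrow> n \<ge> N2 \<Longrightarrow> norm (Y m - Y n) < e / (2 * K)"
      using Y e K(2) unfolding Cauchy_iff by (metis divide_pos_pos mult_pos_pos zero_less_numeral)
    have "norm (B (X m) (Y m) - B (X n) (Y n)) < e" if "m \<ge> max N1 N2" "n \<ge> max N1 N2" for m n
    proof -
      have "norm (X m - X n) * norm (Y m) \<le> norm (X m - X n) * M"
        using M by (intro mult_left_mono) auto
      also have "\<dots> < e / (2 * M) * M"
        using that N1 M by (intro mult_strict_right_mono) auto
      finally have 1: "norm (X m - X n) * norm (Y m) < e / 2" using M by simp
      have "norm (X n) * norm (Y m - Y n) \<le> K * norm (Y m - Y n)"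
        using K by (intro mult_right_mono) auto
      also have "\<dots> < K * (e / (2 * K))"
        using that N2 K by (intro mult_strict_left_mono) auto
      finally have 2: "norm (X n) * norm (Y m - Y n) < e / 2" using K by simp
      show ?thesis using B[of "X m" "Y m" "X n" "Y n"] 1 2 by linarith
    qed
    then show "\<exists>M. \<forall>m\<ge>M. \<forall>n\<ge>M. norm (B (X m) (Y m) - B (X n) (Y n)) < e" by blast
  qed
qed

lemma bilinear_diff_tendsto_zero:
  assumes B: "\<And>x y x' y'. norm (B x y - B x' y' :: 'c::real_normed_vector)
      \<le> norm (x - x') * norm y + norm x' * norm (y - y')"
    and "Cauchy (X' :: nat \<Rightarrow> 'a::real_normed_vector)" "Cauchy (Y :: nat \<Rightarrow> 'b::real_normed_vector)"
    and X: "(\<lambda>n. X n - X' n) \<longlonglongrightarrow> 0" and Y: "(\<lambda>n. Y n - Y' n) \<longlonglongrightarrow> 0"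
  shows "(\<lambda>n. B (X n) (Y n) - B (X' n) (Y' n)) \<longlonglongrightarrow> 0"
proof (rule Lim_null_comparison)
  show "\<forall>\<^sub>F n in sequentially. norm (B (X n) (Y n) - B (X' n) (Y' n))
      \<le> norm (X n - X' n) * norm (Y n) + norm (X' n) * norm (Y n - Y' n)"
    using B by (auto intro!: always_eventually)
  have "convergent (\<lambda>n. norm (Y n))" "convergent (\<lambda>n. norm (X' n))"
    using assms by (auto intro!: Cauchy_convergent Cauchy_norm)
  then obtain l m where "(\<lambda>n. norm (Y n)) \<longlonglongrightarrow> l" "(\<lambda>n. norm (X' n)) \<longlonglongrightarrow> m" unfolding convergent_def by blast
  then have "(\<lambda>n. norm (X n - X' n) * norm (Y n) + norm (X' n) * norm (Y n - Y' n)) \<longlonglongrightarrow> 0 * l + m * 0"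
    by (intro tendsto_intros tendsto_norm_zero X Y)
  then show "(\<lambda>n. norm (X n - X' n) * norm (Y n) + norm (X' n) * norm (Y n - Y' n)) \<longlonglongrightarrow> 0" by simp
qed

lemma cinner_diff_bound:
  "norm (cinner x y - cinner x' y') \<le> norm (x - x') * norm y + norm x' * norm (y - y' :: 'a::complex_inner)"
proof -
  have "cinner x y - cinner x' y' = cinner (x - x') y + cinner x' (y - y')"
    by (simp add: cinner_diff_left cinner_diff_right)
  then show ?thesis
    using norm_triangle_ineq[of "cinner (x - x') y" "cinner x' (y - y')"]
      Cauchy_Schwarz[of "x - x'" y] Cauchy_Schwarz[of x' "y - y'"] by simp
qed

instantiation completion :: (complex_inner) complex_hilbert
begin

lift_definition cinner_completion :: "'a completion \<Rightarrow> 'a completion \<Rightarrow> complex"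
  is "\<lambda>X Y. lim (\<lambda>n. cinner (X n) (Y n))"
  by (elim conjE, rule lim_eq_if_diff)
    (rule Cauchy_bounded_bilinear[where B=cinner] bilinear_diff_tendsto_zero[where B=cinner],
      rule cinner_diff_bound, assumption+)+

lemma cinner_completion_lim:
  assumes "Cauchy X" "Cauchy (Y :: nat \<Rightarrow> 'a)"
  shows "(\<lambda>n. cinner (X n) (Y n)) \<longlonglongrightarrow> lim (\<lambda>n. cinner (X n) (Y n))"
  using Cauchy_convergent[OF Cauchy_bounded_bilinear[where B=cinner, OF cinner_diff_bound assms]] convergent_LIMSEQ_iff by blast

instance
proof
  fix x y z :: "'a completion" and c :: complex
  show "cinner x y = cnj (cinner y x)"
  proof (transfer, elim conjE)
    fix X Y :: "nat \<Rightarrow> 'a" assume "Cauchy X" "Cauchy Y"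
    from tendsto_cnj[OF cinner_completion_lim[OF this(2,1)]]
    show "lim (\<lambda>n. cinner (X n) (Y n)) = cnj (lim (\<lambda>n. cinner (Y n) (X n)))"
      by (intro limI) (simp add: cinner_commute[symmetric])
  qed
  show "cinner (x + y) z = cinner x z + cinner y z"
  proof (transfer, elim conjE)
    fix X Y Z :: "nat \<Rightarrow> 'a" assume "Cauchy X" "Cauchy Y" "Cauchy Z"
    then show "lim (\<lambda>n. cinner (X n + Y n) (Z n)) = lim (\<lambda>n. cinner (X n) (Z n)) + lim (\<lambda>n. cinner (Y n) (Z n))"
      unfolding cinner_add_left by (intro limI tendsto_add cinner_completion_lim)
  qed
  show "cinner (c *\<^sub>C x) y = c * cinner x y"
  proof (transfer, elim conjE)
    fix X Y :: "nat \<Rightarrow> 'a" and c assume "Cauchy X" "Cauchy Y"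
    then show "lim (\<lambda>n. cinner (c *\<^sub>C X n) (Y n)) = c * lim (\<lambda>n. cinner (X n) (Y n))"
      unfolding cinner_scaleC_left by (intro limI tendsto_mult tendsto_const cinner_completion_lim)
  qed
  show "cinner x x = complex_of_real ((norm x)\<^sup>2)"
  proof (transfer, elim conjE)
    fix X :: "nat \<Rightarrow> 'a" assume "Cauchy X"
    then show "lim (\<lambda>n. cinner (X n) (X n)) = complex_of_real ((lim (\<lambda>n. norm (X n)))\<^sup>2)"
      unfolding cinner_self by (intro limI tendsto_of_real tendsto_power norm_completion_lim)
  qed
qed

end

lemma cinner_embed: "cinner (embed x) (embed y) = cinner x y"
  by transfer simp

lemma norm_star_le: "norm (star x) \<le> norm (x :: 'a::pre_cstar_algebra)"
proof (cases "star x = 0")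
  case False
  have "(norm (star x))\<^sup>2 \<le> norm x * norm (star x)"
    using norm_star_mult[of "star x"] norm_mult_le[of x "star x"] by (simp add: star_star)
  then show ?thesis using False by (simp add: power2_eq_square)
qed simp

lemma norm_star: "norm (star x) = norm (x :: 'a::pre_cstar_algebra)"
  using norm_star_le[of x] norm_star_le[of "star x"] by (simp add: star_star)

lemma star_minus: "star (- x) = - star (x :: 'a::star_algebra)"
  using star_scaleC[of "-1" x] by simp

lemma star_diff: "star (x - y) = star x - star (y :: 'a::star_algebra)"
  using star_add[of x "- y"] by (simp add: star_minus)

lemma bounded_linear_star: "bounded_linear (star :: 'a \<Rightarrow> 'a::pre_cstar_algebra)"
  by (rule bounded_linear_intro[where K=1]) (simp_all add: star_add star_scaleC scaleR_scaleC norm_star)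

lemma times_diff_bound:
  "norm (x * y - x' * y') \<le> norm (x - x') * norm y + norm x' * norm (y - y' :: 'a::pre_cstar_algebra)"
proof -
  have "x * y - x' * y' = (x - x') * y + x' * (y - y')" by (simp add: algebra_simps)
  then show ?thesis
    using norm_triangle_ineq[of "(x - x') * y" "x' * (y - y')"]
      norm_mult_le[of "x - x'" y] norm_mult_le[of x' "y - y'"] by simp
qed

instantiation completion :: (pre_cstar_algebra) cstar_algebra
begin

lift_definition one_completion :: "'a completion" is "\<lambda>n. 1"
  by simp

lift_definition times_completion :: "'a completion \<Rightarrow> 'a completion \<Rightarrow> 'a completion" is "\<lambda>X Y n. X n * Y n"
  by (elim conjE, intro conjI)
    (rule Cauchy_bounded_bilinear[where B="(*)"] bilinear_diff_tendsto_zero[where B="(*)"],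
      rule times_diff_bound, assumption+)+

lift_definition star_completion :: "'a completion \<Rightarrow> 'a completion" is "\<lambda>X n. star (X n)"
proof (elim conjE, intro conjI)
  fix X X' :: "nat \<Rightarrow> 'a"
  assume "(\<lambda>n. X n - X' n) \<longlonglongrightarrow> 0"
  from bounded_linear.tendsto_zero[OF bounded_linear_star this]
  show "(\<lambda>n. star (X n) - star (X' n)) \<longlonglongrightarrow> 0" by (simp add: star_diff)
qed (simp_all add: bounded_linear.Cauchy[OF bounded_linear_star])

lemma Cauchy_times: "Cauchy X \<Longrightarrow> Cauchy (Y :: nat \<Rightarrow> 'a) \<Longrightarrow> Cauchy (\<lambda>n. X n * Y n)"
  by (rule Cauchy_bounded_bilinear[where B="(*)", OF times_diff_bound])

lemma Cauchy_star: "Cauchy (X :: nat \<Rightarrow> 'a) \<Longrightarrow> Cauchy (\<lambda>n. star (X n))"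
  by (rule bounded_linear.Cauchy[OF bounded_linear_star])

instance
proof
  fix x y z :: "'a completion" and c :: complex
  show "x * y * z = x * (y * z)" by transfer (simp add: Cauchy_times mult.assoc)
  show "1 * x = x" by transfer simp
  show "x * 1 = x" by transfer simp
  show "(x + y) * z = x * z + y * z" by transfer (simp add: Cauchy_times Cauchy_add distrib_right)
  show "x * (y + z) = x * y + x * z" by transfer (simp add: Cauchy_times Cauchy_add distrib_left)
  show "(c *\<^sub>C x) * y = c *\<^sub>C (x * y)" by transfer (simp add: Cauchy_times Cauchy_scaleC mult_scaleC_left)
  show "x * (c *\<^sub>C y) = c *\<^sub>C (x * y)" by transfer (simp add: Cauchy_times Cauchy_scaleC mult_scaleC_right)
  show "star (star x) = x" by transfer (simp add: star_star)
  show "star (x + y) = star x + star y" by transfer (simp add: Cauchy_star Cauchy_add star_add)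
  show "star (c *\<^sub>C x) = cnj c *\<^sub>C star x" by transfer (simp add: Cauchy_star Cauchy_scaleC star_scaleC)
  show "star (x * y) = star y * star x" by transfer (simp add: Cauchy_star Cauchy_times star_mult)
  show "norm (x * y) \<le> norm x * norm y"
  proof (transfer, elim conjE)
    fix X Y :: "nat \<Rightarrow> 'a" assume "Cauchy X" "Cauchy Y"
    then show "lim (\<lambda>n. norm (X n * Y n)) \<le> lim (\<lambda>n. norm (X n)) * lim (\<lambda>n. norm (Y n))"
      by (intro LIMSEQ_le[OF norm_completion_lim tendsto_mult[OF norm_completion_lim norm_completion_lim]])
        (auto simp: Cauchy_times norm_mult_le)
  qed
  show "norm (star x * x) = (norm x)\<^sup>2"
  proof (transfer, elim conjE)
    fix X :: "nat \<Rightarrow> 'a" assume "Cauchy X"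
    then show "lim (\<lambda>n. norm (star (X n) * X n)) = (lim (\<lambda>n. norm (X n)))\<^sup>2"
      unfolding norm_star_mult by (intro limI tendsto_power norm_completion_lim)
  qed
qed

end

lemma embed_times: "embed (x * y) = embed x * embed y"
  by transfer simp

lemma embed_star: "embed (star x) = star (embed x)"
  by transfer simp

lemma embed_one: "embed 1 = 1"
  by transfer simp

section \<open>P-modules and their associated Hilbert spaces\<close>

text \<open>
  A P-module is a type of class \<open>pmodule\<close>: a Hilbert space with two operators
  \<open>opA\<close>, \<open>opB\<close> such that \<open>opA\<^sup>* opA + opB\<^sup>* opB = id\<close>. This identity is written out
  with the inner product; it implies that both operators are contractions, so that boundedness need not
  be required separately. The class \<open>pythagorean\<close> omits completeness, so that it also covers
  the direct limit below.
\<close>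

class pythagorean = complex_inner +
  fixes opA opB :: "'a \<Rightarrow> 'a"
  assumes opA_add: "opA (x + y) = opA x + opA y"
    and opA_scaleC: "opA (c *\<^sub>C x) = c *\<^sub>C opA x"
    and opB_add: "opB (x + y) = opB x + opB y"
    and opB_scaleC: "opB (c *\<^sub>C x) = c *\<^sub>C opB x"
    and pythagorean_identity: "cinner (opA x) (opA y) + cinner (opB x) (opB y) = cinner x y"

class pmodule = pythagorean + complex_hilbert

lemma opA_zero [simp]: "opA 0 = (0::'a::pythagorean)"
  using opA_scaleC[of 0 0] by simp

lemma opB_zero [simp]: "opB 0 = (0::'a::pythagorean)"
  using opB_scaleC[of 0 0] by simp

lemma pythagorean_norm: "(norm (opA x))\<^sup>2 + (norm (opB x))\<^sup>2 = (norm (x::'a::pythagorean))\<^sup>2"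
proof -
  have "complex_of_real ((norm (opA x))\<^sup>2 + (norm (opB x))\<^sup>2) = complex_of_real ((norm x)\<^sup>2)"
    unfolding of_real_add cinner_self[symmetric] by (rule pythagorean_identity)
  then show ?thesis by (simp only: of_real_eq_iff)
qed

lemma norm_opA_le: "norm (opA x) \<le> norm (x::'a::pythagorean)"
  using pythagorean_norm[of x] zero_le_power2[of "norm (opB x)"]
  by (intro power2_le_imp_le[OF _ norm_ge_zero]) linarith

lemma norm_opB_le: "norm (opB x) \<le> norm (x::'a::pythagorean)"
  using pythagorean_norm[of x] zero_le_power2[of "norm (opA x)"]
  by (intro power2_le_imp_le[OF _ norm_ge_zero]) linarith

lemma bounded_clinear_opA: "bounded_clinear (opA :: 'a \<Rightarrow> 'a::pythagorean)"
  by (rule bounded_clinearI[where K=1]) (simp_all add: opA_add opA_scaleC norm_opA_le)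

lemma bounded_clinear_opB: "bounded_clinear (opB :: 'a \<Rightarrow> 'a::pythagorean)"
  by (rule bounded_clinearI[where K=1]) (simp_all add: opB_add opB_scaleC norm_opB_le)

subsection \<open>The direct limit over finite binary trees\<close>

text \<open>
  A tree whose leaves carry labels in \<open>H\<close> is a pair of a finite binary tree \<open>t\<close> and a vector
  in \<open>H\<^sub>t\<close>, the direct sum of copies of \<open>H\<close> over the leaves of \<open>t\<close>. The relation
  \<open>grow\<close> attaches one caret at one leaf, and the direct limit is the quotient by the equivalence
  relation generated by it. Sums and inner products of labelled trees are taken leaf by leaf after growing
  both trees to a common one.
\<close>

datatype 'a ltree = Lf 'a | Nd "'a ltree" "'a ltree"

inductive grow :: "'a::pythagorean ltree \<Rightarrow> 'a ltree \<Rightarrow> bool" where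
  grow_leaf: "grow (Lf x) (Nd (Lf (opA x)) (Lf (opB x)))"
| grow_left: "grow l l' \<Longrightarrow> grow (Nd l r) (Nd l' r)"
| grow_right: "grow r r' \<Longrightarrow> grow (Nd l r) (Nd l r')"

fun ladd :: "'a::pythagorean ltree \<Rightarrow> 'a ltree \<Rightarrow> 'a ltree" where
  "ladd (Lf x) (Lf y) = Lf (x + y)"
| "ladd (Lf x) (Nd c d) = Nd (ladd (Lf (opA x)) c) (ladd (Lf (opB x)) d)"
| "ladd (Nd a b) (Lf y) = Nd (ladd a (Lf (opA y))) (ladd b (Lf (opB y)))"
| "ladd (Nd a b) (Nd c d) = Nd (ladd a c) (ladd b d)"

fun linner :: "'a::pythagorean ltree \<Rightarrow> 'a ltree \<Rightarrow> complex" where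
  "linner (Lf x) (Lf y) = cinner x y"
| "linner (Lf x) (Nd c d) = linner (Lf (opA x)) c + linner (Lf (opB x)) d"
| "linner (Nd a b) (Lf y) = linner a (Lf (opA y)) + linner b (Lf (opB y))"
| "linner (Nd a b) (Nd c d) = linner a c + linner b d"

primrec lnorm :: "'a::pythagorean ltree \<Rightarrow> real" where
  "lnorm (Lf x) = norm x"
| "lnorm (Nd l r) = sqrt ((lnorm l)\<^sup>2 + (lnorm r)\<^sup>2)"

primrec lleft :: "'a::pythagorean ltree \<Rightarrow> 'a ltree" where
  "lleft (Lf x) = Lf (opA x)"
| "lleft (Nd l r) = l"

primrec lright :: "'a::pythagorean ltree \<Rightarrow> 'a ltree" where
  "lright (Lf x) = Lf (opB x)"
| "lright (Nd l r) = r"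

abbreviation leqv :: "'a::pythagorean ltree \<Rightarrow> 'a ltree \<Rightarrow> bool" (infix "\<sim>\<^sub>l" 50)
  where "leqv \<equiv> equivclp grow"

lemma leqv_refl [simp]: "t \<sim>\<^sub>l t"
  by (simp add: equivclp_def)

lemma leqv_if_grow: "grow t t' \<Longrightarrow> t \<sim>\<^sub>l t'"
  by (rule r_into_equivclp)

lemma leqv_lift:
  assumes "t \<sim>\<^sub>l t'" "\<And>t t'. grow t t' \<Longrightarrow> f t \<sim>\<^sub>l f t'"
  shows "f t \<sim>\<^sub>l f t'"
  using assms(1)
proof (induction rule: equivclp_induct)
  case (step y z)
  then have "f y \<sim>\<^sub>l f z" using assms(2) by (metis equivclp_sym)
  with step.IH show ?case by (metis equivclp_trans)
qed simp

lemma leqv_inv: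
  assumes "t \<sim>\<^sub>l t'" "\<And>t t'. grow t t' \<Longrightarrow> f t = f t'"
  shows "f t = f t'"
  using assms(1) by (induction rule: equivclp_induct) (auto dest: assms(2))

lemma leqv_Nd: "l \<sim>\<^sub>l l' \<Longrightarrow> r \<sim>\<^sub>l r' \<Longrightarrow> Nd l r \<sim>\<^sub>l Nd l' r'"
  using leqv_lift[of l l' "\<lambda>l. Nd l r"] leqv_lift[of r r' "\<lambda>r. Nd l' r"]
  by (meson equivclp_trans grow_left grow_right leqv_if_grow)

lemma ladd_commute: "ladd t s = ladd s t"
  by (induction t s rule: ladd.induct) (auto simp: add.commute)

lemma ladd_grow: "grow t t' \<Longrightarrow> ladd t s \<sim>\<^sub>l ladd t' s"
proof (induction arbitrary: s rule: grow.induct)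
  case (grow_leaf x)
  then show ?case
    using leqv_if_grow[OF grow.grow_leaf] by (cases s) (auto simp: opA_add[symmetric] opB_add[symmetric])
next
  case (grow_left l l' r)
  then show ?case by (cases s) (auto intro: leqv_Nd)
next
  case (grow_right r r' l)
  then show ?case by (cases s) (auto intro: leqv_Nd)
qed

lemma ladd_cong: "t \<sim>\<^sub>l t' \<Longrightarrow> s \<sim>\<^sub>l s' \<Longrightarrow> ladd t s \<sim>\<^sub>l ladd t' s'"
  using leqv_lift[of t t' "\<lambda>t. ladd t s"] leqv_lift[of s s' "\<lambda>s. ladd s t'"]
  by (metis equivclp_trans ladd_commute ladd_grow)

lemma linner_commute: "linner t s = cnj (linner s t)"
  by (induction t s rule: linner.induct) (auto simp: cinner_commute[symmetric])

lemma linner_grow: "grow t t' \<Longrightarrow> linner t s = linner t' s"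
proof (induction arbitrary: s rule: grow.induct)
  case (grow_leaf x)
  then show ?case by (cases s) (auto simp: pythagorean_identity)
next
  case (grow_left l l' r)
  then show ?case by (cases s) auto
next
  case (grow_right r r' l)
  then show ?case by (cases s) auto
qed

lemma linner_cong: "t \<sim>\<^sub>l t' \<Longrightarrow> s \<sim>\<^sub>l s' \<Longrightarrow> linner t s = linner t' s'"
  using leqv_inv[of t t' "\<lambda>t. linner t s"] leqv_inv[of s s' "\<lambda>s. linner s t'"]
  by (metis linner_commute linner_grow)

lemma lnorm_nonneg [simp]: "0 \<le> lnorm t"
  by (induction t) auto

lemma lnorm_split: "lnorm t = sqrt ((lnorm (lleft t))\<^sup>2 + (lnorm (lright t))\<^sup>2)"
  by (cases t) (auto simp: pythagorean_norm)

lemma lnorm_grow: "grow t t' \<Longrightarrow> lnorm t = lnorm t'"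
  by (induction rule: grow.induct) (auto simp: pythagorean_norm)

lemma lnorm_cong: "t \<sim>\<^sub>l t' \<Longrightarrow> lnorm t = lnorm t'"
  by (rule leqv_inv) (auto dest: lnorm_grow)

lemma lleft_cong: "t \<sim>\<^sub>l t' \<Longrightarrow> lleft t \<sim>\<^sub>l lleft t'"
  by (erule leqv_lift) (erule grow.cases; simp add: leqv_if_grow)

lemma lright_cong: "t \<sim>\<^sub>l t' \<Longrightarrow> lright t \<sim>\<^sub>l lright t'"
  by (erule leqv_lift) (erule grow.cases; simp add: leqv_if_grow)

lemma lscaleC_cong: "t \<sim>\<^sub>l t' \<Longrightarrow> map_ltree (scaleC c) t \<sim>\<^sub>l map_ltree (scaleC c) t'"
proof (erule leqv_lift)
  show "map_ltree (scaleC c) t \<sim>\<^sub>l map_ltree (scaleC c) t'" if "grow t t'" for t t' :: "'a ltree"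
    using that
  proof (induction rule: grow.induct)
    case (grow_leaf x)
    then show ?case using leqv_if_grow[OF grow.grow_leaf[of "c *\<^sub>C x"]] by (simp add: opA_scaleC opB_scaleC)
  qed (simp_all add: leqv_Nd)
qed

lemma map_ltree_scaleR: "map_ltree (scaleR r) t = map_ltree (scaleC (complex_of_real r)) (t :: 'a::pythagorean ltree)"
  by (induction t) (simp_all add: scaleR_scaleC)

lemma map_ltree_uminus: "map_ltree uminus t = map_ltree (scaleC (- 1)) (t :: 'a::pythagorean ltree)"
  by (induction t) simp_all

lemma ladd_zero: "ladd (Lf 0) t = t"
  by (induction t) auto

lemma ladd_assoc_Lf: "ladd (Lf (x + y)) s = ladd (Lf x) (ladd (Lf y) s)"
  by (induction s arbitrary: x y) (auto simp: add.assoc opA_add opB_add)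

lemma ladd_assoc: "ladd (ladd t u) s = ladd t (ladd u s)"
proof (induction t u arbitrary: s rule: ladd.induct)
  case (1 x y)
  then show ?case by (simp add: ladd_assoc_Lf)
next
  case (2 x c d)
  then show ?case by (cases s) auto
next
  case (3 a b y)
  then show ?case by (cases s) (auto simp: opA_add opB_add ladd_assoc_Lf[symmetric])
next
  case (4 a b c d)
  then show ?case by (cases s) auto
qed

lemma Lf_zero: "Nd (Lf 0) (Lf 0) \<sim>\<^sub>l Lf 0"
  by (rule equivclp_sym, rule leqv_if_grow) (use grow_leaf[of 0] in simp)

lemma ladd_uminus: "ladd (map_ltree uminus t) t \<sim>\<^sub>l Lf 0"
proof (induction t)
  case (Nd l r)
  then have "Nd (ladd (map_ltree uminus l) l) (ladd (map_ltree uminus r) r) \<sim>\<^sub>l Nd (Lf 0) (Lf 0)"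
    by (rule leqv_Nd)
  from equivclp_trans[OF this Lf_zero] show ?case by simp
qed simp

lemma lscaleC_ladd: "map_ltree (scaleC c) (ladd t s) = ladd (map_ltree (scaleC c) t) (map_ltree (scaleC c) s)"
  by (induction t s rule: ladd.induct) (auto simp: scaleC_add_right opA_scaleC opB_scaleC)

lemma lscaleC_add_left: "map_ltree (scaleC (c + d)) t = ladd (map_ltree (scaleC c) t) (map_ltree (scaleC d) t)"
  by (induction t) (auto simp: scaleC_add_left)

lemma lnorm_triangle: "lnorm (ladd t s) \<le> lnorm t + lnorm s"
proof (induction t s rule: ladd.induct)
  case (1 x y)
  then show ?case by (simp add: norm_triangle_ineq)
next
  case (2 x c d)
  have "lnorm (ladd (Lf x) (Nd c d))
      \<le> sqrt ((lnorm (Lf (opA x)) + lnorm c)\<^sup>2 + (lnorm (Lf (opB x)) + lnorm d)\<^sup>2)"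
    using 2 by (simp del: lnorm.simps(1)) (intro add_mono power_mono; simp)
  also have "\<dots> \<le> sqrt ((lnorm (Lf (opA x)))\<^sup>2 + (lnorm (Lf (opB x)))\<^sup>2) + sqrt ((lnorm c)\<^sup>2 + (lnorm d)\<^sup>2)"
    by (rule real_sqrt_sum_squares_triangle_ineq)
  also have "\<dots> = lnorm (Lf x) + lnorm (Nd c d)" by (simp add: pythagorean_norm)
  finally show ?case .
next
  case (3 a b y)
  have "lnorm (ladd (Nd a b) (Lf y))
      \<le> sqrt ((lnorm a + lnorm (Lf (opA y)))\<^sup>2 + (lnorm b + lnorm (Lf (opB y)))\<^sup>2)"
    using 3 by (simp del: lnorm.simps(1)) (intro add_mono power_mono; simp)
  also have "\<dots> \<le> sqrt ((lnorm a)\<^sup>2 + (lnorm b)\<^sup>2) + sqrt ((lnorm (Lf (opA y)))\<^sup>2 + (lnorm (Lf (opB y)))\<^sup>2)"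
    by (rule real_sqrt_sum_squares_triangle_ineq)
  also have "\<dots> = lnorm (Nd a b) + lnorm (Lf y)" by (simp add: pythagorean_norm)
  finally show ?case .
next
  case (4 a b c d)
  have "lnorm (ladd (Nd a b) (Nd c d)) \<le> sqrt ((lnorm a + lnorm c)\<^sup>2 + (lnorm b + lnorm d)\<^sup>2)"
    using 4 by simp (intro add_mono power_mono; simp)
  also have "\<dots> \<le> sqrt ((lnorm a)\<^sup>2 + (lnorm b)\<^sup>2) + sqrt ((lnorm c)\<^sup>2 + (lnorm d)\<^sup>2)"
    by (rule real_sqrt_sum_squares_triangle_ineq)
  finally show ?case by simp
qed

lemma lnorm_scaleC: "lnorm (map_ltree (scaleC c) t) = cmod c * lnorm t"
  by (induction t) (auto simp: norm_scaleC power_mult_distrib distrib_left[symmetric] real_sqrt_mult)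

lemma lnorm_eq_0: "lnorm t = 0 \<longleftrightarrow> t \<sim>\<^sub>l Lf 0"
proof
  show "lnorm t = 0 \<Longrightarrow> t \<sim>\<^sub>l Lf 0"
  proof (induction t)
    case (Nd l r)
    then have "Nd l r \<sim>\<^sub>l Nd (Lf 0) (Lf 0)" by (auto intro!: leqv_Nd simp: sum_power2_eq_zero_iff)
    then show ?case using Lf_zero by (metis equivclp_trans)
  qed simp
qed (auto dest: lnorm_cong)

lemma linner_Lf_add: "linner (Lf (x + y)) s = linner (Lf x) s + linner (Lf y) s"
  by (induction s arbitrary: x y) (auto simp: cinner_add_left opA_add opB_add)

lemma linner_ladd_left: "linner (ladd t u) s = linner t s + linner u s"
proof (induction t u arbitrary: s rule: ladd.induct)
  case (1 x y)
  then show ?case by (simp add: linner_Lf_add)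
next
  case (2 x c d)
  show ?case
  proof (cases s)
    case (Lf z)
    then show ?thesis using pythagorean_identity[of x z] by (simp add: 2 algebra_simps)
  qed (simp add: 2)
next
  case (3 a b y)
  show ?case
  proof (cases s)
    case (Lf z)
    then show ?thesis using pythagorean_identity[of y z] by (simp add: 3 algebra_simps)
  qed (simp add: 3)
next
  case (4 a b c d)
  show ?case by (cases s) (auto simp: 4)
qed

lemma linner_scaleC_left: "linner (map_ltree (scaleC c) t) s = c * linner t s"
  by (induction t s rule: linner.induct) (auto simp: cinner_scaleC_left opA_scaleC[symmetric] opB_scaleC[symmetric]
    distrib_left)

lemma linner_self: "linner t t = complex_of_real ((lnorm t)\<^sup>2)"
  by (induction t) (auto simp: cinner_self simp flip: of_real_power of_real_add)

quotient_type (overloaded) 'a dlim = "'a::pythagorean ltree" / leqv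
  by (rule equivp_evquivclp)

instantiation dlim :: (pythagorean) pythagorean
begin

lift_definition zero_dlim :: "'a dlim" is "Lf 0" .

lift_definition plus_dlim :: "'a dlim \<Rightarrow> 'a dlim \<Rightarrow> 'a dlim" is ladd
  by (rule ladd_cong)

lift_definition uminus_dlim :: "'a dlim \<Rightarrow> 'a dlim" is "map_ltree uminus"
  unfolding map_ltree_uminus by (rule lscaleC_cong)

lift_definition scaleR_dlim :: "real \<Rightarrow> 'a dlim \<Rightarrow> 'a dlim" is "\<lambda>r. map_ltree (scaleR r)"
  unfolding map_ltree_scaleR by (rule lscaleC_cong)

lift_definition scaleC_dlim :: "complex \<Rightarrow> 'a dlim \<Rightarrow> 'a dlim" is "\<lambda>c. map_ltree (scaleC c)"
  by (rule lscaleC_cong)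

lift_definition norm_dlim :: "'a dlim \<Rightarrow> real" is lnorm
  by (rule lnorm_cong)

lift_definition cinner_dlim :: "'a dlim \<Rightarrow> 'a dlim \<Rightarrow> complex" is linner
  by (rule linner_cong)

lift_definition opA_dlim :: "'a dlim \<Rightarrow> 'a dlim" is lleft
  by (rule lleft_cong)

lift_definition opB_dlim :: "'a dlim \<Rightarrow> 'a dlim" is lright
  by (rule lright_cong)

definition minus_dlim :: "'a dlim \<Rightarrow> 'a dlim \<Rightarrow> 'a dlim"
  where "minus_dlim x y = x + - y"

definition dist_dlim :: "'a dlim \<Rightarrow> 'a dlim \<Rightarrow> real"
  where "dist_dlim x y = norm (x - y)"

definition sgn_dlim :: "'a dlim \<Rightarrow> 'a dlim"
  where "sgn_dlim x = inverse (norm x) *\<^sub>R x"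

definition uniformity_dlim :: "('a dlim \<times> 'a dlim) filter"
  where "uniformity_dlim = (INF e\<in>{0<..}. principal {(x, y). dist x y < e})"

definition open_dlim :: "'a dlim set \<Rightarrow> bool"
  where "open_dlim U \<longleftrightarrow> (\<forall>x\<in>U. \<forall>\<^sub>F (x', y) in uniformity. x' = x \<longrightarrow> y \<in> U)"

instance
proof
  fix x y z :: "'a dlim" and a b :: real and c d :: complex
  show "x + y + z = x + (y + z)" by transfer (simp add: ladd_assoc)
  show "x + y = y + x" by transfer (simp add: ladd_commute)
  show "0 + x = x" by transfer (simp add: ladd_zero)
  show "- x + x = 0" by transfer (rule ladd_uminus)
  show "x - y = x + - y" by (simp add: minus_dlim_def)
  show "a *\<^sub>R (x + y) = a *\<^sub>R x + a *\<^sub>R y"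
    by transfer (simp add: map_ltree_scaleR lscaleC_ladd)
  show "(a + b) *\<^sub>R x = a *\<^sub>R x + b *\<^sub>R x"
    by transfer (simp add: map_ltree_scaleR lscaleC_add_left)
  show "a *\<^sub>R b *\<^sub>R x = (a * b) *\<^sub>R x" by transfer (simp add: ltree.map_comp o_def)
  show "1 *\<^sub>R x = x" by transfer (simp add: ltree.map_ident_strong)
  show "c *\<^sub>C (x + y) = c *\<^sub>C x + c *\<^sub>C y" by transfer (simp add: lscaleC_ladd)
  show "(c + d) *\<^sub>C x = c *\<^sub>C x + d *\<^sub>C x" by transfer (simp add: lscaleC_add_left)
  show "c *\<^sub>C d *\<^sub>C x = (c * d) *\<^sub>C x" by transfer (simp add: ltree.map_comp o_def)
  show "a *\<^sub>R x = complex_of_real a *\<^sub>C x" by transfer (simp add: map_ltree_scaleR)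
  show "dist x y = norm (x - y)" by (simp add: dist_dlim_def)
  show "sgn x = inverse (norm x) *\<^sub>R x" by (simp add: sgn_dlim_def)
  show "uniformity = (INF e\<in>{0<..}. principal {(x::'a dlim, y). dist x y < e})"
    by (simp add: uniformity_dlim_def)
  show "open U \<longleftrightarrow> (\<forall>x\<in>U. \<forall>\<^sub>F (x', y) in uniformity. x' = x \<longrightarrow> y \<in> U)" for U :: "'a dlim set"
    by (simp add: open_dlim_def)
  show "norm x = 0 \<longleftrightarrow> x = 0" by transfer (rule lnorm_eq_0)
  show "norm (x + y) \<le> norm x + norm y" by transfer (rule lnorm_triangle)
  show "norm (a *\<^sub>R x) = \<bar>a\<bar> * norm x" by transfer (simp add: map_ltree_scaleR lnorm_scaleC)
  show "norm (c *\<^sub>C x) = cmod c * norm x" by transfer (rule lnorm_scaleC)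
  show "cinner x y = cnj (cinner y x)" by transfer (rule linner_commute)
  show "cinner (x + y) z = cinner x z + cinner y z" by transfer (rule linner_ladd_left)
  show "cinner (c *\<^sub>C x) y = c * cinner x y" by transfer (rule linner_scaleC_left)
  show "cinner x x = complex_of_real ((norm x)\<^sup>2)" by transfer (rule linner_self)
  have "lleft (ladd t s) = ladd (lleft t) (lleft s)" "lright (ladd t s) = ladd (lright t) (lright s)"
    for t s :: "'a ltree"
    by (cases t; cases s; simp add: opA_add opB_add)+
  then show "opA (x + y) = opA x + opA y" "opB (x + y) = opB x + opB y"
    by (transfer, simp)+
  have "lleft (map_ltree (scaleC c) t) = map_ltree (scaleC c) (lleft t)"
    "lright (map_ltree (scaleC c) t) = map_ltree (scaleC c) (lright t)" for t :: "'a ltree"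
    by (cases t; simp add: opA_scaleC opB_scaleC)+
  then show "opA (c *\<^sub>C x) = c *\<^sub>C opA x" "opB (c *\<^sub>C x) = c *\<^sub>C opB x"
    by (transfer, simp)+
  have "linner (lleft t) (lleft s) + linner (lright t) (lright s) = linner t s" for t s :: "'a ltree"
    by (cases t; cases s; simp add: pythagorean_identity)
  then show "cinner (opA x) (opA y) + cinner (opB x) (opB y) = cinner x y" by transfer
qed

end

subsection \<open>Completion\<close>

lemma Cauchy_opA: "Cauchy X \<Longrightarrow> Cauchy (\<lambda>n. opA (X n :: 'a::pythagorean))"
  using bounded_linear.Cauchy[of "opA :: 'a \<Rightarrow> 'a" X] bounded_clinear_opA[where 'a='a]
  by (simp add: bounded_clinear_def)

lemma Cauchy_opB: "Cauchy X \<Longrightarrow> Cauchy (\<lambda>n. opB (X n :: 'a::pythagorean))"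
  using bounded_linear.Cauchy[of "opB :: 'a \<Rightarrow> 'a" X] bounded_clinear_opB[where 'a='a]
  by (simp add: bounded_clinear_def)

instantiation completion :: (pythagorean) pmodule
begin

lift_definition opA_completion :: "'a completion \<Rightarrow> 'a completion" is "\<lambda>X n. opA (X n)"
proof (elim conjE, intro conjI)
  fix X X' :: "nat \<Rightarrow> 'a"
  interpret bounded_linear "opA :: 'a \<Rightarrow> 'a" using bounded_clinear_opA[where 'a='a] by (simp add: bounded_clinear_def)
  assume "(\<lambda>n. X n - X' n) \<longlonglongrightarrow> 0"
  from tendsto_zero[OF this] show "(\<lambda>n. opA (X n) - opA (X' n)) \<longlonglongrightarrow> 0" by (simp add: diff)
qed (simp_all add: Cauchy_opA)

lift_definition opB_completion :: "'a completion \<Rightarrow> 'a completion" is "\<lambda>X n. opB (X n)"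
proof (elim conjE, intro conjI)
  fix X X' :: "nat \<Rightarrow> 'a"
  interpret bounded_linear "opB :: 'a \<Rightarrow> 'a" using bounded_clinear_opB[where 'a='a] by (simp add: bounded_clinear_def)
  assume "(\<lambda>n. X n - X' n) \<longlonglongrightarrow> 0"
  from tendsto_zero[OF this] show "(\<lambda>n. opB (X n) - opB (X' n)) \<longlonglongrightarrow> 0" by (simp add: diff)
qed (simp_all add: Cauchy_opB)

instance
proof
  fix x y :: "'a completion" and c :: complex
  show "opA (x + y) = opA x + opA y" by transfer (simp add: Cauchy_add Cauchy_opA opA_add)
  show "opB (x + y) = opB x + opB y" by transfer (simp add: Cauchy_add Cauchy_opB opB_add)
  show "opA (c *\<^sub>C x) = c *\<^sub>C opA x" by transfer (simp add: Cauchy_scaleC Cauchy_opA opA_scaleC)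
  show "opB (c *\<^sub>C x) = c *\<^sub>C opB x" by transfer (simp add: Cauchy_scaleC Cauchy_opB opB_scaleC)
  show "cinner (opA x) (opA y) + cinner (opB x) (opB y) = cinner x y"
  proof (transfer, elim conjE)
    fix X Y :: "nat \<Rightarrow> 'a" assume XY: "Cauchy X" "Cauchy Y"
    have "(\<lambda>n. cinner (opA (X n)) (opA (Y n)) + cinner (opB (X n)) (opB (Y n)))
      \<longlonglongrightarrow> lim (\<lambda>n. cinner (opA (X n)) (opA (Y n))) + lim (\<lambda>n. cinner (opB (X n)) (opB (Y n)))"
      by (intro tendsto_add cinner_completion_lim Cauchy_opA Cauchy_opB XY)
    then show "lim (\<lambda>n. cinner (opA (X n)) (opA (Y n))) + lim (\<lambda>n. cinner (opB (X n)) (opB (Y n)))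
      = lim (\<lambda>n. cinner (X n) (Y n))"
      unfolding pythagorean_identity by (rule limI[symmetric])
  qed
qed

end

text \<open>
  For a P-module \<open>'a\<close>, \<open>'a dilation\<close> is the Hilbert space completion of the direct limit. Its own
  P-module structure consists of the operators \<open>\<tau>\<^sub>0\<close>, \<open>\<tau>\<^sub>1\<close> extending the maps
  that send a labelled tree to its left and right subtrees. The module itself sits inside
  as the set of all \<open>embed (abs_dlim (Lf \<xi>))\<close>.
\<close>

type_synonym 'a dilation = "'a dlim completion"

abbreviation tau0 :: "'a::pmodule dilation \<Rightarrow> 'a dilation" where "tau0 \<equiv> opA"
abbreviation tau1 :: "'a::pmodule dilation \<Rightarrow> 'a dilation" where "tau1 \<equiv> opB"

section \<open>The Cuntz algebra\<close>

text \<open>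
  The universal C*-algebra generated by \<open>s\<^sub>0, s\<^sub>1\<close> subject to the Cuntz relations is obtained in
  the usual three steps: the universal unital *-algebra with these generators and relations (a quotient of
  formal expressions), its quotient by the vectors of norm zero for the largest C*-seminorm, and the
  completion. The index of a generator is a Boolean, \<open>False\<close> for \<open>0\<close> and \<open>True\<close> for \<open>1\<close>.
\<close>

datatype cterm =
  Gen bool | Zero | One | Add cterm cterm | Mult cterm cterm | Scale complex cterm | Star cterm

inductive cuntz_eq :: "cterm \<Rightarrow> cterm \<Rightarrow> bool" (infix "\<doteq>" 50) where
  refl: "x \<doteq> x"
| sym: "x \<doteq> y \<Longrightarrow> y \<doteq> x"
| trans: "x \<doteq> y \<Longrightarrow> y \<doteq> z \<Longrightarrow> x \<doteq> z"
| cong_add: "x \<doteq> x' \<Longrightarrow> y \<doteq> y' \<Longrightarrow> Add x y \<doteq> Add x' y'"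
| cong_mult: "x \<doteq> x' \<Longrightarrow> y \<doteq> y' \<Longrightarrow> Mult x y \<doteq> Mult x' y'"
| cong_scale: "x \<doteq> x' \<Longrightarrow> Scale c x \<doteq> Scale c x'"
| cong_star: "x \<doteq> x' \<Longrightarrow> Star x \<doteq> Star x'"
| add_assoc: "Add (Add x y) z \<doteq> Add x (Add y z)"
| add_commute: "Add x y \<doteq> Add y x"
| add_zero: "Add Zero x \<doteq> x"
| add_uminus: "Add (Scale (- 1) x) x \<doteq> Zero"
| scale_add_right: "Scale c (Add x y) \<doteq> Add (Scale c x) (Scale c y)"
| scale_add_left: "Scale (c + d) x \<doteq> Add (Scale c x) (Scale d x)"
| scale_scale: "Scale c (Scale d x) \<doteq> Scale (c * d) x"
| scale_one: "Scale 1 x \<doteq> x"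
| mult_assoc: "Mult (Mult x y) z \<doteq> Mult x (Mult y z)"
| mult_one_left: "Mult One x \<doteq> x"
| mult_one_right: "Mult x One \<doteq> x"
| mult_add_left: "Mult (Add x y) z \<doteq> Add (Mult x z) (Mult y z)"
| mult_add_right: "Mult x (Add y z) \<doteq> Add (Mult x y) (Mult x z)"
| mult_scale_left: "Mult (Scale c x) y \<doteq> Scale c (Mult x y)"
| mult_scale_right: "Mult x (Scale c y) \<doteq> Scale c (Mult x y)"
| star_star: "Star (Star x) \<doteq> x"
| star_add: "Star (Add x y) \<doteq> Add (Star x) (Star y)"
| star_scale: "Star (Scale c x) \<doteq> Scale (cnj c) (Star x)"
| star_mult: "Star (Mult x y) \<doteq> Mult (Star y) (Star x)"
| isometry: "Mult (Star (Gen b)) (Gen b) \<doteq> One"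
| ranges: "Add (Mult (Gen False) (Star (Gen False))) (Mult (Gen True) (Star (Gen True))) \<doteq> One"

quotient_type cuntz_alg = cterm / cuntz_eq
  by (rule equivpI) (auto intro!: reflpI sympI transpI intro: cuntz_eq.intros)

instantiation cuntz_alg :: star_algebra
begin

lift_definition zero_cuntz_alg :: cuntz_alg is Zero .
lift_definition one_cuntz_alg :: cuntz_alg is One .
lift_definition plus_cuntz_alg :: "cuntz_alg \<Rightarrow> cuntz_alg \<Rightarrow> cuntz_alg" is Add
  by (rule cuntz_eq.cong_add)
lift_definition uminus_cuntz_alg :: "cuntz_alg \<Rightarrow> cuntz_alg" is "Scale (- 1)"
  by (rule cuntz_eq.cong_scale)
lift_definition times_cuntz_alg :: "cuntz_alg \<Rightarrow> cuntz_alg \<Rightarrow> cuntz_alg" is Mult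
  by (rule cuntz_eq.cong_mult)
lift_definition scaleC_cuntz_alg :: "complex \<Rightarrow> cuntz_alg \<Rightarrow> cuntz_alg" is Scale
  by (rule cuntz_eq.cong_scale)
lift_definition star_cuntz_alg :: "cuntz_alg \<Rightarrow> cuntz_alg" is Star
  by (rule cuntz_eq.cong_star)
definition minus_cuntz_alg :: "cuntz_alg \<Rightarrow> cuntz_alg \<Rightarrow> cuntz_alg"
  where "minus_cuntz_alg x y = x + - y"
definition scaleR_cuntz_alg :: "real \<Rightarrow> cuntz_alg \<Rightarrow> cuntz_alg"
  where "scaleR_cuntz_alg r x = complex_of_real r *\<^sub>C x"

instance
proof
  fix x y z :: cuntz_alg and c d :: complex and a b :: real
  show "x + y + z = x + (y + z)" by transfer (rule cuntz_eq.add_assoc)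
  show "x + y = y + x" by transfer (rule cuntz_eq.add_commute)
  show "0 + x = x" by transfer (rule cuntz_eq.add_zero)
  show "- x + x = 0" by transfer (rule cuntz_eq.add_uminus)
  show "x - y = x + - y" by (rule minus_cuntz_alg_def)
  show R: "c *\<^sub>C (x + y) = c *\<^sub>C x + c *\<^sub>C y" for c x and y :: cuntz_alg
    by transfer (rule cuntz_eq.scale_add_right)
  show L: "(c + d) *\<^sub>C x = c *\<^sub>C x + d *\<^sub>C x" for c d and x :: cuntz_alg
    by transfer (rule cuntz_eq.scale_add_left)
  show S: "c *\<^sub>C d *\<^sub>C x = (c * d) *\<^sub>C x" for c d and x :: cuntz_alg
    by transfer (rule cuntz_eq.scale_scale)
  have one: "1 *\<^sub>C x = x" by transfer (rule cuntz_eq.scale_one)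
  show "a *\<^sub>R x = complex_of_real a *\<^sub>C x" by (rule scaleR_cuntz_alg_def)
  show "a *\<^sub>R (x + y) = a *\<^sub>R x + a *\<^sub>R y" by (simp add: scaleR_cuntz_alg_def R)
  show "(a + b) *\<^sub>R x = a *\<^sub>R x + b *\<^sub>R x" by (simp add: scaleR_cuntz_alg_def L)
  show "a *\<^sub>R b *\<^sub>R x = (a * b) *\<^sub>R x" by (simp add: scaleR_cuntz_alg_def S)
  show "1 *\<^sub>R x = x" by (simp add: scaleR_cuntz_alg_def one)
  show "x * y * z = x * (y * z)" by transfer (rule cuntz_eq.mult_assoc)
  show "1 * x = x" by transfer (rule cuntz_eq.mult_one_left)
  show "x * 1 = x" by transfer (rule cuntz_eq.mult_one_right)
  show "(x + y) * z = x * z + y * z" by transfer (rule cuntz_eq.mult_add_left)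
  show "x * (y + z) = x * y + x * z" by transfer (rule cuntz_eq.mult_add_right)
  show "(c *\<^sub>C x) * y = c *\<^sub>C (x * y)" by transfer (rule cuntz_eq.mult_scale_left)
  show "x * (c *\<^sub>C y) = c *\<^sub>C (x * y)" by transfer (rule cuntz_eq.mult_scale_right)
  show "star (star x) = x" by transfer (rule cuntz_eq.star_star)
  show "star (x + y) = star x + star y" by transfer (rule cuntz_eq.star_add)
  show "star (c *\<^sub>C x) = cnj c *\<^sub>C star x" by transfer (rule cuntz_eq.star_scale)
  show "star (x * y) = star y * star x" by transfer (rule cuntz_eq.star_mult)
qed

end

lift_definition alg_gen :: "bool \<Rightarrow> cuntz_alg" is Gen .

lemma alg_gen_isometry: "star (alg_gen b) * alg_gen b = 1"
  by transfer (rule cuntz_eq.isometry)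

lemma alg_gen_ranges: "alg_gen False * star (alg_gen False) + alg_gen True * star (alg_gen True) = 1"
  by transfer (rule cuntz_eq.ranges)

lemma cuntz_alg_induct [case_names gen zero one add mult scale star]:
  assumes "\<And>b. P (alg_gen b)" "P 0" "P 1" "\<And>x y. P x \<Longrightarrow> P y \<Longrightarrow> P (x + y)"
    "\<And>x y. P x \<Longrightarrow> P y \<Longrightarrow> P (x * y)" "\<And>c x. P x \<Longrightarrow> P (c *\<^sub>C x)" "\<And>x. P x \<Longrightarrow> P (star x)"
  shows "P x"
proof -
  have "P (abs_cuntz_alg t)" for t
    by (induction t)
      (simp_all add: assms alg_gen.abs_eq[symmetric] zero_cuntz_alg.abs_eq[symmetric]
        one_cuntz_alg.abs_eq[symmetric] plus_cuntz_alg.abs_eq[symmetric] times_cuntz_alg.abs_eq[symmetric]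
        scaleC_cuntz_alg.abs_eq[symmetric] star_cuntz_alg.abs_eq[symmetric])
  then show ?thesis by (metis Quotient_abs_rep[OF Quotient_cuntz_alg])
qed

subsection \<open>The universal C*-norm\<close>

definition cstar_seminorm :: "('a::star_algebra \<Rightarrow> real) \<Rightarrow> bool" where
  "cstar_seminorm \<nu> \<longleftrightarrow>
    (\<forall>x. 0 \<le> \<nu> x) \<and>
    (\<forall>x y. \<nu> (x + y) \<le> \<nu> x + \<nu> y) \<and>
    (\<forall>c x. \<nu> (c *\<^sub>C x) = cmod c * \<nu> x) \<and>
    (\<forall>x y. \<nu> (x * y) \<le> \<nu> x * \<nu> y) \<and>
    (\<forall>x. \<nu> (star x * x) = (\<nu> x)\<^sup>2)"

definition universal_norm :: "cuntz_alg \<Rightarrow> real" where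
  "universal_norm x = (SUP \<nu>\<in>Collect cstar_seminorm. \<nu> x)"

lemma cstar_seminormD:
  assumes "cstar_seminorm \<nu>"
  shows "0 \<le> \<nu> x" "\<nu> (x + y) \<le> \<nu> x + \<nu> y" "\<nu> (c *\<^sub>C x) = cmod c * \<nu> x"
    "\<nu> (x * y) \<le> \<nu> x * \<nu> y" "\<nu> (star x * x) = (\<nu> x)\<^sup>2"
  using assms unfolding cstar_seminorm_def by blast+

lemma cstar_seminorm_star_le: assumes "cstar_seminorm \<nu>" shows "\<nu> (star x) \<le> \<nu> x"
proof (cases "\<nu> (star x) = 0")
  case False
  have "(\<nu> (star x))\<^sup>2 \<le> \<nu> x * \<nu> (star x)"
    using cstar_seminormD(4,5)[OF assms] by (metis star_algebra_class.star_star)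
  then show ?thesis using False cstar_seminormD(1)[OF assms, of "star x"] by (simp add: power2_eq_square)
qed (simp add: cstar_seminormD(1)[OF assms])

lemma cstar_seminorm_zero: "cstar_seminorm \<nu> \<Longrightarrow> \<nu> 0 = 0"
  using cstar_seminormD(3)[of \<nu> 0 0] by simp

lemma cstar_seminorm_one: assumes "cstar_seminorm \<nu>" shows "\<nu> 1 \<le> 1"
proof -
  have star1: "star 1 = (1 :: 'a)"
    by (metis mult_1_right mult_1_left star_algebra_class.star_mult star_algebra_class.star_star)
  have "(\<nu> 1)\<^sup>2 = \<nu> 1"
    using cstar_seminormD(5)[OF assms, of 1] by (simp add: star1)
  then show ?thesis by (metis abs_1 linorder_le_cases power2_eq_square mult_left_cancel mult_1_right order_refl zero_le_one)
qed

lemma universal_norm_bdd: "bdd_above ((\<lambda>\<nu>. \<nu> x) ` Collect (cstar_seminorm :: (cuntz_alg \<Rightarrow> real) \<Rightarrow> bool))"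
proof -
  have "\<exists>M. \<forall>\<nu>. cstar_seminorm \<nu> \<longrightarrow> \<nu> x \<le> M"
  proof (induction x rule: cuntz_alg_induct)
    case (gen b)
    have "\<nu> (alg_gen b) \<le> 1" if "cstar_seminorm \<nu>" for \<nu>
    proof -
      have "(\<nu> (alg_gen b))\<^sup>2 \<le> 1\<^sup>2"
        using cstar_seminormD(5)[OF that, of "alg_gen b"] cstar_seminorm_one[OF that]
        by (simp add: alg_gen_isometry)
      then show ?thesis by (rule power2_le_imp_le) simp
    qed
    then show ?case by blast
  next
    case zero
    then show ?case using cstar_seminorm_zero by (metis order_refl)
  next
    case one
    then show ?case using cstar_seminorm_one by blast
  next
    case (add x y)
    then obtain M N where "\<And>\<nu>. cstar_seminorm \<nu> \<Longrightarrow> \<nu> x \<le> M" "\<And>\<nu>. cstar_seminorm \<nu> \<Longrightarrow> \<nu> y \<le> N"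
      by metis
    then have "\<nu> (x + y) \<le> M + N" if "cstar_seminorm \<nu>" for \<nu>
      using cstar_seminormD(2)[OF that, of x y] that by (metis add_mono order_trans)
    then show ?case by blast
  next
    case (mult x y)
    then obtain M N where MN: "\<And>\<nu>. cstar_seminorm \<nu> \<Longrightarrow> \<nu> x \<le> M" "\<And>\<nu>. cstar_seminorm \<nu> \<Longrightarrow> \<nu> y \<le> N"
      by metis
    have "\<nu> (x * y) \<le> M * N" if \<nu>: "cstar_seminorm \<nu>" for \<nu>
    proof -
      have "\<nu> x * \<nu> y \<le> M * N"
        using MN[OF \<nu>] cstar_seminormD(1)[OF \<nu>] by (meson mult_mono order_trans)
      then show ?thesis using cstar_seminormD(4)[OF \<nu>, of x y] by simp
    qed
    then show ?case by blast
  next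
    case (scale c x)
    then obtain M where "\<And>\<nu>. cstar_seminorm \<nu> \<Longrightarrow> \<nu> x \<le> M" by metis
    then have "\<nu> (c *\<^sub>C x) \<le> cmod c * M" if "cstar_seminorm \<nu>" for \<nu>
      using that by (simp add: cstar_seminormD(3) mult_left_mono)
    then show ?case by blast
  next
    case (star x)
    then show ?case using cstar_seminorm_star_le by (meson order_trans)
  qed
  then show ?thesis by (auto simp: bdd_above_def)
qed

lemma universal_norm_upper: "cstar_seminorm \<nu> \<Longrightarrow> \<nu> x \<le> universal_norm x"
  unfolding universal_norm_def by (rule cSUP_upper[OF _ universal_norm_bdd]) simp

lemma cstar_seminorm_trivial: "cstar_seminorm (\<lambda>x. 0)"
  by (simp add: cstar_seminorm_def)

lemma universal_norm_least:
  "(\<And>\<nu>. cstar_seminorm \<nu> \<Longrightarrow> \<nu> x \<le> M) \<Longrightarrow> universal_norm x \<le> M"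
  unfolding universal_norm_def using cstar_seminorm_trivial by (intro cSUP_least) auto

lemma cstar_seminorm_universal: "cstar_seminorm universal_norm"
  unfolding cstar_seminorm_def
proof (intro conjI allI)
  fix x y :: cuntz_alg and c :: complex
  show nonneg: "0 \<le> universal_norm x" for x
    using universal_norm_upper[OF cstar_seminorm_trivial] .
  show "universal_norm (x + y) \<le> universal_norm x + universal_norm y"
    by (rule universal_norm_least) (meson add_mono cstar_seminormD(2) order_trans universal_norm_upper)
  have le: "universal_norm (c *\<^sub>C x) \<le> cmod c * universal_norm x" for c x
    by (rule universal_norm_least) (simp add: cstar_seminormD(3) mult_left_mono universal_norm_upper)
  show "universal_norm (c *\<^sub>C x) = cmod c * universal_norm x"
  proof (cases "c = 0")
    case True
    then show ?thesis using le[of c x] nonneg[of "c *\<^sub>C x"] by simp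
  next
    case False
    have "universal_norm x \<le> cmod (inverse c) * universal_norm (c *\<^sub>C x)"
      using le[of "inverse c" "c *\<^sub>C x"] False by (simp add: scaleC_scaleC)
    then have "cmod c * universal_norm x \<le> universal_norm (c *\<^sub>C x)"
      using False by (simp add: norm_inverse inverse_eq_divide[symmetric] pos_le_divide_eq[symmetric]
          divide_inverse mult.commute)
    with le[of c x] show ?thesis by simp
  qed
  show "universal_norm (x * y) \<le> universal_norm x * universal_norm y"
    by (rule universal_norm_least)
      (meson cstar_seminormD(1,4) mult_mono nonneg order_trans universal_norm_upper)
  show "universal_norm (star x * x) = (universal_norm x)\<^sup>2"
  proof (rule antisym)
    show "universal_norm (star x * x) \<le> (universal_norm x)\<^sup>2"
      by (rule universal_norm_least) (simp add: cstar_seminormD(1,5) power_mono universal_norm_upper)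
    have "universal_norm x \<le> sqrt (universal_norm (star x * x))"
      by (rule universal_norm_least)
        (metis cstar_seminormD(5) real_le_rsqrt universal_norm_upper)
    then show "(universal_norm x)\<^sup>2 \<le> universal_norm (star x * x)"
      using nonneg by (metis real_sqrt_le_iff real_sqrt_pow2 power_mono)
  qed
qed

lemmas unorm = cstar_seminormD[OF cstar_seminorm_universal] cstar_seminorm_star_le[OF cstar_seminorm_universal]
  cstar_seminorm_zero[OF cstar_seminorm_universal]

lemma unorm_minus: "universal_norm (- x) = universal_norm x"
  using unorm(3)[of "-1" x] by simp

lemma unorm_diff_triangle: "universal_norm (x - z) \<le> universal_norm (x - y) + universal_norm (y - z)"
  using unorm(2)[of "x - y" "y - z"] by simp

lemma unorm_diff_commute: "universal_norm (x - y) = universal_norm (y - x)"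
  using unorm_minus[of "x - y"] by simp

lemma unorm_le0_iff: "universal_norm x \<le> 0 \<longleftrightarrow> universal_norm x = 0"
  using unorm(1)[of x] by linarith

lemma unorm_diff_eq_0: "universal_norm (x - y) = 0 \<Longrightarrow> universal_norm x = universal_norm y"
  using unorm(2)[of "x - y" y] unorm(2)[of "y - x" x] unorm_diff_commute[of x y] by simp

quotient_type cuntz_pre = cuntz_alg / "\<lambda>x y. universal_norm (x - y) = 0"
proof (rule equivpI)
  show "reflp (\<lambda>x y. universal_norm (x - y) = 0)" by (rule reflpI) (simp add: unorm)
  show "symp (\<lambda>x y. universal_norm (x - y) = 0)" by (rule sympI) (simp add: unorm_diff_commute)
  show "transp (\<lambda>x y. universal_norm (x - y) = 0)"
    by (rule transpI) (metis add_0 unorm_diff_triangle unorm_le0_iff)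
qed

instantiation cuntz_pre :: pre_cstar_algebra
begin

lift_definition zero_cuntz_pre :: cuntz_pre is 0 .
lift_definition one_cuntz_pre :: cuntz_pre is 1 .

lift_definition plus_cuntz_pre :: "cuntz_pre \<Rightarrow> cuntz_pre \<Rightarrow> cuntz_pre" is "(+)"
proof -
  fix x x' y y' :: cuntz_alg
  assume "universal_norm (x - x') = 0" "universal_norm (y - y') = 0"
  then show "universal_norm (x + y - (x' + y')) = 0"
    using unorm(2)[of "x - x'" "y - y'"] by (simp add: add_diff_add unorm_le0_iff)
qed

lift_definition scaleC_cuntz_pre :: "complex \<Rightarrow> cuntz_pre \<Rightarrow> cuntz_pre" is scaleC
  by (simp add: complex_vec.scale_right_diff_distrib[symmetric] unorm)

lift_definition uminus_cuntz_pre :: "cuntz_pre \<Rightarrow> cuntz_pre" is uminus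
  by (metis minus_diff_minus unorm_minus)

lift_definition times_cuntz_pre :: "cuntz_pre \<Rightarrow> cuntz_pre \<Rightarrow> cuntz_pre" is "(*)"
proof -
  fix x x' y y' :: cuntz_alg
  assume 0: "universal_norm (x - x') = 0" "universal_norm (y - y') = 0"
  have "x * y - x' * y' = (x - x') * y + x' * (y - y')" by (simp add: algebra_simps)
  then show "universal_norm (x * y - x' * y') = 0"
    using unorm(2)[of "(x - x') * y" "x' * (y - y')"] unorm(4)[of "x - x'" y] unorm(4)[of x' "y - y'"]
      unorm_le0_iff[of "x * y - x' * y'"] by (simp add: 0)
qed

lift_definition star_cuntz_pre :: "cuntz_pre \<Rightarrow> cuntz_pre" is star
  by (metis star_diff unorm(6) unorm_le0_iff)

lift_definition norm_cuntz_pre :: "cuntz_pre \<Rightarrow> real" is universal_norm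
  by (rule unorm_diff_eq_0)

definition minus_cuntz_pre :: "cuntz_pre \<Rightarrow> cuntz_pre \<Rightarrow> cuntz_pre"
  where "minus_cuntz_pre x y = x + - y"

definition scaleR_cuntz_pre :: "real \<Rightarrow> cuntz_pre \<Rightarrow> cuntz_pre"
  where "scaleR_cuntz_pre r x = complex_of_real r *\<^sub>C x"

definition dist_cuntz_pre :: "cuntz_pre \<Rightarrow> cuntz_pre \<Rightarrow> real"
  where "dist_cuntz_pre x y = norm (x - y)"

definition sgn_cuntz_pre :: "cuntz_pre \<Rightarrow> cuntz_pre"
  where "sgn_cuntz_pre x = inverse (norm x) *\<^sub>R x"

definition uniformity_cuntz_pre :: "(cuntz_pre \<times> cuntz_pre) filter"
  where "uniformity_cuntz_pre = (INF e\<in>{0<..}. principal {(x, y). dist x y < e})"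

definition open_cuntz_pre :: "cuntz_pre set \<Rightarrow> bool"
  where "open_cuntz_pre U \<longleftrightarrow> (\<forall>x\<in>U. \<forall>\<^sub>F (x', y) in uniformity. x' = x \<longrightarrow> y \<in> U)"

instance
proof
  fix x y z :: cuntz_pre and c d :: complex and a b :: real
  show "x + y + z = x + (y + z)" by transfer (simp add: unorm algebra_simps)
  show "x + y = y + x" by transfer (simp add: unorm algebra_simps)
  show "0 + x = x" by transfer (simp add: unorm)
  show "- x + x = 0" by transfer (simp add: unorm)
  show "x - y = x + - y" by (rule minus_cuntz_pre_def)
  show R: "c *\<^sub>C (x + y) = c *\<^sub>C x + c *\<^sub>C y" for c x and y :: cuntz_pre
    by transfer (simp add: scaleC_add_right unorm)
  show L: "(c + d) *\<^sub>C x = c *\<^sub>C x + d *\<^sub>C x" for c d and x :: cuntz_pre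
    by transfer (simp add: scaleC_add_left unorm)
  show S: "c *\<^sub>C d *\<^sub>C x = (c * d) *\<^sub>C x" for c d and x :: cuntz_pre
    by transfer (simp add: scaleC_scaleC unorm)
  have one: "1 *\<^sub>C x = x" by transfer (simp add: unorm)
  show "a *\<^sub>R x = complex_of_real a *\<^sub>C x" by (rule scaleR_cuntz_pre_def)
  show "a *\<^sub>R (x + y) = a *\<^sub>R x + a *\<^sub>R y" by (simp add: scaleR_cuntz_pre_def R)
  show "(a + b) *\<^sub>R x = a *\<^sub>R x + b *\<^sub>R x" by (simp add: scaleR_cuntz_pre_def L)
  show "a *\<^sub>R b *\<^sub>R x = (a * b) *\<^sub>R x" by (simp add: scaleR_cuntz_pre_def S)
  show "1 *\<^sub>R x = x" by (simp add: scaleR_cuntz_pre_def one)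
  show "x * y * z = x * (y * z)" by transfer (simp add: mult.assoc unorm)
  show "1 * x = x" by transfer (simp add: unorm)
  show "x * 1 = x" by transfer (simp add: unorm)
  show "(x + y) * z = x * z + y * z" by transfer (simp add: distrib_right unorm)
  show "x * (y + z) = x * y + x * z" by transfer (simp add: distrib_left unorm)
  show "(c *\<^sub>C x) * y = c *\<^sub>C (x * y)" by transfer (simp add: mult_scaleC_left unorm)
  show "x * (c *\<^sub>C y) = c *\<^sub>C (x * y)" by transfer (simp add: mult_scaleC_right unorm)
  show "star (star x) = x" by transfer (simp add: star_algebra_class.star_star unorm)
  show "star (x + y) = star x + star y" by transfer (simp add: star_algebra_class.star_add unorm)
  show "star (c *\<^sub>C x) = cnj c *\<^sub>C star x" by transfer (simp add: star_scaleC unorm)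
  show "star (x * y) = star y * star x" by transfer (simp add: star_algebra_class.star_mult unorm)
  show "dist x y = norm (x - y)" by (rule dist_cuntz_pre_def)
  show "sgn x = inverse (norm x) *\<^sub>R x" by (rule sgn_cuntz_pre_def)
  show "uniformity = (INF e\<in>{0<..}. principal {(x::cuntz_pre, y). dist x y < e})"
    by (rule uniformity_cuntz_pre_def)
  show "open U \<longleftrightarrow> (\<forall>x\<in>U. \<forall>\<^sub>F (x', y) in uniformity. x' = x \<longrightarrow> y \<in> U)" for U :: "cuntz_pre set"
    by (rule open_cuntz_pre_def)
  show "norm x = 0 \<longleftrightarrow> x = 0" by transfer simp
  show "norm (x + y) \<le> norm x + norm y" by transfer (rule unorm)
  show C: "norm (c *\<^sub>C x) = cmod c * norm x" for c and x :: cuntz_pre by transfer (rule unorm)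
  show "norm (a *\<^sub>R x) = \<bar>a\<bar> * norm x" by (simp add: scaleR_cuntz_pre_def C)
  show "norm (x * y) \<le> norm x * norm y" by transfer (rule unorm)
  show "norm (star x * x) = (norm x)\<^sup>2" by transfer (rule unorm)
qed

end

type_synonym cuntz = "cuntz_pre completion"

definition cuntz_gen :: "bool \<Rightarrow> cuntz"
  where "cuntz_gen b = embed (abs_cuntz_pre (alg_gen b))"

lemma cuntz_gen_isometry: "star (cuntz_gen b) * cuntz_gen b = 1"
  unfolding cuntz_gen_def embed_star[symmetric] embed_times[symmetric]
  by (simp add: star_cuntz_pre.abs_eq times_cuntz_pre.abs_eq alg_gen_isometry
      one_cuntz_pre.abs_eq[symmetric] embed_one)

lemma cuntz_gen_ranges: "cuntz_gen False * star (cuntz_gen False) + cuntz_gen True * star (cuntz_gen True) = 1"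
  unfolding cuntz_gen_def embed_star[symmetric] embed_times[symmetric] embed_add[symmetric]
  by (simp add: star_cuntz_pre.abs_eq times_cuntz_pre.abs_eq plus_cuntz_pre.abs_eq alg_gen_ranges
      one_cuntz_pre.abs_eq[symmetric] embed_one)

section \<open>Representations\<close>

definition is_adjoint :: "('h::complex_inner \<Rightarrow> 'h) \<Rightarrow> ('h \<Rightarrow> 'h) \<Rightarrow> bool"
  where "is_adjoint S T \<longleftrightarrow> (\<forall>x y. cinner (S x) y = cinner x (T y))"

text \<open>
  Contractivity, the last clause, is automatic for *-representations of C*-algebras.
\<close>

definition star_rep :: "('o::pre_cstar_algebra \<Rightarrow> 'h::complex_inner \<Rightarrow> 'h) \<Rightarrow> bool" where
  "star_rep \<sigma> \<longleftrightarrow>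
    (\<forall>a. bounded_clinear (\<sigma> a)) \<and>
    (\<forall>a b x. \<sigma> (a + b) x = \<sigma> a x + \<sigma> b x) \<and>
    (\<forall>c a x. \<sigma> (c *\<^sub>C a) x = c *\<^sub>C \<sigma> a x) \<and>
    (\<forall>a b. \<sigma> (a * b) = \<sigma> a \<circ> \<sigma> b) \<and>
    \<sigma> 1 = id \<and>
    (\<forall>a. is_adjoint (\<sigma> (star a)) (\<sigma> a)) \<and>
    (\<forall>a x. norm (\<sigma> a x) \<le> norm a * norm x)"

lemma cinner_ext: "(\<And>y. cinner x y = cinner x' (y::'h::complex_inner)) \<Longrightarrow> x = x'"
proof -
  assume "\<And>y. cinner x y = cinner x' y"
  then have "cinner (x - x') (x - x') = 0" by (simp add: cinner_diff_left)
  then show "x = x'" by (simp add: cinner_self)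
qed

lemma cinner_norm_le:
  assumes "cmod (cinner x x) \<le> M * norm x" "0 \<le> M" shows "norm (x::'h::complex_inner) \<le> M"
proof (cases "x = 0")
  case False
  then show ?thesis using assms(1) by (simp add: cinner_self norm_power norm_mult power2_eq_square)
qed (simp add: assms)

lemma is_adjoint_sym: "is_adjoint S T \<Longrightarrow> is_adjoint T S"
  unfolding is_adjoint_def by (metis cinner_commute)

lemma is_adjoint_unique: "is_adjoint S T \<Longrightarrow> is_adjoint S' T \<Longrightarrow> S = S'"
proof (rule ext, rule cinner_ext)
  show "cinner (S x) y = cinner (S' x) y" if "is_adjoint S T" "is_adjoint S' T" for x y
    using that by (simp add: is_adjoint_def)
qed

lemma bounded_clinear_zero: "bounded_clinear (\<lambda>x. 0)"
  by (simp add: bounded_clinear_def)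

lemma bounded_clinear_ident: "bounded_clinear (\<lambda>x. x)"
  by (simp add: bounded_clinear_def)

lemma bounded_clinear_plus: "bounded_clinear f \<Longrightarrow> bounded_clinear g \<Longrightarrow> bounded_clinear (\<lambda>x. f x + g x)"
  by (simp add: bounded_clinear_def bounded_linear_add scaleC_add_right)

lemma bounded_linear_scaleC: "bounded_linear (\<lambda>x::'a::complex_normed_vector. c *\<^sub>C x)"
  by (rule bounded_linear_intro[where K="cmod c"])
    (auto simp: scaleR_scaleC scaleC_add_right scaleC_scaleC norm_scaleC mult.commute)

lemma bounded_clinear_cmult: "bounded_clinear f \<Longrightarrow> bounded_clinear (\<lambda>x. c *\<^sub>C f x)"
  using bounded_linear_compose[OF bounded_linear_scaleC]
  by (auto simp: bounded_clinear_def scaleC_scaleC mult.commute)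

lemma bounded_clinear_comp: "bounded_clinear f \<Longrightarrow> bounded_clinear g \<Longrightarrow> bounded_clinear (\<lambda>x. f (g x))"
  by (simp add: bounded_clinear_def bounded_linear_compose)

lemma onorm_scaleC_le:
  assumes "bounded_clinear f" shows "onorm (\<lambda>x. c *\<^sub>C f x) \<le> cmod c * onorm f"
proof (rule onorm_bound)
  show "0 \<le> cmod c * onorm f"
    using assms by (simp add: bounded_clinear_def onorm_pos_le)
  show "norm (c *\<^sub>C f x) \<le> cmod c * onorm f * norm x" for x
    using assms onorm[of f x] by (simp add: bounded_clinear_def norm_scaleC mult.assoc mult_left_mono)
qed

lemma onorm_scaleC:
  assumes "bounded_clinear f" shows "onorm (\<lambda>x. c *\<^sub>C f x) = cmod c * onorm f"
proof (cases "c = 0")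
  case False
  have "onorm (\<lambda>x. inverse c *\<^sub>C c *\<^sub>C f x) \<le> cmod (inverse c) * onorm (\<lambda>x. c *\<^sub>C f x)"
    by (rule onorm_scaleC_le[OF bounded_clinear_cmult[OF assms]])
  then have "cmod c * onorm f \<le> onorm (\<lambda>x. c *\<^sub>C f x)"
    using False by (simp add: scaleC_scaleC norm_inverse inverse_eq_divide[symmetric] pos_le_divide_eq[symmetric]
          divide_inverse mult.commute)
  with onorm_scaleC_le[OF assms, of c] show ?thesis by simp
qed (simp add: onorm_zero)

lemma onorm_adjoint_comp:
  assumes f: "bounded_clinear f" and g: "bounded_clinear g" and adj: "is_adjoint g f"
  shows "onorm (\<lambda>x. g (f x)) = (onorm f)\<^sup>2"
proof (rule antisym)
  have bf: "bounded_linear f" and bg: "bounded_linear g" using f g by (auto simp: bounded_clinear_def)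
  have adj1: "cinner (g x) y = cinner x (f y)" for x y using adj by (simp add: is_adjoint_def)
  have adj2: "cinner (f x) y = cinner x (g y)" for x y
    using is_adjoint_sym[OF adj] by (simp add: is_adjoint_def)
  have "norm (g x) \<le> onorm f * norm x" for x
  proof (rule cinner_norm_le)
    have "cmod (cinner (g x) (g x)) \<le> norm x * norm (f (g x))"
      unfolding adj1 by (rule Cauchy_Schwarz)
    also have "\<dots> \<le> norm x * (onorm f * norm (g x))"
      by (intro mult_left_mono onorm[OF bf]) simp
    finally show "cmod (cinner (g x) (g x)) \<le> onorm f * norm x * norm (g x)" by (simp add: ac_simps)
  qed (simp add: onorm_pos_le[OF bf])
  then have "onorm g \<le> onorm f" by (rule onorm_bound[OF onorm_pos_le[OF bf]])
  then show "onorm (\<lambda>x. g (f x)) \<le> (onorm f)\<^sup>2"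
    using onorm_compose[OF bg bf] mult_right_mono[OF _ onorm_pos_le[OF bf]]
    by (fastforce simp: o_def power2_eq_square)
  have bgf: "bounded_linear (\<lambda>x. g (f x))" by (rule bounded_linear_compose[OF bg bf])
  have "norm (f x) \<le> sqrt (onorm (\<lambda>x. g (f x))) * norm x" for x
  proof (rule power2_le_imp_le)
    have "(norm (f x))\<^sup>2 = cmod (cinner (f x) (f x))" by (simp add: cinner_self norm_power norm_mult power2_eq_square)
    also have "\<dots> = cmod (cinner x (g (f x)))" by (simp add: adj2)
    also have "\<dots> \<le> norm x * norm (g (f x))" by (rule Cauchy_Schwarz)
    also have "\<dots> \<le> norm x * (onorm (\<lambda>x. g (f x)) * norm x)"
      by (intro mult_left_mono onorm[OF bgf]) simp
    finally show "(norm (f x))\<^sup>2 \<le> (sqrt (onorm (\<lambda>x. g (f x))) * norm x)\<^sup>2"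
      using onorm_pos_le[OF bgf] by (simp add: power_mult_distrib power2_eq_square ac_simps)
  qed (simp add: onorm_pos_le[OF bgf])
  then have "onorm f \<le> sqrt (onorm (\<lambda>x. g (f x)))"
    by (rule onorm_bound[rotated]) (simp add: onorm_pos_le[OF bgf])
  then show "(onorm f)\<^sup>2 \<le> onorm (\<lambda>x. g (f x))"
    using onorm_pos_le[OF bf] onorm_pos_le[OF bgf] by (metis power_mono real_sqrt_pow2)
qed

subsection \<open>The universal property of the Cuntz algebra\<close>

locale cuntz_family =
  fixes S T :: "bool \<Rightarrow> 'h \<Rightarrow> 'h::complex_hilbert"
  assumes S: "bounded_clinear (S b)" and T: "bounded_clinear (T b)"
    and adj: "is_adjoint (S b) (T b)"
    and isom: "T b (S b x) = x"
    and ranges: "S False (T False x) + S True (T True x) = x"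
begin

text \<open>The value of a formal expression, together with its adjoint.\<close>

primrec ev :: "cterm \<Rightarrow> ('h \<Rightarrow> 'h) \<times> ('h \<Rightarrow> 'h)" where
  "ev (Gen b) = (S b, T b)"
| "ev Zero = (\<lambda>x. 0, \<lambda>x. 0)"
| "ev One = (\<lambda>x. x, \<lambda>x. x)"
| "ev (Add u v) = (\<lambda>x. fst (ev u) x + fst (ev v) x, \<lambda>x. snd (ev u) x + snd (ev v) x)"
| "ev (Mult u v) = (\<lambda>x. fst (ev u) (fst (ev v) x), \<lambda>x. snd (ev v) (snd (ev u) x))"
| "ev (Scale c u) = (\<lambda>x. c *\<^sub>C fst (ev u) x, \<lambda>x. cnj c *\<^sub>C snd (ev u) x)"
| "ev (Star u) = (snd (ev u), fst (ev u))"

lemma ev_bounded: "bounded_clinear (fst (ev t)) \<and> bounded_clinear (snd (ev t))"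
  by (induction t) (auto simp: S T bounded_clinear_zero bounded_clinear_ident bounded_clinear_plus
      bounded_clinear_cmult bounded_clinear_comp)

lemma ev_adjoint: "is_adjoint (snd (ev t)) (fst (ev t))"
proof -
  have "is_adjoint (snd (ev t)) (fst (ev t)) \<and> is_adjoint (fst (ev t)) (snd (ev t))"
  proof (induction t)
    case (Gen b)
    then show ?case using adj is_adjoint_sym by auto
  qed (auto simp: is_adjoint_def cinner_add_left cinner_add_right cinner_scaleC_left cinner_scaleC_right)
  then show ?thesis ..
qed

lemma ev_cong: "t \<doteq> u \<Longrightarrow> ev t = ev u"
proof (induction rule: cuntz_eq.induct)
  case (mult_add_left x y z)
  then show ?case using ev_bounded[of z] by (auto simp: bounded_clinear_add)
next
  case (mult_add_right x y z)
  then show ?case using ev_bounded[of x] by (auto simp: bounded_clinear_add)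
next
  case (mult_scale_left c x y)
  then show ?case using ev_bounded[of y] by (auto simp: bounded_clinear_scaleC)
next
  case (mult_scale_right x c y)
  then show ?case using ev_bounded[of x] by (auto simp: bounded_clinear_scaleC)
qed (auto simp: algebra_simps scaleC_add_right scaleC_add_left scaleC_scaleC isom ranges)

definition ev_alg :: "cuntz_alg \<Rightarrow> 'h \<Rightarrow> 'h"
  where "ev_alg a = fst (ev (rep_cuntz_alg a))"

lemma ev_alg_abs: "ev_alg (abs_cuntz_alg t) = fst (ev t)"
  unfolding ev_alg_def
  using ev_cong[OF Quotient3_rep_abs[OF Quotient3_cuntz_alg, of t]] cuntz_eq.refl by simp

lemma ev_alg_simps:
  "ev_alg (alg_gen b) = S b" "ev_alg 0 = (\<lambda>x. 0)" "ev_alg 1 = (\<lambda>x. x)"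
  "ev_alg (a + a') = (\<lambda>x. ev_alg a x + ev_alg a' x)"
  "ev_alg (a * a') = (\<lambda>x. ev_alg a (ev_alg a' x))"
  "ev_alg (c *\<^sub>C a) = (\<lambda>x. c *\<^sub>C ev_alg a x)"
  "bounded_clinear (ev_alg a)"
  "is_adjoint (ev_alg (star a)) (ev_alg a)"
proof -
  obtain t where t: "a = abs_cuntz_alg t" by (metis Quotient_abs_rep[OF Quotient_cuntz_alg])
  obtain t' where t': "a' = abs_cuntz_alg t'" by (metis Quotient_abs_rep[OF Quotient_cuntz_alg])
  show "ev_alg (alg_gen b) = S b" "ev_alg 0 = (\<lambda>x. 0)" "ev_alg 1 = (\<lambda>x. x)"
    "ev_alg (a + a') = (\<lambda>x. ev_alg a x + ev_alg a' x)"
    "ev_alg (a * a') = (\<lambda>x. ev_alg a (ev_alg a' x))"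
    "ev_alg (c *\<^sub>C a) = (\<lambda>x. c *\<^sub>C ev_alg a x)"
    "bounded_clinear (ev_alg a)"
    "is_adjoint (ev_alg (star a)) (ev_alg a)"
    unfolding t t'
    by (simp_all add: alg_gen.abs_eq zero_cuntz_alg.abs_eq one_cuntz_alg.abs_eq plus_cuntz_alg.abs_eq
        times_cuntz_alg.abs_eq scaleC_cuntz_alg.abs_eq star_cuntz_alg.abs_eq ev_alg_abs ev_bounded ev_adjoint)
qed

lemma ev_alg_seminorm: "cstar_seminorm (\<lambda>a. onorm (ev_alg a))"
proof -
  have bl: "bounded_linear (ev_alg a)" for a using ev_alg_simps(7) by (simp add: bounded_clinear_def)
  show ?thesis
    unfolding cstar_seminorm_def ev_alg_simps(4-6)
    by (simp add: onorm_pos_le[OF bl] onorm_triangle[OF bl bl] onorm_scaleC[OF ev_alg_simps(7)]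
        onorm_compose[OF bl bl, unfolded o_def] onorm_adjoint_comp[OF ev_alg_simps(7) ev_alg_simps(7) ev_alg_simps(8)])
qed

lemma ev_alg_bound: "norm (ev_alg a x) \<le> universal_norm a * norm x"
proof -
  have "norm (ev_alg a x) \<le> onorm (ev_alg a) * norm x"
    using ev_alg_simps(7) by (intro onorm) (simp add: bounded_clinear_def)
  also have "\<dots> \<le> universal_norm a * norm x"
    by (intro mult_right_mono universal_norm_upper[OF ev_alg_seminorm]) simp
  finally show ?thesis .
qed

definition ev_pre :: "cuntz_pre \<Rightarrow> 'h \<Rightarrow> 'h"
  where "ev_pre p = ev_alg (rep_cuntz_pre p)"

lemma ev_pre_abs: "ev_pre (abs_cuntz_pre a) = ev_alg a"
proof
  fix x
  let ?r = "rep_cuntz_pre (abs_cuntz_pre a)"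
  have "universal_norm (?r - a) = 0"
    using Quotient3_rep_abs[OF Quotient3_cuntz_pre, of a] by (simp add: unorm)
  then have "norm (ev_alg (?r - a) x) \<le> 0" using ev_alg_bound[of "?r - a" x] by simp
  moreover have "ev_alg ?r x = ev_alg (?r - a) x + ev_alg a x"
    using ev_alg_simps(4)[of "?r - a" a] by (simp add: fun_eq_iff)
  ultimately show "ev_pre (abs_cuntz_pre a) x = ev_alg a x" by (simp add: ev_pre_def)
qed

lemma ev_pre_simps:
  "ev_pre (abs_cuntz_pre (alg_gen b)) = S b" "ev_pre 1 = (\<lambda>x. x)"
  "ev_pre (p + p') = (\<lambda>x. ev_pre p x + ev_pre p' x)"
  "ev_pre (p * p') = (\<lambda>x. ev_pre p (ev_pre p' x))"
  "ev_pre (c *\<^sub>C p) = (\<lambda>x. c *\<^sub>C ev_pre p x)"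
  "bounded_clinear (ev_pre p)"
  "is_adjoint (ev_pre (star p)) (ev_pre p)"
  "norm (ev_pre p x) \<le> norm p * norm x"
proof -
  obtain a where a: "p = abs_cuntz_pre a" by (metis Quotient_abs_rep[OF Quotient_cuntz_pre])
  obtain a' where a': "p' = abs_cuntz_pre a'" by (metis Quotient_abs_rep[OF Quotient_cuntz_pre])
  show "ev_pre (abs_cuntz_pre (alg_gen b)) = S b" "ev_pre 1 = (\<lambda>x. x)"
    "ev_pre (p + p') = (\<lambda>x. ev_pre p x + ev_pre p' x)"
    "ev_pre (p * p') = (\<lambda>x. ev_pre p (ev_pre p' x))"
    "ev_pre (c *\<^sub>C p) = (\<lambda>x. c *\<^sub>C ev_pre p x)"
    "bounded_clinear (ev_pre p)"
    "is_adjoint (ev_pre (star p)) (ev_pre p)"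
    "norm (ev_pre p x) \<le> norm p * norm x"
    unfolding a a'
    by (simp_all add: one_cuntz_pre.abs_eq plus_cuntz_pre.abs_eq times_cuntz_pre.abs_eq
        scaleC_cuntz_pre.abs_eq star_cuntz_pre.abs_eq norm_cuntz_pre.abs_eq ev_pre_abs ev_alg_simps
        ev_alg_bound)
qed

lemma ev_pre_diff: "ev_pre (p - q) x = ev_pre p x - ev_pre q x"
  using ev_pre_simps(3)[of "p - q" q] by (simp add: fun_eq_iff)

lemma ev_pre_diff_right: "ev_pre p (x - y) = ev_pre p x - ev_pre p y"
  using ev_pre_simps(6)[of p] by (simp add: bounded_clinear_def bounded_linear.linear linear_diff)

definition cuntz_ev :: "cuntz \<Rightarrow> 'h \<Rightarrow> 'h"
  where "cuntz_ev a x = lim (\<lambda>n. ev_pre (rep_completion a n) x)"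

lemma ev_pre_Cauchy: assumes "Cauchy X" shows "Cauchy (\<lambda>n. ev_pre (X n) x)"
proof (rule bounded_linear.Cauchy[of "\<lambda>p. ev_pre p x", OF _ assms])
  show "bounded_linear (\<lambda>p. ev_pre p x)"
    by (rule bounded_linear_intro[where K="norm x"]) (simp_all add: ev_pre_simps scaleR_scaleC)
qed

lemma cuntz_ev_lim:
  assumes X: "(\<lambda>n. embed (X n)) \<longlonglongrightarrow> a" shows "(\<lambda>n. ev_pre (X n) x) \<longlonglongrightarrow> cuntz_ev a x"
proof -
  let ?R = "rep_completion a"
  have R: "Cauchy ?R" using Quotient_rep_reflp[OF Quotient_completion, of a] by blast
  then have Ra: "(\<lambda>n. embed (?R n)) \<longlonglongrightarrow> a"
    using embed_tendsto_abs[OF R] Quotient_abs_rep[OF Quotient_completion, of a] by simp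
  have "(\<lambda>n. norm (embed (X n) - embed (?R n))) \<longlonglongrightarrow> 0"
    using tendsto_norm[OF tendsto_diff[OF X Ra]] by simp
  then have "(\<lambda>n. norm (X n - ?R n) * norm x) \<longlonglongrightarrow> 0 * norm x"
    by (intro tendsto_intros) (simp add: embed_diff[symmetric])
  then have "(\<lambda>n. norm (X n - ?R n) * norm x) \<longlonglongrightarrow> 0" by simp
  then have "(\<lambda>n. ev_pre (X n - ?R n) x) \<longlonglongrightarrow> 0"
    by (rule Lim_null_comparison[rotated]) (simp add: ev_pre_simps(8))
  moreover have "(\<lambda>n. ev_pre (?R n) x) \<longlonglongrightarrow> cuntz_ev a x"
    unfolding cuntz_ev_def using ev_pre_Cauchy[OF R] by (simp add: Cauchy_convergent convergent_LIMSEQ_iff[symmetric])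
  ultimately show ?thesis using tendsto_add by (fastforce simp: ev_pre_diff)
qed

lemma cuntz_ev_embed: "cuntz_ev (embed p) = ev_pre p"
proof
  fix x
  show "cuntz_ev (embed p) x = ev_pre p x"
    using cuntz_ev_lim[of "\<lambda>_. p" "embed p" x] LIMSEQ_unique by (metis tendsto_const)
qed

lemma cuntz_ev_bound: "norm (cuntz_ev a x) \<le> norm a * norm x"
proof -
  obtain X where X: "(\<lambda>n. embed (X n)) \<longlonglongrightarrow> a" using completion_seq by metis
  have "(\<lambda>n. norm (X n) * norm x) \<longlonglongrightarrow> norm a * norm x"
    using tendsto_mult[OF tendsto_norm[OF X] tendsto_const] by simp
  from LIMSEQ_le[OF tendsto_norm[OF cuntz_ev_lim[OF X]] this] show ?thesis
    using ev_pre_simps(8) by blast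
qed

lemma cuntz_ev_rep: "star_rep cuntz_ev"
proof -
  have add: "cuntz_ev (a + b) x = cuntz_ev a x + cuntz_ev b x" for a b x
  proof -
    obtain X Y where X: "(\<lambda>n. embed (X n)) \<longlonglongrightarrow> a" and Y: "(\<lambda>n. embed (Y n)) \<longlonglongrightarrow> b"
      using completion_seq by metis
    have "(\<lambda>n. embed (X n + Y n)) \<longlonglongrightarrow> a + b" unfolding embed_add by (intro tendsto_add X Y)
    from cuntz_ev_lim[OF this, of x] tendsto_add[OF cuntz_ev_lim[OF X] cuntz_ev_lim[OF Y], of x x]
    show ?thesis unfolding ev_pre_simps by (rule LIMSEQ_unique)
  qed
  have scale: "cuntz_ev (c *\<^sub>C a) x = c *\<^sub>C cuntz_ev a x" for c a x
  proof -
    obtain X where X: "(\<lambda>n. embed (X n)) \<longlonglongrightarrow> a" using completion_seq by metis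
    have "(\<lambda>n. embed (c *\<^sub>C X n)) \<longlonglongrightarrow> c *\<^sub>C a" unfolding embed_scaleC by (intro tendsto_scaleC X)
    from cuntz_ev_lim[OF this, of x] tendsto_scaleC[OF cuntz_ev_lim[OF X], of c x]
    show ?thesis unfolding ev_pre_simps by (rule LIMSEQ_unique)
  qed
  have add_right: "cuntz_ev a (x + y) = cuntz_ev a x + cuntz_ev a y" for a x y
  proof -
    obtain X where X: "(\<lambda>n. embed (X n)) \<longlonglongrightarrow> a" using completion_seq by metis
    from cuntz_ev_lim[OF X, of "x + y"] tendsto_add[OF cuntz_ev_lim[OF X, of x] cuntz_ev_lim[OF X, of y]]
    show ?thesis unfolding bounded_clinear_add[OF ev_pre_simps(6)] by (rule LIMSEQ_unique)
  qed
  have scale_right: "cuntz_ev a (c *\<^sub>C x) = c *\<^sub>C cuntz_ev a x" for a c x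
  proof -
    obtain X where X: "(\<lambda>n. embed (X n)) \<longlonglongrightarrow> a" using completion_seq by metis
    from cuntz_ev_lim[OF X, of "c *\<^sub>C x"] tendsto_scaleC[OF cuntz_ev_lim[OF X, of x], of c]
    show ?thesis unfolding bounded_clinear_scaleC[OF ev_pre_simps(6)] by (rule LIMSEQ_unique)
  qed
  have bounded: "bounded_clinear (cuntz_ev a)" for a
  proof (rule bounded_clinearI[where K="norm a"])
    show "norm (cuntz_ev a x) \<le> norm x * norm a" for x using cuntz_ev_bound[of a x] by (simp only: mult.commute)
  qed (simp_all only: add_right scale_right)
  have mult: "cuntz_ev (a * b) x = cuntz_ev a (cuntz_ev b x)" for a b x
  proof -
    obtain X Y where X: "(\<lambda>n. embed (X n)) \<longlonglongrightarrow> a" and Y: "(\<lambda>n. embed (Y n)) \<longlonglongrightarrow> b"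
      using completion_seq by metis
    have "(\<lambda>n. embed (X n * Y n)) \<longlonglongrightarrow> a * b" unfolding embed_times by (intro tendsto_mult X Y)
    then have 1: "(\<lambda>n. ev_pre (X n) (ev_pre (Y n) x)) \<longlonglongrightarrow> cuntz_ev (a * b) x"
      using cuntz_ev_lim[of "\<lambda>n. X n * Y n" "a * b" x] by (simp add: ev_pre_simps)
    have "(\<lambda>n. norm (embed (X n)) * norm (ev_pre (Y n) x - cuntz_ev b x)) \<longlonglongrightarrow> norm a * norm (cuntz_ev b x - cuntz_ev b x)"
      by (intro tendsto_intros X cuntz_ev_lim Y)
    then have "(\<lambda>n. norm (X n) * norm (ev_pre (Y n) x - cuntz_ev b x)) \<longlonglongrightarrow> 0" by simp
    then have "(\<lambda>n. ev_pre (X n) (ev_pre (Y n) x - cuntz_ev b x)) \<longlonglongrightarrow> 0"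
      by (rule Lim_null_comparison[rotated]) (simp add: ev_pre_simps(8))
    from tendsto_add[OF this cuntz_ev_lim[OF X, of "cuntz_ev b x"]]
    have 2: "(\<lambda>n. ev_pre (X n) (ev_pre (Y n) x)) \<longlonglongrightarrow> cuntz_ev a (cuntz_ev b x)"
      by (simp add: ev_pre_diff_right)
    from 1 2 show ?thesis by (rule LIMSEQ_unique)
  qed
  have adjoint: "cinner (cuntz_ev (star a) x) y = cinner x (cuntz_ev a y)" for a x y
  proof -
    have cont: "(\<lambda>n. cinner (F n) (G n)) \<longlonglongrightarrow> cinner f g" if F: "F \<longlonglongrightarrow> f" and G: "G \<longlonglongrightarrow> g" for F G and f g :: 'h
    proof -
      have "(\<lambda>n. norm (F n - f) * norm (G n) + norm f * norm (G n - g)) \<longlonglongrightarrow> norm (f - f) * norm g + norm f * norm (g - g)"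
        by (intro tendsto_intros F G)
      then have "(\<lambda>n. cinner (F n) (G n) - cinner f g) \<longlonglongrightarrow> 0"
        by (simp add: Lim_null_comparison[OF always_eventually[OF allI[OF cinner_diff_bound]]])
      then show ?thesis by (simp add: LIM_zero_iff)
    qed
    obtain X where X: "(\<lambda>n. embed (X n)) \<longlonglongrightarrow> a" using completion_seq by metis
    have "(\<lambda>n. embed (star (X n))) \<longlonglongrightarrow> star a"
      unfolding embed_star by (rule bounded_linear.tendsto[OF bounded_linear_star X])
    then have 1: "(\<lambda>n. cinner (ev_pre (star (X n)) x) y) \<longlonglongrightarrow> cinner (cuntz_ev (star a) x) y"
      by (intro cont cuntz_ev_lim tendsto_const)
    have "(\<lambda>n. cinner x (ev_pre (X n) y)) \<longlonglongrightarrow> cinner x (cuntz_ev a y)"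
      by (intro cont cuntz_ev_lim tendsto_const X)
    moreover have "cinner (ev_pre (star (X n)) x) y = cinner x (ev_pre (X n) y)" for n
      using ev_pre_simps(7)[of "X n"] by (simp add: is_adjoint_def)
    ultimately show ?thesis using LIMSEQ_unique[OF 1] by simp
  qed
  have one: "cuntz_ev 1 = id"
    unfolding embed_one[symmetric] cuntz_ev_embed ev_pre_simps by (simp add: id_def)
  show ?thesis
    unfolding star_rep_def is_adjoint_def
    using add scale bounded mult adjoint one cuntz_ev_bound by auto
qed

lemma cuntz_ev_gen: "cuntz_ev (cuntz_gen b) = S b"
  by (simp add: cuntz_gen_def cuntz_ev_embed ev_pre_simps)

end

lemma star_repD:
  assumes "star_rep \<sigma>"
  shows "bounded_clinear (\<sigma> a)" "\<sigma> (a + b) x = \<sigma> a x + \<sigma> b x" "\<sigma> (c *\<^sub>C a) x = c *\<^sub>C \<sigma> a x"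
    "\<sigma> (a * b) x = \<sigma> a (\<sigma> b x)" "\<sigma> 1 x = x" "is_adjoint (\<sigma> (star a)) (\<sigma> a)"
    "norm (\<sigma> a x) \<le> norm a * norm x"
  using assms by (auto simp: star_rep_def)

lemma cuntz_rep_unique:
  fixes \<sigma> \<rho> :: "cuntz \<Rightarrow> 'h \<Rightarrow> 'h::complex_inner"
  assumes \<sigma>: "star_rep \<sigma>" and \<rho>: "star_rep \<rho>" and gen: "\<And>b. \<sigma> (cuntz_gen b) = \<rho> (cuntz_gen b)"
  shows "\<sigma> = \<rho>"
proof -
  have pre: "\<sigma> (embed (abs_cuntz_pre x)) = \<rho> (embed (abs_cuntz_pre x))" for x
  proof (induction x rule: cuntz_alg_induct)
    case (gen b)
    then show ?case using assms(3) by (simp add: cuntz_gen_def)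
  next
    case zero
    have "embed (abs_cuntz_pre 0) = 0 *\<^sub>C (1 :: cuntz)"
      by (simp add: zero_cuntz_pre.abs_eq[symmetric]) (metis embed_diff diff_self)
    then show ?case by (simp add: fun_eq_iff star_repD[OF \<sigma>] star_repD[OF \<rho>] del: complex_vec.scale_zero_left)
  next
    case one
    then show ?case
      by (simp add: fun_eq_iff one_cuntz_pre.abs_eq[symmetric] embed_one star_repD[OF \<sigma>] star_repD[OF \<rho>])
  next
    case (add x y)
    then show ?case
      by (simp add: fun_eq_iff plus_cuntz_pre.abs_eq[symmetric] embed_add star_repD[OF \<sigma>] star_repD[OF \<rho>])
  next
    case (mult x y)
    then show ?case
      by (simp add: fun_eq_iff times_cuntz_pre.abs_eq[symmetric] embed_times star_repD[OF \<sigma>] star_repD[OF \<rho>])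
  next
    case (scale c x)
    then show ?case
      by (simp add: fun_eq_iff scaleC_cuntz_pre.abs_eq[symmetric] embed_scaleC star_repD[OF \<sigma>] star_repD[OF \<rho>])
  next
    case (star x)
    have "is_adjoint (\<sigma> (star (embed (abs_cuntz_pre x)))) (\<rho> (embed (abs_cuntz_pre x)))"
      using star_repD(6)[OF \<sigma>, of "embed (abs_cuntz_pre x)"] by (simp only: star)
    from is_adjoint_unique[OF this star_repD(6)[OF \<rho>]] show ?case
      by (simp only: star_cuntz_pre.abs_eq[symmetric] embed_star)
  qed
  show ?thesis
  proof (intro ext)
    fix a :: cuntz and x
    obtain X where X: "(\<lambda>n. embed (X n)) \<longlonglongrightarrow> a" using completion_seq by metis
    have eq: "\<sigma> (embed p) = \<rho> (embed p)" for p
      using pre by (metis Quotient_abs_rep[OF Quotient_cuntz_pre])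
    have lim: "(\<lambda>n. \<tau> (embed (X n)) x) \<longlonglongrightarrow> \<tau> a x" if "star_rep \<tau>" for \<tau> :: "cuntz \<Rightarrow> 'h \<Rightarrow> 'h"
    proof (rule bounded_linear.tendsto[of "\<lambda>a. \<tau> a x", OF _ X])
      show "bounded_linear (\<lambda>a. \<tau> a x)"
        by (rule bounded_linear_intro[where K="norm x"]) (simp_all add: star_repD[OF that] scaleR_scaleC)
    qed
    from lim[OF \<sigma>] lim[OF \<rho>] show "\<sigma> a x = \<rho> a x" unfolding eq by (rule LIMSEQ_unique)
  qed
qed

theorem cuntz_universal:
  fixes S T :: "bool \<Rightarrow> 'h \<Rightarrow> 'h::complex_hilbert"
  assumes "cuntz_family S T"
  shows "\<exists>!\<sigma>. star_rep \<sigma> \<and> (\<forall>b. \<sigma> (cuntz_gen b) = S b)"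
proof (rule ex1I[of _ "cuntz_family.cuntz_ev S T"])
  fix \<sigma> assume "star_rep \<sigma> \<and> (\<forall>b. \<sigma> (cuntz_gen b) = S b)"
  then show "\<sigma> = cuntz_family.cuntz_ev S T"
    by (intro cuntz_rep_unique[OF _ cuntz_family.cuntz_ev_rep[OF assms]])
      (simp_all only: cuntz_family.cuntz_ev_gen[OF assms])
qed (simp add: cuntz_family.cuntz_ev_rep[OF assms] cuntz_family.cuntz_ev_gen[OF assms])

subsection \<open>The representation associated with a P-module\<close>

definition associated_rep :: "cuntz \<Rightarrow> 'a::pmodule dilation \<Rightarrow> 'a dilation" where
  "associated_rep = (THE \<sigma>. star_rep \<sigma> \<and>
     is_adjoint (\<sigma> (cuntz_gen False)) tau0 \<and> is_adjoint (\<sigma> (cuntz_gen True)) tau1)"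

lift_definition join_dlim :: "bool \<Rightarrow> 'a::pythagorean dlim \<Rightarrow> 'a dlim"
  is "\<lambda>b t. if b then Nd (Lf 0) t else Nd t (Lf 0)"
  by (auto intro: leqv_Nd)

lemma linner_zero_left: "linner (Lf 0) t = 0"
  by (induction t) auto

lemma linner_Nd_zero:
  "linner (Nd (Lf 0) t) s = linner t (lright s)" "linner (Nd t (Lf 0)) s = linner t (lleft s)"
  by (cases s; simp add: linner_zero_left)+

lemma ladd_join: "ladd (Nd (lleft t) (Lf 0)) (Nd (Lf 0) (lright t)) \<sim>\<^sub>l t"
  using leqv_if_grow[OF grow_leaf, THEN equivclp_sym]
  by (cases t) (simp_all add: ladd_zero ladd_commute[of _ "Lf 0"])

lemma join_dlim:
  "bounded_clinear (join_dlim b)"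
  "cinner (join_dlim b x) y = cinner x ((if b then opB else opA) y)"
  "(if b then opB else opA) (join_dlim b x) = x"
  "join_dlim False (opA x) + join_dlim True (opB x) = x"
proof -
  show "bounded_clinear (join_dlim b)"
  proof (rule bounded_clinearI[where K=1])
    show "join_dlim b (x + y) = join_dlim b x + join_dlim b y" for x y by transfer simp
    show "join_dlim b (c *\<^sub>C x) = c *\<^sub>C join_dlim b x" for c x by transfer simp
    show "norm (join_dlim b x) \<le> norm x * 1" for x by transfer simp
  qed
  show "cinner (join_dlim b x) y = cinner x ((if b then opB else opA) y)"
  proof (cases b)
    case True
    have "cinner (join_dlim True x) y = cinner x (opB y)" by transfer (simp add: linner_Nd_zero)
    then show ?thesis using True by simp
  next
    case False
    have "cinner (join_dlim False x) y = cinner x (opA y)" by transfer (simp add: linner_Nd_zero)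
    then show ?thesis using False by simp
  qed
  have "opB (join_dlim True x) = x" "opA (join_dlim False x) = x" by (transfer, simp)+
  then show "(if b then opB else opA) (join_dlim b x) = x" by simp
  show "join_dlim False (opA x) + join_dlim True (opB x) = x" by transfer (simp del: ladd.simps add: ladd_join)
qed

lemma bounded_linear_join: "bounded_linear (join_dlim b :: 'a::pythagorean dlim \<Rightarrow> 'a dlim)"
  using join_dlim(1)[of b, where 'a='a] by (simp add: bounded_clinear_def)

lift_definition join :: "bool \<Rightarrow> 'a::pythagorean dilation \<Rightarrow> 'a dilation" is "\<lambda>b X n. join_dlim b (X n)"
proof (elim conjE, intro conjI)
  fix X X' :: "nat \<Rightarrow> 'a dlim" and b
  assume "(\<lambda>n. X n - X' n) \<longlonglongrightarrow> 0"
  from bounded_linear.tendsto_zero[OF bounded_linear_join this]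
  show "(\<lambda>n. join_dlim b (X n) - join_dlim b (X' n)) \<longlonglongrightarrow> 0"
    by (simp add: bounded_linear.linear[OF bounded_linear_join] linear_diff)
qed (simp_all add: bounded_linear.Cauchy[OF bounded_linear_join])

lemma Cauchy_join: "Cauchy X \<Longrightarrow> Cauchy (\<lambda>n. join_dlim b (X n))"
  by (rule bounded_linear.Cauchy[OF bounded_linear_join])

lemma join_cuntz_family:
  "cuntz_family join (\<lambda>b. if b then opB else opA :: 'a::pythagorean dilation \<Rightarrow> 'a dilation)"
proof
  fix b and x :: "'a dilation"
  have adj: "cinner (join b x) y = cinner x ((if b then opB else opA) y)" for b and x y :: "'a dilation"
  proof (cases b)
    case True
    have "cinner (join True x) y = cinner x (opB y)" by transfer (simp add: join_dlim(2))
    then show ?thesis using True by simp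
  next
    case False
    have "cinner (join False x) y = cinner x (opA y)" by transfer (simp add: join_dlim(2))
    then show ?thesis using False by simp
  qed
  have "opB (join True x) = x" for x :: "'a dilation"
    by transfer (simp add: Cauchy_join Cauchy_opB join_dlim(3)[of True, simplified])
  moreover have "opA (join False x) = x" for x :: "'a dilation"
    by transfer (simp add: Cauchy_join Cauchy_opA join_dlim(3)[of False, simplified])
  ultimately have isom: "(if b then opB else opA) (join b x) = x" for b and x :: "'a dilation"
    by (cases b) auto
  show "(if b then opB else opA) (join b x) = x" by (rule isom)
  show "is_adjoint (join b) (if b then opB else opA :: 'a dilation \<Rightarrow> 'a dilation)" 
    unfolding is_adjoint_def by (intro allI adj)
  have join_norm: "norm (join b x) = norm x" for x :: "'a dilation"
  proof -
    have "complex_of_real ((norm (join b x))\<^sup>2) = complex_of_real ((norm x)\<^sup>2)"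
      unfolding cinner_self[symmetric] adj isom ..
    then show ?thesis by (simp only: of_real_eq_iff) simp
  qed
  show "bounded_clinear (join b :: 'a dilation \<Rightarrow> _)"
  proof (rule bounded_clinearI[where K=1])
    show "join b (x + y) = join b x + join b y" for x y :: "'a dilation"
      by transfer (simp add: Cauchy_join Cauchy_add bounded_clinear_add[OF join_dlim(1)])
    show "join b (c *\<^sub>C x) = c *\<^sub>C join b x" for c and x :: "'a dilation"
      by transfer (simp add: Cauchy_join Cauchy_scaleC bounded_clinear_scaleC[OF join_dlim(1)])
    show "norm (join b x) \<le> norm x * 1" for x :: "'a dilation" by (simp add: join_norm)
  qed
  show "bounded_clinear (if b then opB else opA :: 'a dilation \<Rightarrow> 'a dilation)"
    by (simp add: bounded_clinear_opA bounded_clinear_opB)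
  show "join False ((if False then opB else opA) x) + join True ((if True then opB else opA) x) = x"
    unfolding if_True if_False by transfer (simp add: join_dlim(4) Cauchy_join Cauchy_opA Cauchy_opB)
qed

lemma associated_rep:
  "star_rep (associated_rep :: cuntz \<Rightarrow> 'a::pmodule dilation \<Rightarrow> 'a dilation)"
  "is_adjoint (associated_rep (cuntz_gen False)) (tau0 :: 'a dilation \<Rightarrow> 'a dilation)"
  "is_adjoint (associated_rep (cuntz_gen True)) (tau1 :: 'a dilation \<Rightarrow> 'a dilation)"
proof -
  have adj: "is_adjoint (join False) (tau0 :: 'a dilation \<Rightarrow> _)" "is_adjoint (join True) (tau1 :: 'a dilation \<Rightarrow> _)"
    using cuntz_family.adj[OF join_cuntz_family, of False] cuntz_family.adj[OF join_cuntz_family, of True] by simp_all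
  have iff: "is_adjoint (\<sigma> (cuntz_gen False)) tau0 \<and> is_adjoint (\<sigma> (cuntz_gen True)) tau1
      \<longleftrightarrow> (\<forall>b. \<sigma> (cuntz_gen b) = join b)" for \<sigma> :: "cuntz \<Rightarrow> 'a dilation \<Rightarrow> 'a dilation"
  proof
    assume "is_adjoint (\<sigma> (cuntz_gen False)) tau0 \<and> is_adjoint (\<sigma> (cuntz_gen True)) tau1"
    then have "\<sigma> (cuntz_gen False) = join False" "\<sigma> (cuntz_gen True) = join True"
      using adj by (blast intro: is_adjoint_unique)+
    then show "\<forall>b. \<sigma> (cuntz_gen b) = join b" by (simp add: all_bool_eq)
  qed (simp add: adj)
  have "star_rep (associated_rep :: cuntz \<Rightarrow> 'a dilation \<Rightarrow> 'a dilation) \<and>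
     is_adjoint (associated_rep (cuntz_gen False)) (tau0 :: 'a dilation \<Rightarrow> _) \<and>
     is_adjoint (associated_rep (cuntz_gen True)) (tau1 :: 'a dilation \<Rightarrow> _)"
    unfolding associated_rep_def iff by (rule theI'[OF cuntz_universal[OF join_cuntz_family]])
  then show "star_rep (associated_rep :: cuntz \<Rightarrow> 'a dilation \<Rightarrow> 'a dilation)"
    "is_adjoint (associated_rep (cuntz_gen False)) (tau0 :: 'a dilation \<Rightarrow> _)"
    "is_adjoint (associated_rep (cuntz_gen True)) (tau1 :: 'a dilation \<Rightarrow> _)" by auto
qed

section \<open>Thompson's groups inside the Cuntz algebra\<close>

text \<open>
  The Cantor space is the type of Boolean streams; finite words are lists, and \<open>\<mu> @- w\<close> is
  concatenation. A standard partition is a list of finite words such that every infinite word has exactly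
  one of them as a prefix.
\<close>

definition standard_partition :: "bool list list \<Rightarrow> bool" where
  "standard_partition \<mu> \<longleftrightarrow> (\<forall>z::bool stream. \<exists>!j. j < length \<mu> \<and> (\<exists>w. z = \<mu> ! j @- w))"

text \<open>The lexicographic order, restricted to pairs of words neither of which is a prefix of the other.\<close>

definition lex_less :: "bool list \<Rightarrow> bool list \<Rightarrow> bool" where
  "lex_less u v \<longleftrightarrow> (\<exists>p x y. u = p @ False # x \<and> v = p @ True # y)"

definition cyclic_less :: "bool list \<Rightarrow> bool list \<Rightarrow> bool list \<Rightarrow> bool" where
  "cyclic_less u v w \<longleftrightarrow>
    (lex_less u v \<and> lex_less v w) \<or> (lex_less v w \<and> lex_less w u) \<or> (lex_less w u \<and> lex_less u v)"

definition thompson_table :: "bool list list \<Rightarrow> bool list list \<Rightarrow> bool" where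
  "thompson_table \<mu> \<nu> \<longleftrightarrow> standard_partition \<mu> \<and> standard_partition \<nu> \<and> length \<mu> = length \<nu>"

definition linear_table :: "bool list list \<Rightarrow> bool list list \<Rightarrow> bool" where
  "linear_table \<mu> \<nu> \<longleftrightarrow> thompson_table \<mu> \<nu> \<and>
    (\<forall>i<length \<mu>. \<forall>j<length \<mu>. lex_less (\<mu> ! i) (\<mu> ! j) \<longleftrightarrow> lex_less (\<nu> ! i) (\<nu> ! j))"

definition cyclic_table :: "bool list list \<Rightarrow> bool list list \<Rightarrow> bool" where
  "cyclic_table \<mu> \<nu> \<longleftrightarrow> thompson_table \<mu> \<nu> \<and>
    (\<forall>i<length \<mu>. \<forall>j<length \<mu>. \<forall>k<length \<mu>.
      cyclic_less (\<mu> ! i) (\<mu> ! j) (\<mu> ! k) \<longleftrightarrow> cyclic_less (\<nu> ! i) (\<nu> ! j) (\<nu> ! k))"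

definition table_map :: "bool list list \<Rightarrow> bool list list \<Rightarrow> bool stream \<Rightarrow> bool stream" where
  "table_map \<mu> \<nu> z = (THE z'. \<exists>j<length \<mu>. \<exists>w. z = \<mu> ! j @- w \<and> z' = \<nu> ! j @- w)"

definition thompson_V :: "(bool stream \<Rightarrow> bool stream) set" where
  "thompson_V = {table_map \<mu> \<nu> | \<mu> \<nu>. thompson_table \<mu> \<nu>}"

definition thompson_T :: "(bool stream \<Rightarrow> bool stream) set" where
  "thompson_T = {table_map \<mu> \<nu> | \<mu> \<nu>. cyclic_table \<mu> \<nu>}"

definition thompson_F :: "(bool stream \<Rightarrow> bool stream) set" where
  "thompson_F = {table_map \<mu> \<nu> | \<mu> \<nu>. linear_table \<mu> \<nu>}"

primrec cuntz_word :: "bool list \<Rightarrow> cuntz" where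
  "cuntz_word [] = 1"
| "cuntz_word (b # w) = cuntz_gen b * cuntz_word w"

definition table_unitary :: "bool list list \<Rightarrow> bool list list \<Rightarrow> cuntz" where
  "table_unitary \<mu> \<nu> = (\<Sum>j<length \<mu>. cuntz_word (\<nu> ! j) * star (cuntz_word (\<mu> ! j)))"

text \<open>
  The copy in the Cuntz algebra of a subset of \<open>V\<close>. All tables of an element of \<open>V\<close> yield
  the same unitary.
\<close>

definition cuntz_copy :: "(bool stream \<Rightarrow> bool stream) set \<Rightarrow> cuntz set" where
  "cuntz_copy G = {table_unitary \<mu> \<nu> | \<mu> \<nu>. thompson_table \<mu> \<nu> \<and> table_map \<mu> \<nu> \<in> G}"

section \<open>Irreducibility and intertwiners\<close>

text \<open>
  The restriction of a representation of the Cuntz algebra to one of the groups is the restriction to a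
  subset \<open>X\<close> of the algebra. The zero space is not excluded.
\<close>

definition irreducible_on :: "'o set \<Rightarrow> ('o \<Rightarrow> 'h::complex_hilbert \<Rightarrow> 'h) \<Rightarrow> bool" where
  "irreducible_on X \<sigma> \<longleftrightarrow>
    (\<forall>K. csubspace K \<and> closed K \<and> (\<forall>a\<in>X. \<sigma> a ` K \<subseteq> K) \<longrightarrow> K = {0} \<or> K = UNIV)"

definition intertwines_on ::
  "'o set \<Rightarrow> ('o \<Rightarrow> 'h \<Rightarrow> 'h) \<Rightarrow> ('o \<Rightarrow> 'k \<Rightarrow> 'k) \<Rightarrow> ('h::complex_hilbert \<Rightarrow> 'k::complex_hilbert) \<Rightarrow> bool"
  where "intertwines_on X \<sigma> \<rho> \<Theta> \<longleftrightarrow> (\<forall>a\<in>X. \<Theta> \<circ> \<sigma> a = \<rho> a \<circ> \<Theta>)"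

definition unitary_map :: "('h::complex_hilbert \<Rightarrow> 'k::complex_hilbert) \<Rightarrow> bool" where
  "unitary_map U \<longleftrightarrow> bounded_clinear U \<and> bij U \<and> (\<forall>x y. cinner (U x) (U y) = cinner x y)"

definition unitarily_equivalent_on ::
  "'o set \<Rightarrow> ('o \<Rightarrow> 'h::complex_hilbert \<Rightarrow> 'h) \<Rightarrow> ('o \<Rightarrow> 'k::complex_hilbert \<Rightarrow> 'k) \<Rightarrow> bool"
  where "unitarily_equivalent_on X \<sigma> \<rho> \<longleftrightarrow> (\<exists>U. unitary_map U \<and> intertwines_on X \<sigma> \<rho> U)"

section \<open>Notions for P-modules\<close>

definition submodule :: "'a::pmodule set \<Rightarrow> bool" where
  "submodule K \<longleftrightarrow> csubspace K \<and> closed K \<and> opA ` K \<subseteq> K \<and> opB ` K \<subseteq> K"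

definition orth_compl :: "'a::complex_inner set \<Rightarrow> 'a set" where
  "orth_compl K = {x. \<forall>y\<in>K. cinner x y = 0}"

definition complete_submodule :: "'a::pmodule set \<Rightarrow> bool" where
  "complete_submodule K \<longleftrightarrow> submodule K \<and> (\<forall>L. submodule L \<and> L \<subseteq> orth_compl K \<longrightarrow> L = {0})"

definition small_submodule :: "'a::pmodule set" where
  "small_submodule = \<Inter> {K. complete_submodule K}"

definition decomposable :: "'a::pmodule itself \<Rightarrow> bool" where
  "decomposable _ \<longleftrightarrow> (\<exists>K L :: 'a set. submodule K \<and> submodule L \<and> K \<noteq> {0} \<and> L \<noteq> {0} \<and> L \<subseteq> orth_compl K)"

definition indecomposable :: "'a::pmodule itself \<Rightarrow> bool" where
  "indecomposable _ \<longleftrightarrow> \<not> decomposable TYPE('a)"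

definition diffuse :: "'a::pmodule itself \<Rightarrow> bool" where
  "diffuse _ \<longleftrightarrow> (\<forall>\<xi>::'a. \<forall>x::nat \<Rightarrow> 'a \<Rightarrow> 'a. (\<forall>n. x n \<in> {opA, opB}) \<longrightarrow>
    (\<lambda>n. fold x [0..<n] \<xi>) \<longlonglongrightarrow> 0)"

definition finite_dimensional :: "'a::complex_vector itself \<Rightarrow> bool" where
  "finite_dimensional _ \<longleftrightarrow> (\<exists>S. finite S \<and> cspan S = (UNIV :: 'a set))"

text \<open>
  A morphism between sub-modules is given by a function on the ambient space of which only the
  restriction to the sub-module \<open>K\<close> matters.
\<close>

definition pmodule_morphism :: "'a::pmodule set \<Rightarrow> 'b::pmodule set \<Rightarrow> ('a \<Rightarrow> 'b) \<Rightarrow> bool" where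
  "pmodule_morphism K L \<theta> \<longleftrightarrow>
    \<theta> ` K \<subseteq> L \<and>
    (\<forall>x\<in>K. \<forall>y\<in>K. \<theta> (x + y) = \<theta> x + \<theta> y) \<and>
    (\<forall>c. \<forall>x\<in>K. \<theta> (c *\<^sub>C x) = c *\<^sub>C \<theta> x) \<and>
    (\<exists>M. \<forall>x\<in>K. norm (\<theta> x) \<le> M * norm x) \<and>
    (\<forall>x\<in>K. \<theta> (opA x) = opA (\<theta> x)) \<and>
    (\<forall>x\<in>K. \<theta> (opB x) = opB (\<theta> x))"

definition unitarily_equivalent_submodules :: "'a::pmodule set \<Rightarrow> 'b::pmodule set \<Rightarrow> bool" where
  "unitarily_equivalent_submodules K L \<longleftrightarrow>
    (\<exists>\<theta>. pmodule_morphism K L \<theta> \<and> bij_betw \<theta> K L \<and> (\<forall>x\<in>K. \<forall>y\<in>K. cinner (\<theta> x) (\<theta> y) = cinner x y))"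

end

theory Submission
  imports Defs
begin

text \<open>
  Write \<open>join b\<close> for the isometries of the dilation that represent the generators of the Cuntz algebra, and
  \<open>tau b\<close> for their adjoints. Two ideas carry the proof.
  
  The first passes from \<open>F\<close> to the Cuntz algebra. For each \<open>n\<close> there is an element of \<open>F\<close>
  that sends \<open>w\<close> to \<open>b w\<close> whenever \<open>w\<close> does not begin with \<open>n\<close> letters \<open>\<not> b\<close>. On vectors
  without component in the cone of those letters it acts as \<open>join b\<close>, and the component in the cone has the size of
  \<open>tau (\<not> b)\<close> iterated \<open>n\<close> times, which tends to \<open>0\<close> because the module is diffuse. So these
  elements converge strongly to \<open>join b\<close> (\<open>shift_elem_tendsto_join\<close>). Hence an operator that intertwines
  \<open>F\<close> commutes with \<open>join\<close> and \<open>tau\<close> (\<open>F_intertwiner_commutes\<close>), and a closed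
  subspace invariant under \<open>F\<close> is reducing (\<open>F_invariant_subspace_reducing\<close>). The same then holds for every
  group or algebra between \<open>F\<close> and the Cuntz algebra.
  
  The second passes from the dilation to finite dimension. Let \<open>K\<close> be a complete sub-module and let
  \<open>level K n\<close> consist of the vectors that every word of length \<open>n\<close> in \<open>tau False\<close>,
  \<open>tau True\<close> sends into \<open>K\<close>. These subspaces increase, and the orthogonal complement of their union is
  a sub-module orthogonal to \<open>K\<close>; so the union is dense. By Pythagoras the squared distance of a vector to
  \<open>level K n\<close> is the sum of the squared distances to \<open>K\<close> of its images under the words of length
  \<open>n\<close>. Therefore some image of a given nonzero vector is close to \<open>K\<close> relative to its own norm. If
  \<open>K\<close> is finite dimensional, compactness produces from a nonzero sub-module \<open>L\<close> a nonzero vector of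
  \<open>L \<inter> K\<close>; carrying along an intertwiner \<open>\<Theta>\<close> and a second complete sub-module \<open>K'\<close>, that vector can
  be chosen with \<open>\<Theta> y \<in> K'\<close> (\<open>exists_common_vector\<close>).
  
  From this the assertions follow. The vectors of \<open>K\<close> that \<open>\<Theta>\<close> sends into \<open>K'\<close> form a complete
  sub-module. With \<open>\<Theta>\<close> the identity, this says that \<open>K \<inter> K'\<close> is complete, so a complete sub-module of least dimension is the smallest one; with \<open>\<Theta>\<close> an intertwiner,
  \<open>\<Theta>\<close> maps the smallest complete sub-module into the other. A reducing subspace other than
  \<open>0\<close> and the whole space and its orthogonal complement both meet the original module, which is therefore decomposable. Conversely, orthogonal sub-modules of the module
  generate orthogonal reducing subspaces. Finally, a unitary morphism between complete sub-modules extends level by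
  level to a unitary intertwiner of the dilations (\<open>unitary_extension_exists\<close>).
\<close>

section \<open>Closed subspaces of a complex Hilbert space\<close>

interpretation cinner: bounded_bilinear "cinner :: 'a::complex_inner \<Rightarrow> 'a \<Rightarrow> complex"
proof
  fix a b :: 'a and r :: real
  show "cinner (r *\<^sub>R a) b = r *\<^sub>R cinner a b" "cinner a (r *\<^sub>R b) = r *\<^sub>R cinner a b"
    by (simp_all add: scaleR_scaleC cinner_scaleC_left cinner_scaleC_right scaleR_conv_of_real)
  show "\<exists>K. \<forall>a b :: 'a. norm (cinner a b) \<le> norm a * norm b * K"
    by (rule exI[of _ 1]) (simp add: Cauchy_Schwarz)
qed (simp_all add: cinner_add_left cinner_add_right)

lemma cinner_eq_0_commute: "cinner x y = 0 \<longleftrightarrow> cinner y (x::'a::complex_inner) = 0"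
  by (metis cinner_commute complex_cnj_zero)

lemma norm_add_sq:
  "(norm (x + y))\<^sup>2 = (norm x)\<^sup>2 + (norm y)\<^sup>2 + 2 * Re (cinner x (y::'a::complex_inner))"
proof -
  have "complex_of_real ((norm (x + y))\<^sup>2) = cinner x x + cinner y y + (cinner x y + cnj (cinner x y))"
    unfolding cinner_self[symmetric] cinner_commute[of y x, symmetric]
    by (simp only: cinner_add_left cinner_add_right ac_simps)
  also have "\<dots> = complex_of_real ((norm x)\<^sup>2 + (norm y)\<^sup>2 + 2 * Re (cinner x y))"
    by (simp only: cinner_self complex_add_cnj of_real_add)
  finally show ?thesis by (simp only: of_real_eq_iff)
qed

lemma norm_add_orthogonal_sq:
  "cinner x y = 0 \<Longrightarrow> (norm (x + y))\<^sup>2 = (norm x)\<^sup>2 + (norm (y::'a::complex_inner))\<^sup>2"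
  by (simp add: norm_add_sq)

lemma norm_diff_sq:
  "(norm (x - y))\<^sup>2 = (norm x)\<^sup>2 + (norm y)\<^sup>2 - 2 * Re (cinner x (y::'a::complex_inner))"
  using norm_add_sq[of x "- y"] by (simp add: cinner_minus_right)

text \<open>
  If the inner product were nonzero, moving \<open>p\<close> by the best approximation of \<open>x - p\<close> on the line through
  \<open>k\<close> would bring it closer to \<open>x\<close>.
\<close>

lemma nearest_point_orthogonal:
  fixes x p :: "'a::complex_inner"
  assumes K: "csubspace K" and p: "p \<in> K" and least: "\<And>k. k \<in> K \<Longrightarrow> norm (x - p) \<le> norm (x - k)"
    and k: "k \<in> K"
  shows "cinner (x - p) k = 0"
proof (cases "k = 0")
  case False
  define c where "c = cinner (x - p) k / complex_of_real ((norm k)\<^sup>2)"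
  have cc: "cinner (x - p) k = c * complex_of_real ((norm k)\<^sup>2)" using False by (simp add: c_def)
  have "p + c *\<^sub>C k \<in> K" using K p k by (simp add: complex_vec.subspace_add complex_vec.subspace_scale)
  then have "norm (x - p) \<le> norm ((x - p) - c *\<^sub>C k)" using least by (simp add: algebra_simps)
  then have "(norm (x - p))\<^sup>2 \<le> (norm ((x - p) - c *\<^sub>C k))\<^sup>2" by (intro power_mono) auto
  also have "Re (cinner (x - p) (c *\<^sub>C k)) = (cmod c)\<^sup>2 * (norm k)\<^sup>2"
  proof -
    have "cinner (x - p) (c *\<^sub>C k) = complex_of_real ((cmod c)\<^sup>2 * (norm k)\<^sup>2)"
      using complex_norm_square[of c] by (simp add: cinner_scaleC_right cc mult_ac)
    then show ?thesis by (simp only: Re_complex_of_real)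
  qed
  then have "(norm ((x - p) - c *\<^sub>C k))\<^sup>2 = (norm (x - p))\<^sup>2 - (cmod c)\<^sup>2 * (norm k)\<^sup>2"
    by (simp add: norm_diff_sq norm_scaleC power_mult_distrib)
  finally have "c = 0" using False by (simp add: mult_le_0_iff)
  then show ?thesis by (simp add: cc)
qed simp

text \<open>
  By the parallelogram law, points of a subspace that nearly minimise the distance to a given point are close
  to one another, so a minimising sequence is Cauchy.
\<close>

lemma orthogonal_projection_exists:
  fixes x :: "'a::complex_hilbert"
  assumes K: "csubspace K" and cl: "closed K"
  shows "\<exists>p\<in>K. \<forall>k\<in>K. cinner (x - p) k = 0"
proof -
  define d where "d = infdist x K"
  have ne: "K \<noteq> {}" using complex_vec.subspace_0[OF K] by auto
  have dle: "d \<le> norm (x - k)" if "k \<in> K" for k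
    using infdist_le[OF that, of x] by (simp add: d_def dist_norm)
  have d0: "0 \<le> d" by (simp add: d_def infdist_nonneg)
  have "\<exists>k\<in>K. (norm (x - k))\<^sup>2 < d\<^sup>2 + inverse (real (Suc n))" for n
  proof -
    have "d < sqrt (d\<^sup>2 + inverse (real (Suc n)))" using d0 by (intro real_less_rsqrt) auto
    then obtain k where k: "k \<in> K" "dist x k < sqrt (d\<^sup>2 + inverse (real (Suc n)))"
      unfolding d_def infdist_notempty[OF ne] by (subst (asm) cINF_less_iff) (use ne in auto)
    then have "(norm (x - k))\<^sup>2 < (sqrt (d\<^sup>2 + inverse (real (Suc n))))\<^sup>2"
      by (intro power_strict_mono) (auto simp: dist_norm)
    then show ?thesis using k by (auto simp: add_nonneg_nonneg)
  qed
  then obtain p where p: "\<And>n. p n \<in> K" "\<And>n. (norm (x - p n))\<^sup>2 < d\<^sup>2 + inverse (real (Suc n))" by metis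
  have close: "(norm (p m - p n))\<^sup>2 \<le> 2 * inverse (real (Suc m)) + 2 * inverse (real (Suc n))" for m n
  proof -
    define q where "q = (1/2::complex) *\<^sub>C (p m + p n)"
    have "q \<in> K" using K p by (simp add: q_def complex_vec.subspace_add complex_vec.subspace_scale)
    then have "d\<^sup>2 \<le> (norm (x - q))\<^sup>2" using dle d0 by (intro power_mono) auto
    moreover have "(x - p m) + (x - p n) = 2 *\<^sub>C (x - q)"
      using scaleC_add_left[of 1 1 x]
      by (simp add: q_def complex_vec.scale_right_diff_distrib scaleC_scaleC algebra_simps)
    then have "(norm ((x - p m) + (x - p n)))\<^sup>2 = 4 * (norm (x - q))\<^sup>2"
      by (simp add: norm_scaleC power_mult_distrib)
    moreover have "(norm (p m - p n))\<^sup>2 = (norm ((x - p n) - (x - p m)))\<^sup>2" by simp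
    moreover have "(norm ((x - p n) - (x - p m)))\<^sup>2 + (norm ((x - p n) + (x - p m)))\<^sup>2
        = 2 * (norm (x - p m))\<^sup>2 + 2 * (norm (x - p n))\<^sup>2"
      unfolding norm_add_sq[of "x - p n" "x - p m"] norm_diff_sq[of "x - p n" "x - p m"] by simp
    ultimately show ?thesis using p(2)[of m] p(2)[of n] by (simp add: add.commute)
  qed
  have "Cauchy p"
  proof (rule CauchyI)
    fix e :: real assume e: "e > 0"
    then obtain N where N: "inverse (real (Suc N)) < e\<^sup>2 / 4" using reals_Archimedean[of "e\<^sup>2/4"] by auto
    have "norm (p m - p n) < e" if "m \<ge> N" "n \<ge> N" for m n
    proof (rule power2_less_imp_less)
      have "inverse (real (Suc m)) \<le> inverse (real (Suc N))" "inverse (real (Suc n)) \<le> inverse (real (Suc N))"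
        using that by (simp_all add: field_simps)
      then show "(norm (p m - p n))\<^sup>2 < e\<^sup>2" using close[of m n] N by linarith
    qed (use e in simp)
    then show "\<exists>M. \<forall>m\<ge>M. \<forall>n\<ge>M. norm (p m - p n) < e" by blast
  qed
  then obtain q where q: "p \<longlonglongrightarrow> q" by (auto simp: Cauchy_convergent_iff convergent_def)
  have qK: "q \<in> K" by (rule closed_sequentially[OF cl _ q]) (use p in auto)
  have "(norm (x - q))\<^sup>2 \<le> d\<^sup>2 + 0"
  proof (rule LIMSEQ_le[OF _ tendsto_add[OF tendsto_const LIMSEQ_inverse_real_of_nat]])
    show "(\<lambda>n. (norm (x - p n))\<^sup>2) \<longlonglongrightarrow> (norm (x - q))\<^sup>2" by (intro tendsto_intros q)
    show "\<exists>N. \<forall>n\<ge>N. (norm (x - p n))\<^sup>2 \<le> d\<^sup>2 + inverse (real (Suc n))"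
      using less_imp_le[OF p(2)] by auto
  qed
  then have "norm (x - q) \<le> d" using power2_le_imp_le[OF _ d0] by simp
  then have "norm (x - q) \<le> norm (x - k)" if "k \<in> K" for k using dle[OF that] by linarith
  then show ?thesis by (intro bexI[OF _ qK] ballI nearest_point_orthogonal[OF K qK])
qed

lemma csubspace_orth_compl: "csubspace (orth_compl K)"
  unfolding complex_vec.subspace_def orth_compl_def by (auto simp: cinner_add_left cinner_scaleC_left)

lemma closed_orth_compl: "closed (orth_compl (K :: 'a::complex_inner set))"
proof -
  have "orth_compl K = (\<Inter>y\<in>K. {x. cinner x y = 0})" by (auto simp: orth_compl_def)
  moreover have "closed {x :: 'a. cinner x y = 0}" for y
    by (intro closed_Collect_eq cinner.continuous_on continuous_intros)
  ultimately show ?thesis by auto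
qed

lemma orth_compl_antimono: "K \<subseteq> L \<Longrightarrow> orth_compl L \<subseteq> orth_compl K"
  by (auto simp: orth_compl_def)

lemma subset_orth_compl_commute: "L \<subseteq> orth_compl K \<longleftrightarrow> K \<subseteq> orth_compl L"
  unfolding orth_compl_def subset_iff mem_Collect_eq Ball_def by (metis cinner_eq_0_commute)

lemma self_orthogonal_eq_0: "x \<in> K \<Longrightarrow> x \<in> orth_compl K \<Longrightarrow> (x::'a::complex_inner) = 0"
  using cinner_self[of x] by (simp add: orth_compl_def)

lemma orth_compl_orth_compl:
  fixes K :: "'a::complex_hilbert set"
  assumes K: "csubspace K" and "closed K"
  shows "orth_compl (orth_compl K) = K"
proof
  show "orth_compl (orth_compl K) \<subseteq> K"
  proof
    fix x assume x: "x \<in> orth_compl (orth_compl K)"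
    obtain p where p: "p \<in> K" "\<forall>k\<in>K. cinner (x - p) k = 0"
      using orthogonal_projection_exists[OF assms] by blast
    then have "x - p \<in> orth_compl K" by (simp add: orth_compl_def)
    moreover have "p \<in> orth_compl (orth_compl K)" using p(1) subset_orth_compl_commute by blast
    then have "x - p \<in> orth_compl (orth_compl K)"
      using x by (rule complex_vec.subspace_diff[OF csubspace_orth_compl, rotated])
    ultimately show "x \<in> K" using self_orthogonal_eq_0 p(1) by fastforce
  qed
qed (use subset_orth_compl_commute in blast)

lemma closed_subspace_eq_UNIV:
  fixes K :: "'a::complex_hilbert set"
  assumes "csubspace K" "closed K" "orth_compl K = {0}"
  shows "K = UNIV"
proof -
  have "orth_compl {0 :: 'a} = UNIV" by (simp add: orth_compl_def)
  then show ?thesis using orth_compl_orth_compl[OF assms(1,2)] assms(3) by simp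
qed

definition proj :: "'a::complex_hilbert set \<Rightarrow> 'a \<Rightarrow> 'a" where
  "proj K x = (SOME p. p \<in> K \<and> (\<forall>k\<in>K. cinner (x - p) k = 0))"

context
  fixes K :: "'a::complex_hilbert set"
  assumes K: "csubspace K" and cl: "closed K"
begin

lemma proj_in: "proj K x \<in> K" and proj_orth: "k \<in> K \<Longrightarrow> cinner (x - proj K x) k = 0"
  using someI_ex[OF orthogonal_projection_exists[OF K cl, of x, unfolded Bex_def]] unfolding proj_def by blast+

lemma proj_eqI:
  assumes p: "p \<in> K" and orth: "\<And>k. k \<in> K \<Longrightarrow> cinner (x - p) k = 0" shows "proj K x = p"
proof -
  have d: "proj K x - p \<in> K" using p proj_in K by (simp add: complex_vec.subspace_diff)
  have "cinner (proj K x - p) (proj K x - p) = cinner (x - p) (proj K x - p) - cinner (x - proj K x) (proj K x - p)"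
    by (simp add: cinner_diff_left)
  also have "\<dots> = 0" using d orth proj_orth by simp
  finally show ?thesis by (simp add: cinner_self)
qed

lemma proj_id: "x \<in> K \<Longrightarrow> proj K x = x"
  by (rule proj_eqI) auto

lemma bounded_clinear_proj: "bounded_clinear (proj K)" and norm_proj_le: "norm (proj K x) \<le> norm x"
proof -
  show le: "norm (proj K x) \<le> norm x" for x
  proof (rule power2_le_imp_le)
    have "cinner (x - proj K x) (proj K x) = 0" by (intro proj_orth proj_in)
    from norm_add_orthogonal_sq[OF this] show "(norm (proj K x))\<^sup>2 \<le> (norm x)\<^sup>2" by simp
  qed simp
  show "bounded_clinear (proj K)"
  proof (rule bounded_clinearI[where K=1])
    fix x y :: 'a and c
    show "proj K (x + y) = proj K x + proj K y"
    proof (rule proj_eqI)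
      fix k assume "k \<in> K"
      then have "cinner (x - proj K x) k + cinner (y - proj K y) k = 0" by (simp add: proj_orth)
      then show "cinner (x + y - (proj K x + proj K y)) k = 0"
        by (simp add: cinner_add_left[symmetric] algebra_simps)
    qed (simp add: K complex_vec.subspace_add proj_in)
    show "proj K (c *\<^sub>C x) = c *\<^sub>C proj K x"
      by (rule proj_eqI) (simp_all add: K complex_vec.subspace_scale proj_in proj_orth
          complex_vec.scale_right_diff_distrib[symmetric] cinner_scaleC_left)
    show "norm (proj K x) \<le> norm x * 1" by (simp add: le)
  qed
qed

end

subsection \<open>Finite-dimensional subspaces\<close>

lemma closed_if_bolzano_weierstrass:
  fixes K :: "'a::real_normed_vector set"
  assumes bw: "\<And>X M. (\<And>n. X n \<in> K) \<Longrightarrow> (\<And>n. norm (X n) \<le> M) \<Longrightarrow>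
      \<exists>l\<in>K. \<exists>r. strict_mono (r :: nat \<Rightarrow> nat) \<and> (X \<circ> r) \<longlonglongrightarrow> l"
  shows "closed K"
proof (unfold closed_sequential_limits, intro allI impI, elim conjE)
  fix Y l assume Y: "\<forall>n. Y n \<in> K" "Y \<longlonglongrightarrow> l"
  obtain M where "\<And>n. norm (Y n) \<le> M" using convergent_imp_Bseq[OF convergentI[OF Y(2)]] by (metis BseqE)
  then obtain l' r where "l' \<in> K" "strict_mono r" "(Y \<circ> r) \<longlonglongrightarrow> l'" using bw[of Y M] Y(1) by metis
  moreover have "(Y \<circ> r) \<longlonglongrightarrow> l" using LIMSEQ_subseq_LIMSEQ[OF Y(2) \<open>strict_mono r\<close>] .
  ultimately show "l \<in> K" using LIMSEQ_unique by metis
qed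

text \<open>
  Bolzano-Weierstrass for the span of a finite set, by adjoining one vector at a time: the component of the new
  vector orthogonal to the span of the old ones contributes one bounded sequence of scalars.
\<close>

lemma finite_span_bolzano_weierstrass:
  fixes B :: "'a::complex_hilbert set" and X :: "nat \<Rightarrow> 'a"
  assumes "finite B" "\<And>n. X n \<in> cspan B" "\<And>n. norm (X n) \<le> M"
  shows "\<exists>l\<in>cspan B. \<exists>r. strict_mono r \<and> (X \<circ> r) \<longlonglongrightarrow> l"
  using assms
proof (induction B arbitrary: X M rule: finite_induct)
  case empty
  then have "X = (\<lambda>_. 0)" by (simp add: fun_eq_iff)
  then have "(X \<circ> id) \<longlonglongrightarrow> 0" unfolding o_def by simp
  then show ?case using strict_mono_id by (intro bexI[of _ 0] exI[of _ id] conjI) (simp_all only: complex_vec.span_zero)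
next
  case (insert b B)
  let ?K = "cspan B"
  have K: "csubspace ?K" by simp
  have cl: "closed ?K" by (rule closed_if_bolzano_weierstrass) (rule insert.IH)
  \<comment> \<open>the span is unchanged when \<open>b\<close> is replaced by its part orthogonal to the old span\<close>
  define q where "q = b - proj ?K b"
  have qK: "cinner q k = 0" if "k \<in> ?K" for k using proj_orth[OF K cl that] by (simp add: q_def)
  have sub: "?K \<subseteq> cspan (insert b B)" by (rule complex_vec.span_mono) auto
  have q_in: "q \<in> cspan (insert b B)"
    using proj_in[OF K cl, of b] sub complex_vec.span_base[of b "insert b B"]
    by (auto simp: q_def intro: complex_vec.span_diff)
  have "\<exists>y c. X n = y + c *\<^sub>C q \<and> y \<in> ?K" for n
  proof -
    obtain c where c: "X n - c *\<^sub>C b \<in> ?K" using insert.prems(1)[of n] by (auto simp: complex_vec.span_breakdown_eq)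
    have "X n = (X n - c *\<^sub>C b + c *\<^sub>C proj ?K b) + c *\<^sub>C q"
      by (simp add: q_def complex_vec.scale_right_diff_distrib)
    moreover have "X n - c *\<^sub>C b + c *\<^sub>C proj ?K b \<in> ?K"
      by (intro complex_vec.span_add c complex_vec.span_scale proj_in K cl)
    ultimately show ?thesis by blast
  qed
  then obtain Y C where YC: "\<And>n. X n = Y n + C n *\<^sub>C q" "\<And>n. Y n \<in> ?K" by metis
  have sq: "(norm (X n))\<^sup>2 = (norm (Y n))\<^sup>2 + (norm (C n *\<^sub>C q))\<^sup>2" for n
    unfolding YC by (rule norm_add_orthogonal_sq) (simp add: cinner_scaleC_right qK YC cinner_eq_0_commute[of _ q])
  have le: "norm (Y n) \<le> norm (X n)" "norm (C n *\<^sub>C q) \<le> norm (X n)" for n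
    by (rule power2_le_imp_le, simp_all add: sq)+
  obtain l r where lr: "l \<in> ?K" "strict_mono r" "(Y \<circ> r) \<longlonglongrightarrow> l"
    using insert.IH[of Y M] YC(2) order_trans[OF le(1) insert.prems(2)] by metis
  have "\<exists>c s. strict_mono s \<and> (\<lambda>n. C (r (s n)) *\<^sub>C q) \<longlonglongrightarrow> c *\<^sub>C q"
  proof (cases "q = 0")
    case False
    have "cmod (C n) \<le> M / norm q" for n
      using le(2)[of n] insert.prems(2)[of n] False by (simp add: norm_scaleC field_simps)
    then have "bounded (range (C \<circ> r))" by (auto simp: bounded_iff)
    then obtain c s where cs: "strict_mono s" "((C \<circ> r) \<circ> s) \<longlonglongrightarrow> c"
      using bounded_imp_convergent_subsequence by blast
    have "bounded_linear (\<lambda>c. c *\<^sub>C q)"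
      by (rule bounded_linear_intro[where K="norm q"])
        (simp_all add: scaleC_add_left scaleR_scaleC scaleC_scaleC norm_scaleC scaleR_conv_of_real)
    from bounded_linear.tendsto[OF this cs(2)] cs(1) show ?thesis by (auto simp: o_def)
  qed (auto intro!: exI[of _ id] simp: strict_mono_id)
  then obtain c s where cs: "strict_mono s" "(\<lambda>n. C (r (s n)) *\<^sub>C q) \<longlonglongrightarrow> c *\<^sub>C q" by blast
  have "(\<lambda>n. Y (r (s n)) + C (r (s n)) *\<^sub>C q) \<longlonglongrightarrow> l + c *\<^sub>C q"
    using LIMSEQ_subseq_LIMSEQ[OF lr(3) cs(1)] cs(2) by (intro tendsto_add) (simp_all add: o_def)
  then have "(X \<circ> (r \<circ> s)) \<longlonglongrightarrow> l + c *\<^sub>C q" by (simp add: YC(1)[symmetric] o_def)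
  moreover have "l + c *\<^sub>C q \<in> cspan (insert b B)"
    using lr(1) sub q_in by (auto intro: complex_vec.span_add complex_vec.span_scale)
  ultimately show ?case using strict_mono_o[OF lr(2) cs(1)] by (intro bexI exI conjI)
qed

lemma closed_cspan_finite: "finite B \<Longrightarrow> closed (cspan (B :: 'a::complex_hilbert set))"
  by (rule closed_if_bolzano_weierstrass) (rule finite_span_bolzano_weierstrass)

section \<open>The Cuntz family of the dilation\<close>

definition tau :: "bool \<Rightarrow> 'a::pythagorean \<Rightarrow> 'a" where
  "tau b = (if b then opB else opA)"

lemma tau_eq: "tau = (\<lambda>b. if b then opB else opA)"
  by (simp add: tau_def fun_eq_iff)

lemma bounded_clinear_tau: "bounded_clinear (tau b)"
  by (simp add: tau_def bounded_clinear_opA bounded_clinear_opB)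

lemmas tendsto_tau = bounded_linear.tendsto[OF bounded_clinear_tau[unfolded bounded_clinear_def, THEN conjunct1]]

lemma tau_linear:
  fixes x y :: "'a::pythagorean"
  shows "tau b (x + y) = tau b x + tau b y" "tau b (c *\<^sub>C x) = c *\<^sub>C tau b x"
  "tau b (x - y) = tau b x - tau b y" "tau b 0 = (0 :: 'a)"
proof -
  interpret bounded_linear "tau b :: 'a \<Rightarrow> 'a"
    by (rule bounded_clinear_tau[unfolded bounded_clinear_def, THEN conjunct1])
  show "tau b (x + y) = tau b x + tau b y" "tau b (x - y) = tau b x - tau b y" "tau b 0 = (0 :: 'a)"
    by (rule add diff zero)+
  show "tau b (c *\<^sub>C x) = c *\<^sub>C tau b x" by (rule bounded_clinear_scaleC[OF bounded_clinear_tau])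
qed

lemma norm_tau_sq: "(norm x)\<^sup>2 = (norm (tau False x))\<^sup>2 + (norm (tau True x))\<^sup>2"
  by (simp add: tau_def pythagorean_norm)

lemma norm_tau_le: "norm (tau b x) \<le> norm x"
  by (simp add: tau_def norm_opA_le norm_opB_le)

lemma submodule_tau:
  "submodule K \<longleftrightarrow> csubspace K \<and> closed K \<and> (\<forall>b. \<forall>x\<in>K. tau b x \<in> K)"
  unfolding submodule_def all_bool_eq by (auto simp: tau_def)

interpretation dil: cuntz_family join "tau :: bool \<Rightarrow> 'a::pythagorean dilation \<Rightarrow> 'a dilation"
  by (subst tau_eq) (rule join_cuntz_family)

lemma cinner_join: "cinner (join b x) y = cinner x (tau b (y :: 'a::pythagorean dilation))"
  "cinner y (join b x) = cinner (tau b y) x"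
  by (rule dil.adj[unfolded is_adjoint_def, rule_format],
      rule dil.adj[THEN is_adjoint_sym, unfolded is_adjoint_def, rule_format, symmetric])

lemma join_linear:
  "join b (x + y) = join b x + join b (y :: 'a::pythagorean dilation)"
  "join b (c *\<^sub>C x) = c *\<^sub>C join b x" "join b (x - y) = join b x - join b y" "join b 0 = (0 :: 'a dilation)"
proof -
  interpret bounded_linear "join b :: 'a dilation \<Rightarrow> _"
    by (rule dil.S[unfolded bounded_clinear_def, THEN conjunct1])
  show "join b (x + y) = join b x + join b y" "join b (x - y) = join b x - join b y" "join b 0 = (0 :: 'a dilation)"
    by (rule add diff zero)+
  show "join b (c *\<^sub>C x) = c *\<^sub>C join b x" by (rule bounded_clinear_scaleC[OF dil.S])
qed

text \<open>
  The two isometries have orthogonal ranges: subtracting \<open>join b x\<close> from its decomposition along both ranges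
  leaves the component in the other range equal to \<open>0\<close>.
\<close>

lemma tau_join: "tau c (join b x) = (if c = b then x else (0 :: 'a::pythagorean dilation))"
proof (cases "c = b")
  case False
  have "join b (tau b y) + join c (tau c y) = y" for y :: "'a dilation"
    using dil.ranges[of y] False by (cases b; cases c) (simp_all add: add.commute)
  from this[of "join b x"] have "join b (tau b (join b x)) + join c (tau c (join b x)) = join b x" .
  then have "join c (tau c (join b x)) = 0" by (simp add: dil.isom)
  then show ?thesis using dil.isom[of c "tau c (join b x)"] False by (simp add: tau_linear)
qed (simp add: dil.isom)

lemma tau_eqI: "(\<And>b. tau b x = tau b y) \<Longrightarrow> x = (y :: 'a::pythagorean dilation)"
  by (metis dil.ranges)

lemma norm_join [simp]: "norm (join b x) = norm (x :: 'a::pythagorean dilation)"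
  using norm_tau_sq[of "join b x"] by (cases b) (simp_all add: tau_join)

lemmas tendsto_join = bounded_linear.tendsto[OF dil.S[unfolded bounded_clinear_def, THEN conjunct1]]

lemma associated_rep_gen: "associated_rep (cuntz_gen b) = (join b :: 'a::pmodule dilation \<Rightarrow> _)"
proof (rule is_adjoint_unique[OF _ dil.adj])
  show "is_adjoint (associated_rep (cuntz_gen b)) (tau b :: 'a dilation \<Rightarrow> _)"
    by (cases b) (simp_all add: tau_def associated_rep(2,3))
qed

lemma associated_rep_gen_star: "associated_rep (star (cuntz_gen b)) = (tau b :: 'a::pmodule dilation \<Rightarrow> _)"
  by (rule is_adjoint_unique[OF star_repD(6)[OF associated_rep(1)]])
    (simp add: associated_rep_gen is_adjoint_sym[OF dil.adj])

subsection \<open>The module inside its dilation\<close>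

definition incl :: "'a::pmodule \<Rightarrow> 'a dilation" where
  "incl x = embed (abs_dlim (Lf x))"

lemma tau_embed: "tau b (embed y) = embed (tau b y)"
proof -
  have "opA (embed y) = embed (opA y)" "opB (embed y) = embed (opB y)" by (transfer, simp)+
  then show ?thesis by (simp add: tau_def)
qed

lemma tau_abs_dlim:
  "tau b (abs_dlim (Lf x)) = abs_dlim (Lf (tau b x))"
  "tau b (abs_dlim (Nd l r)) = abs_dlim (if b then r else l)"
  by (simp_all add: tau_def opA_dlim.abs_eq opB_dlim.abs_eq)

lemma tau_incl: "tau b (incl x) = incl (tau b x)"
  by (simp add: incl_def tau_embed tau_abs_dlim)

lemma incl_linear: "incl (x + y) = incl x + incl y" "incl (c *\<^sub>C x) = c *\<^sub>C incl x"
  by (simp_all add: incl_def embed_add[symmetric] plus_dlim.abs_eq embed_scaleC[symmetric] scaleC_dlim.abs_eq)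

lemma cinner_incl: "cinner (incl x) (incl y) = cinner x y"
  by (simp add: incl_def cinner_embed cinner_dlim.abs_eq)

lemma norm_incl [simp]: "norm (incl x) = norm x"
  by (simp add: incl_def norm_dlim.abs_eq)

lemma incl_eq_0 [simp]: "incl x = 0 \<longleftrightarrow> x = 0"
proof -
  have "incl x = 0 \<longleftrightarrow> norm (incl x) = 0" by (rule norm_eq_zero[symmetric])
  also have "\<dots> \<longleftrightarrow> x = 0" by (simp only: norm_incl norm_eq_zero)
  finally show ?thesis .
qed

lemma incl_zero [simp]: "incl 0 = 0"
  by (simp only: incl_eq_0)

lemma tau_power_diff_le: "norm ((tau b ^^ n) x - (tau b ^^ n) y) \<le> norm (x - y)"
proof (induction n)
  case (Suc n)
  then show ?case using norm_tau_le[of b "(tau b ^^ n) x - (tau b ^^ n) y"] by (simp add: tau_linear)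
qed simp

text \<open>
  On a labelled tree, enough applications of \<open>tau b\<close> descend to a single leaf, where the decay is diffuseness of
  the module. Labelled trees are dense and \<open>tau b\<close> is a contraction.
\<close>

lemma tau_power_tendsto_0:
  fixes x :: "'a::pmodule dilation"
  assumes "diffuse TYPE('a)"
  shows "(\<lambda>n. (tau b ^^ n) x) \<longlonglongrightarrow> 0"
proof -
  have fold: "fold (\<lambda>_. f) [0..<n] = f ^^ n" for f :: "'a \<Rightarrow> 'a" and n
    by (induction n) auto
  have base: "(\<lambda>n. (tau b ^^ n) \<xi>) \<longlonglongrightarrow> 0" for \<xi> :: 'a
  proof -
    have "tau b \<in> {opA, opB :: 'a \<Rightarrow> 'a}" by (simp add: tau_def)
    then show ?thesis using assms[unfolded diffuse_def, rule_format, of "\<lambda>_. tau b" \<xi>] by (simp add: fold)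
  qed
  have "(\<lambda>n. (tau b ^^ n) (embed (abs_dlim t) :: 'a dilation)) \<longlonglongrightarrow> 0" for t
  proof (induction t)
    case (Lf \<xi>)
    have "(tau b ^^ n) (incl \<xi>) = incl ((tau b ^^ n) \<xi>)" for n
      by (induction n) (simp_all add: tau_incl)
    then have "(\<lambda>n. norm ((tau b ^^ n) (incl \<xi>))) \<longlonglongrightarrow> 0" using tendsto_norm_zero[OF base[of \<xi>]] by simp
    then show ?case unfolding incl_def by (rule tendsto_norm_zero_cancel)
  next
    case (Nd l r)
    then show ?case
      by - (rule LIMSEQ_imp_Suc, cases b,
          simp_all add: funpow_Suc_right tau_embed tau_abs_dlim del: funpow.simps)
  qed
  then have dense: "(\<lambda>n. (tau b ^^ n) (embed y :: 'a dilation)) \<longlonglongrightarrow> 0" for y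
    by (induction y rule: dlim.abs_induct)
  show ?thesis
  proof (rule LIMSEQ_I)
    fix e :: real assume e: "e > 0"
    have "x \<in> closure (range embed)" by (simp add: embed_dense)
    then obtain y where y: "norm (embed y - x) < e / 2"
      using e unfolding closure_approachable dist_norm by (metis half_gt_zero imageE)
    obtain N where N: "\<And>n. n \<ge> N \<Longrightarrow> norm ((tau b ^^ n) (embed y :: 'a dilation)) < e / 2"
      using LIMSEQ_D[OF dense[of y], of "e / 2"] e by auto
    have "norm ((tau b ^^ n) x - 0) < e" if "n \<ge> N" for n
      using N[OF that] y tau_power_diff_le[of n b "embed y" x]
        norm_triangle_ineq4[of "(tau b ^^ n) (embed y)" "(tau b ^^ n) (embed y) - (tau b ^^ n) x"]
      by simp
    then show "\<exists>N. \<forall>n\<ge>N. norm ((tau b ^^ n) x - 0) < e" by blast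
  qed
qed

section \<open>Complete sub-modules of a dilation\<close>

lemma csubspace_closure:
  fixes K :: "'a::complex_normed_vector set"
  assumes K: "csubspace K" shows "csubspace (closure K)"
  unfolding complex_vec.subspace_def
proof (intro conjI ballI allI)
  show "0 \<in> closure K" using complex_vec.subspace_0[OF K] closure_subset by blast
next
  fix x y assume "x \<in> closure K" "y \<in> closure K"
  then obtain X Y where "\<And>n. X n \<in> K" "X \<longlonglongrightarrow> x" "\<And>n. Y n \<in> K" "Y \<longlonglongrightarrow> y"
    unfolding closure_sequential by metis
  then show "x + y \<in> closure K"
    unfolding closure_sequential by - (rule exI[of _ "\<lambda>n. X n + Y n"], auto intro: tendsto_add complex_vec.subspace_add[OF K])
next
  fix c x assume "x \<in> closure K"
  then obtain X where "\<And>n. X n \<in> K" "X \<longlonglongrightarrow> x" unfolding closure_sequential by metis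
  then show "c *\<^sub>C x \<in> closure K"
    unfolding closure_sequential by - (rule exI[of _ "\<lambda>n. c *\<^sub>C X n"], auto intro: tendsto_scaleC complex_vec.subspace_scale[OF K])
qed

text \<open>
  An operator that preserves a subspace has an adjoint that preserves the orthogonal complement.
\<close>

lemma submodule_orth_compl:
  fixes K :: "'a::pmodule dilation set"
  assumes "\<And>b x. x \<in> K \<Longrightarrow> join b x \<in> K" shows "submodule (orth_compl K)"
  unfolding submodule_tau using assms
  by (auto simp: csubspace_orth_compl closed_orth_compl) (simp add: orth_compl_def cinner_join(2)[symmetric])

text \<open>
  In a dilation, the vectors \<open>\<Sum>\<^sub>w s\<^sub>w k\<^sub>w\<close>, where \<open>w\<close> runs over the words of length \<open>n\<close> and
  \<open>k\<^sub>w \<in> K\<close>, described by their coefficients.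
\<close>

primrec level :: "'a::pmodule set \<Rightarrow> nat \<Rightarrow> 'a set" where
  "level K 0 = K"
| "level K (Suc n) = {x. \<forall>b. tau b x \<in> level K n}"

lemma csubspace_level: "csubspace K \<Longrightarrow> csubspace (level K n)"
  by (induction n) (auto simp: complex_vec.subspace_def tau_linear)

lemma level_mono: "submodule K \<Longrightarrow> m \<le> n \<Longrightarrow> level K m \<subseteq> level K n"
proof (rule lift_Suc_mono_le[of "level K"])
  fix n assume K: "submodule K"
  show "level K n \<subseteq> level K (Suc n)"
    using K by (induction n) (auto simp: submodule_tau)
qed

lemma join_level:
  assumes "csubspace K" "x \<in> level K n" shows "join b x \<in> level K (Suc n)"
  using assms complex_vec.subspace_0[OF csubspace_level[OF assms(1)]] by (simp add: tau_join)

text \<open>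
  \<open>join\<close> maps each level into the next, so the orthogonal complement of the union is a sub-module. It is
  orthogonal to \<open>K\<close>, hence zero by completeness.
\<close>

lemma level_union_dense:
  assumes K: "complete_submodule (K :: 'a::pmodule dilation set)"
  shows "closure (\<Union>n. level K n) = UNIV"
proof -
  let ?U = "\<Union>n. level K n"
  have sub: "submodule K" "csubspace K" using K by (auto simp: complete_submodule_def submodule_tau)
  have "csubspace ?U"
  proof (unfold complex_vec.subspace_def, intro conjI ballI allI)
    show "0 \<in> ?U" using complex_vec.subspace_0[OF csubspace_level[OF sub(2), of 0]] by blast
    fix x y assume "x \<in> ?U" "y \<in> ?U"
    then obtain m n where "x \<in> level K m" "y \<in> level K n" by blast
    then have "x \<in> level K (max m n)" "y \<in> level K (max m n)"
      using level_mono[OF sub(1), of m "max m n"] level_mono[OF sub(1), of n "max m n"] by auto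
    then show "x + y \<in> ?U" using complex_vec.subspace_add[OF csubspace_level[OF sub(2)]] by blast
  next
    fix c x assume "x \<in> ?U"
    then show "c *\<^sub>C x \<in> ?U" using complex_vec.subspace_scale[OF csubspace_level[OF sub(2)]] by blast
  qed
  then have cs: "csubspace (closure ?U)" by (rule csubspace_closure)
  have "submodule (orth_compl ?U)"
    using join_level[OF sub(2)] by (intro submodule_orth_compl) blast
  moreover have "K \<subseteq> ?U" using level.simps(1)[of K] by blast
  then have "orth_compl ?U \<subseteq> orth_compl K" by (rule orth_compl_antimono)
  ultimately have "orth_compl ?U = {0}" using K unfolding complete_submodule_def by blast
  moreover have "orth_compl (closure ?U) \<subseteq> orth_compl ?U" by (intro orth_compl_antimono closure_subset)
  ultimately have "orth_compl (closure ?U) = {0}"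
    using complex_vec.subspace_0[OF csubspace_orth_compl] by blast
  then show ?thesis by (intro closed_subspace_eq_UNIV cs closed_closure)
qed

lemma level_approx:
  fixes x :: "'a::pmodule dilation"
  assumes K: "complete_submodule K" and e: "e > 0"
  shows "\<exists>N. \<forall>n\<ge>N. \<exists>u\<in>level K n. norm (x - u) < e"
proof -
  have "x \<in> closure (\<Union>n. level K n)" using level_union_dense[OF K] by simp
  then obtain u N where u: "u \<in> level K N" "norm (x - u) < e"
    using e unfolding closure_approachable by (metis UN_E dist_norm norm_minus_commute)
  moreover have "submodule K" using K by (simp add: complete_submodule_def)
  ultimately show ?thesis using level_mono[of K N] by (meson subsetD)
qed

text \<open>
  All three squared norms split as sums over the two branches \<open>tau False\<close>, \<open>tau True\<close>. If the strict
  inequality failed on both branches, it would fail for the sum; so it survives on one branch, one level closer to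
  \<open>K\<close> and \<open>K'\<close>.
\<close>

lemma descend_level:
  fixes \<Theta> :: "'a::pmodule \<Rightarrow> 'b::pmodule"
  assumes L: "\<And>b x. x \<in> L \<Longrightarrow> tau b x \<in> L" and \<Theta>: "\<And>b x. \<Theta> (tau b x) = tau b (\<Theta> x)"
    and "x \<in> L" "u \<in> level K n" "v \<in> level K' n"
    and "(norm (x - u))\<^sup>2 + (norm (\<Theta> x - v))\<^sup>2 < e * (norm x)\<^sup>2"
  shows "\<exists>y\<in>L. \<exists>u\<in>K. \<exists>v\<in>K'. (norm (y - u))\<^sup>2 + (norm (\<Theta> y - v))\<^sup>2 < e * (norm y)\<^sup>2"
  using assms(3-)
proof (induction n arbitrary: x u v)
  case 0
  then show ?case by auto
next
  case (Suc n)
  have "\<exists>b. (norm (tau b x - tau b u))\<^sup>2 + (norm (\<Theta> (tau b x) - tau b v))\<^sup>2 < e * (norm (tau b x))\<^sup>2"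
  proof (rule ccontr)
    assume "\<not> ?thesis"
    then have ge: "e * (norm (tau b x))\<^sup>2 \<le> (norm (tau b (x - u)))\<^sup>2 + (norm (tau b (\<Theta> x - v)))\<^sup>2" for b
      by (simp add: tau_linear \<Theta> not_less)
    show False
      using ge[of False] ge[of True] Suc.prems(4) norm_tau_sq[of "x - u"] norm_tau_sq[of "\<Theta> x - v"] norm_tau_sq[of x]
      by (simp add: distrib_left)
  qed
  then obtain b where "(norm (tau b x - tau b u))\<^sup>2 + (norm (\<Theta> (tau b x) - tau b v))\<^sup>2 < e * (norm (tau b x))\<^sup>2" ..
  moreover have "tau b u \<in> level K n" "tau b v \<in> level K' n" using Suc.prems by auto
  ultimately show ?case using Suc.IH L[OF Suc.prems(1)] by blast
qed

text \<open>
  Approximating a nonzero vector of \<open>L\<close> and its image on a deep level, then descending and normalising, gives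
  unit vectors of \<open>L\<close> nearly in \<open>K\<close> whose images are nearly in \<open>K'\<close>. Since \<open>K\<close> is finite
  dimensional, a subsequence converges; the limit is the required vector because \<open>L\<close>, \<open>K\<close> and \<open>K'\<close> are closed.
\<close>

lemma exists_common_vector:
  fixes \<Theta> :: "'a::pmodule dilation \<Rightarrow> 'b::pmodule dilation"
  assumes K: "complete_submodule K" and B: "finite B" "K \<subseteq> cspan B" and K': "complete_submodule K'"
    and \<Theta>: "bounded_clinear \<Theta>" "\<And>b x. \<Theta> (tau b x) = tau b (\<Theta> x)"
    and L: "submodule L" "L \<noteq> {0}"
  shows "\<exists>y\<in>L \<inter> K. y \<noteq> 0 \<and> \<Theta> y \<in> K'"
proof -
  interpret \<Theta>: bounded_linear \<Theta> using \<Theta>(1) by (simp add: bounded_clinear_def)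
  have cL: "csubspace L" "closed L" "\<And>b x. x \<in> L \<Longrightarrow> tau b x \<in> L" using L(1) by (auto simp: submodule_tau)
  have cK: "csubspace K" "closed K" and cK': "csubspace K'" "closed K'"
    using K K' by (auto simp: complete_submodule_def submodule_tau)
  obtain x where x: "x \<in> L" "x \<noteq> 0" using L(2) complex_vec.subspace_0[OF cL(1)] by blast
  have "\<exists>y u v. y \<in> L \<and> norm y = 1 \<and> u \<in> K \<and> v \<in> K' \<and>
      (norm (y - u))\<^sup>2 + (norm (\<Theta> y - v))\<^sup>2 < inverse (real (Suc k))" for k
  proof -
    define e where "e = inverse (real (Suc k))"
    \<comment> \<open>chosen so that two squared distances below \<open>d\<^sup>2\<close> add up to less than \<open>e * (norm x)\<^sup>2\<close>\<close>
    define d where "d = sqrt (e / 2) * norm x"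
    have e: "e > 0" by (simp add: e_def)
    then have d: "d > 0" using x by (simp add: d_def)
    obtain M N where "\<forall>n\<ge>M. \<exists>u\<in>level K n. norm (x - u) < d" "\<forall>n\<ge>N. \<exists>v\<in>level K' n. norm (\<Theta> x - v) < d"
      using level_approx[OF K d] level_approx[OF K' d] by metis
    then obtain u v where uv: "u \<in> level K (max M N)" "norm (x - u) < d" "v \<in> level K' (max M N)" "norm (\<Theta> x - v) < d"
      by (meson max.cobounded1 max.cobounded2)
    have "(norm (x - u))\<^sup>2 < d\<^sup>2" "(norm (\<Theta> x - v))\<^sup>2 < d\<^sup>2" using uv d by (simp_all add: power_strict_mono)
    moreover have "d\<^sup>2 + d\<^sup>2 = e * (norm x)\<^sup>2" using e by (simp add: d_def power_mult_distrib)
    ultimately have "(norm (x - u))\<^sup>2 + (norm (\<Theta> x - v))\<^sup>2 < e * (norm x)\<^sup>2" by linarith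
    from descend_level[OF cL(3) \<Theta>(2) x(1) uv(1,3) this]
    obtain y p q where y: "y \<in> L" "p \<in> K" "q \<in> K'" "(norm (y - p))\<^sup>2 + (norm (\<Theta> y - q))\<^sup>2 < e * (norm y)\<^sup>2"
      by blast
    have y0: "y \<noteq> 0"
    proof
      assume "y = 0"
      then show False
        using y(4) sum_power2_ge_zero[of "norm (y - p)" "norm (\<Theta> y - q)"] by (simp add: not_less[symmetric])
    qed
    define c where "c = inverse (norm y)"
    have "(norm (c *\<^sub>R y - c *\<^sub>R p))\<^sup>2 + (norm (\<Theta> (c *\<^sub>R y) - c *\<^sub>R q))\<^sup>2
        = c\<^sup>2 * ((norm (y - p))\<^sup>2 + (norm (\<Theta> y - q))\<^sup>2)"
      unfolding \<Theta>.scaleR scaleR_diff_right[symmetric] norm_scaleR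
      by (simp add: power_mult_distrib distrib_left)
    also have "\<dots> < c\<^sup>2 * (e * (norm y)\<^sup>2)" using y(4) y0 by (intro mult_strict_left_mono) (simp_all add: c_def)
    also have "\<dots> = e" using y0 by (simp add: c_def field_simps)
    finally have "(norm (c *\<^sub>R y - c *\<^sub>R p))\<^sup>2 + (norm (\<Theta> (c *\<^sub>R y) - c *\<^sub>R q))\<^sup>2 < e" .
    moreover have "norm (c *\<^sub>R y) = 1" using y0 by (simp add: c_def)
    moreover have "c *\<^sub>R y \<in> L" "c *\<^sub>R p \<in> K" "c *\<^sub>R q \<in> K'"
      using y cL cK cK' by (simp_all add: scaleR_scaleC complex_vec.subspace_scale)
    ultimately show ?thesis unfolding e_def by blast
  qed
  then obtain Y U V where Y: "\<And>k. Y k \<in> L" "\<And>k. norm (Y k) = 1" and U: "\<And>k. U k \<in> K" and V: "\<And>k. V k \<in> K'"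
    and close: "\<And>k. (norm (Y k - U k))\<^sup>2 + (norm (\<Theta> (Y k) - V k))\<^sup>2 < inverse (real (Suc k))" by metis
  have sq_lim: "W \<longlonglongrightarrow> 0" if "\<And>k. (norm (W k))\<^sup>2 \<le> inverse (real (Suc k))" for W :: "nat \<Rightarrow> 'c::real_normed_vector"
  proof (rule Lim_null_comparison)
    show "\<forall>\<^sub>F k in sequentially. norm (W k) \<le> sqrt (inverse (real (Suc k)))"
      using that by (intro always_eventually allI real_le_rsqrt)
    show "(\<lambda>k. sqrt (inverse (real (Suc k)))) \<longlonglongrightarrow> 0"
      using tendsto_real_sqrt[OF LIMSEQ_inverse_real_of_nat] by simp
  qed
  have UY: "(\<lambda>k. Y k - U k) \<longlonglongrightarrow> 0"
  proof (rule sq_lim)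
    show "(norm (Y k - U k))\<^sup>2 \<le> inverse (real (Suc k))" for k
      using close[of k] zero_le_power2[of "norm (\<Theta> (Y k) - V k)"] by linarith
  qed
  have VY: "(\<lambda>k. \<Theta> (Y k) - V k) \<longlonglongrightarrow> 0"
  proof (rule sq_lim)
    show "(norm (\<Theta> (Y k) - V k))\<^sup>2 \<le> inverse (real (Suc k))" for k
      using close[of k] zero_le_power2[of "norm (Y k - U k)"] by linarith
  qed
  have "norm (U k) \<le> 2" for k
  proof -
    have "(norm (Y k - U k))\<^sup>2 \<le> inverse (real (Suc k))"
      using close[of k] zero_le_power2[of "norm (\<Theta> (Y k) - V k)"] by linarith
    also have "\<dots> \<le> 1\<^sup>2" by (simp add: field_simps)
    finally have "norm (Y k - U k) \<le> 1" by (rule power2_le_imp_le) simp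
    then show ?thesis using norm_triangle_ineq4[of "Y k" "Y k - U k"] Y(2)[of k] by simp
  qed
  then obtain y r where r: "strict_mono r" "(U \<circ> r) \<longlonglongrightarrow> y"
    using finite_span_bolzano_weierstrass[OF B(1), of U 2] U B(2) by (meson subsetD)
  have Yr: "(\<lambda>k. Y (r k)) \<longlonglongrightarrow> y"
    using tendsto_add[OF LIMSEQ_subseq_LIMSEQ[OF UY r(1)] r(2)] by (simp add: o_def)
  have Vr: "(\<lambda>k. V (r k)) \<longlonglongrightarrow> \<Theta> y"
    using tendsto_diff[OF \<Theta>.tendsto[OF Yr] LIMSEQ_subseq_LIMSEQ[OF VY r(1)]] by (simp add: o_def)
  have "y \<in> L" using closed_sequentially[OF cL(2) _ Yr] Y(1) by simp
  moreover have "y \<in> K" using closed_sequentially[OF cK(2) _ r(2)] U by simp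
  moreover have "\<Theta> y \<in> K'" using closed_sequentially[OF cK'(2) _ Vr] V by simp
  moreover have "norm y = 1" using LIMSEQ_unique[OF tendsto_norm[OF Yr]] Y(2) by simp
  ultimately show ?thesis by force
qed

section \<open>The smallest complete sub-module\<close>

text \<open>
  A nonzero sub-module orthogonal to the set would contain a nonzero vector of it, by \<open>exists_common_vector\<close>.
\<close>

lemma complete_submodule_vimage:
  fixes \<Theta> :: "'a::pmodule dilation \<Rightarrow> 'b::pmodule dilation"
  assumes K: "complete_submodule K" and B: "finite B" "K \<subseteq> cspan B" and K': "complete_submodule K'"
    and \<Theta>: "bounded_clinear \<Theta>" "\<And>b x. \<Theta> (tau b x) = tau b (\<Theta> x)"
  shows "complete_submodule {x \<in> K. \<Theta> x \<in> K'}"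
  unfolding complete_submodule_def
proof (intro conjI allI impI)
  interpret \<Theta>: bounded_linear \<Theta> using \<Theta>(1) by (simp add: bounded_clinear_def)
  have sub: "submodule K" "submodule K'" using K K' by (simp_all add: complete_submodule_def)
  have "{x \<in> K. \<Theta> x \<in> K'} = K \<inter> \<Theta> -` K'" by auto
  moreover have "closed (\<Theta> -` K')"
    using sub(2) by (intro closed_vimage \<Theta>.continuous_on continuous_on_id) (simp add: submodule_tau)
  ultimately have "closed {x \<in> K. \<Theta> x \<in> K'}" using sub(1) by (auto simp: submodule_tau)
  moreover have "csubspace {x \<in> K. \<Theta> x \<in> K'}"
    using sub by (auto simp: submodule_tau complex_vec.subspace_def \<Theta>.add \<Theta>.zero bounded_clinear_scaleC[OF \<Theta>(1)])
  ultimately show "submodule {x \<in> K. \<Theta> x \<in> K'}" using sub by (auto simp: submodule_tau \<Theta>(2))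
  fix L assume "submodule L \<and> L \<subseteq> orth_compl {x \<in> K. \<Theta> x \<in> K'}"
  then have L: "submodule L" "L \<subseteq> orth_compl {x \<in> K. \<Theta> x \<in> K'}" by blast+
  show "L = {0}"
  proof (rule ccontr)
    assume "L \<noteq> {0}"
    from exists_common_vector[OF assms L(1) this] obtain y where "y \<in> L" "y \<in> K" "y \<noteq> 0" "\<Theta> y \<in> K'" by auto
    then show False using L(2) self_orthogonal_eq_0[of y "{x \<in> K. \<Theta> x \<in> K'}"] by blast
  qed
qed

lemma csubspace_range_incl: "csubspace (range incl)"
  unfolding complex_vec.subspace_def
proof (intro conjI ballI allI)
  show "0 \<in> range incl" by (metis incl_zero rangeI)
next
  fix x y :: "'a dilation" assume "x \<in> range incl" "y \<in> range incl"
  then show "x + y \<in> range incl" by (auto simp: incl_linear(1)[symmetric])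
next
  fix c and x :: "'a dilation" assume "x \<in> range incl"
  then show "c *\<^sub>C x \<in> range incl" by (auto simp: incl_linear(2)[symmetric])
qed

lemma finite_span_range_incl:
  assumes "finite_dimensional TYPE('a::pmodule)"
  obtains B :: "'a::pmodule dilation set" where "finite B" "range incl = cspan B"
proof -
  obtain S :: "'a set" where S: "finite S" "cspan S = UNIV" using assms by (auto simp: finite_dimensional_def)
  have "incl x \<in> cspan (incl ` S)" for x
  proof -
    have "x \<in> cspan S" by (simp add: S)
    then show ?thesis
    proof (induction rule: complex_vec.span_induct_alt)
      case base
      show ?case by (simp add: complex_vec.span_zero)
    next
      case (step c x y)
      then show ?case
        by (auto simp: incl_linear intro: complex_vec.span_add complex_vec.span_scale complex_vec.span_base)
    qed
  qed
  moreover have "cspan (incl ` S) \<subseteq> range incl"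
    by (rule complex_vec.span_minimal[OF _ csubspace_range_incl]) auto
  ultimately have "range incl = cspan (incl ` S)" by blast
  then show ?thesis using that[of "incl ` S"] S(1) by simp
qed

text \<open>
  A labelled tree is a sum of images of vectors of the module under words in \<open>join\<close>, and the adjoint words keep
  \<open>L\<close> inside the orthogonal complement of the module.
\<close>

lemma submodule_orthogonal_to_range_incl:
  fixes L :: "'a::pmodule dilation set"
  assumes L: "submodule L" "L \<subseteq> orth_compl (range incl)"
  shows "L = {0}"
proof -
  have tree: "cinner x (embed (abs_dlim t)) = 0" if "x \<in> L" for x t
    using that
  proof (induction t arbitrary: x)
    case (Lf \<xi>)
    then have "cinner x (incl \<xi>) = 0" using L(2) by (auto simp: orth_compl_def)
    then show ?case by (simp add: incl_def)
  next
    case (Nd l r)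
    have "embed (abs_dlim (Nd l r)) = join False (embed (abs_dlim l)) + join True (embed (abs_dlim r))"
      by (rule tau_eqI) (simp add: tau_embed tau_abs_dlim tau_linear tau_join)
    moreover have "tau b x \<in> L" for b using L(1) Nd.prems by (simp add: submodule_tau)
    ultimately show ?case using Nd.IH by (simp add: cinner_add_right cinner_join(2))
  qed
  have "x = 0" if "x \<in> L" for x
  proof -
    have orth: "cinner x (embed y) = 0" for y using tree[OF that] by (induction y rule: dlim.abs_induct)
    obtain X where "(\<lambda>n. embed (X n)) \<longlonglongrightarrow> x" using completion_seq by metis
    from cinner.tendsto[OF tendsto_const[of x] this] have "cinner x x = 0" by (simp add: orth LIMSEQ_const_iff)
    then show ?thesis by (simp add: cinner_self)
  qed
  moreover have "0 \<in> L" using L(1) complex_vec.subspace_0 by (auto simp: submodule_tau)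
  ultimately show ?thesis by blast
qed

lemma complete_submodule_range_incl:
  assumes "finite_dimensional TYPE('a::pmodule)"
  shows "complete_submodule (range (incl :: 'a \<Rightarrow> 'a dilation))"
proof -
  obtain B :: "'a dilation set" where "finite B" "range incl = cspan B" by (rule finite_span_range_incl[OF assms])
  then have "closed (range (incl :: 'a \<Rightarrow> 'a dilation))" by (simp add: closed_cspan_finite)
  then show ?thesis
    unfolding complete_submodule_def
    using submodule_orthogonal_to_range_incl by (auto simp: submodule_tau csubspace_range_incl tau_incl)
qed

text \<open>
  Take a finite dimensional complete sub-module \<open>K\<close> of least dimension. Intersecting it with another complete
  sub-module \<open>K'\<close> leaves it complete, so minimality forces \<open>K \<subseteq> K'\<close>. The dimension is measured by the size of a
  finite spanning set.
\<close>

lemma smallest_complete_submodule: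
  assumes fd: "finite_dimensional TYPE('a::pmodule)"
  obtains B where "complete_submodule (small_submodule :: 'a::pmodule dilation set)"
    "finite B" "small_submodule \<subseteq> cspan (B :: 'a::pmodule dilation set)"
proof -
  \<comment> \<open>\<open>B\<close> need only span a space containing \<open>K\<close>; at the least value of \<open>n\<close> it spans \<open>K\<close> itself\<close>
  define P where "P n \<longleftrightarrow> (\<exists>K B :: 'a dilation set. complete_submodule K \<and> finite B \<and> K \<subseteq> cspan B \<and> card B = n)" for n
  have "\<exists>n. P n"
    using finite_span_range_incl[OF fd] complete_submodule_range_incl[OF fd] unfolding P_def by (metis subset_refl)
  then have "P (LEAST n. P n)" by (rule LeastI_ex)
  then obtain K B :: "'a dilation set" where K: "complete_submodule K" and B: "finite B" "K \<subseteq> cspan B"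
    and card: "card B = (LEAST n. P n)" unfolding P_def by blast
  have "K \<subseteq> K'" if K': "complete_submodule K'" for K'
  proof
    fix x assume x: "x \<in> K"
    have KK': "complete_submodule (K \<inter> K')"
      using complete_submodule_vimage[OF K B K', of "\<lambda>x. x"] by (simp add: bounded_clinear_ident Int_def)
    then have cs: "csubspace (K \<inter> K')" by (simp add: complete_submodule_def submodule_tau)
    show "x \<in> K'"
    proof (rule ccontr)
      assume nx: "x \<notin> K'"
      obtain C where C: "C \<subseteq> K \<inter> K'" "complex_vec.independent C" "K \<inter> K' \<subseteq> cspan C"
        using complex_vec.maximal_independent_subset[of "K \<inter> K'"] by blast
      have "cspan C \<subseteq> K \<inter> K'" by (rule complex_vec.span_minimal[OF C(1) cs])
      then have "x \<notin> cspan C" using nx by blast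
      then have "complex_vec.independent (insert x C)" using C(2) by (simp add: complex_vec.independent_insert)
      moreover have "insert x C \<subseteq> cspan B" using x C(1) B(2) by blast
      ultimately have "finite (insert x C) \<and> card (insert x C) \<le> card B"
        by (rule complex_vec.independent_span_bound[OF B(1)])
      moreover have "x \<notin> C" using nx C(1) by blast
      ultimately have "finite C" "card C < card B" by auto
      moreover have "P (card C)" unfolding P_def using KK' C(3) \<open>finite C\<close> by blast
      ultimately show False using not_less_Least[of "card C" P] card by simp
    qed
  qed
  then have "small_submodule = K" using K unfolding small_submodule_def by blast
  then show ?thesis using that K B by simp
qed

lemma intertwiner_maps_small_submodule:
  fixes \<Theta> :: "'a::pmodule dilation \<Rightarrow> 'b::pmodule dilation"
  assumes "finite_dimensional TYPE('a)" and "finite_dimensional TYPE('b)"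
    and \<Theta>: "bounded_clinear \<Theta>" "\<And>b x. \<Theta> (tau b x) = tau b (\<Theta> x)"
  shows "pmodule_morphism small_submodule small_submodule \<Theta>"
proof -
  obtain B where small: "complete_submodule (small_submodule :: 'a dilation set)"
    "finite B" "small_submodule \<subseteq> cspan (B :: 'a dilation set)"
    by (rule smallest_complete_submodule[OF assms(1)])
  have "complete_submodule (small_submodule :: 'b dilation set)"
    by (rule smallest_complete_submodule[OF assms(2)])
  from complete_submodule_vimage[OF small this \<Theta>]
  have "small_submodule \<subseteq> {x \<in> small_submodule. \<Theta> x \<in> small_submodule}"
    by (subst (1) small_submodule_def) blast
  moreover have "\<exists>M. \<forall>x. norm (\<Theta> x) \<le> M * norm x"
    using bounded_linear.bounded[of \<Theta>] \<Theta>(1) by (auto simp: bounded_clinear_def mult.commute)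
  moreover have "\<Theta> (opA x) = opA (\<Theta> x)" "\<Theta> (opB x) = opB (\<Theta> x)" for x
    using \<Theta>(2)[of False x] \<Theta>(2)[of True x] by (simp_all add: tau_def)
  ultimately show ?thesis
    unfolding pmodule_morphism_def
    by (auto simp: bounded_clinear_add[OF \<Theta>(1)] bounded_clinear_scaleC[OF \<Theta>(1)])
qed

section \<open>Elements of F that approximate the generators\<close>

text \<open>
  The words \<open>u\<close> and \<open>v\<close> differ for the first time at a letter that is \<open>b\<close> in \<open>u\<close>. This
  is the lexicographic order for \<open>b = False\<close> and its converse for \<open>b = True\<close>; the parameter lets one family of
  tables, and its mirror image, be treated together.
\<close>

definition diverge :: "bool \<Rightarrow> bool list \<Rightarrow> bool list \<Rightarrow> bool" where
  "diverge b u v \<longleftrightarrow> (\<exists>p x y. u = p @ b # x \<and> v = p @ (\<not> b) # y)"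

lemma diverge_heads: "diverge b (b # x) ((\<not> b) # y)"
  unfolding diverge_def by (rule exI[of _ "[]"]) auto

lemma diverge_Cons: "diverge b u v \<Longrightarrow> diverge b (c # u) (c # v)"
  unfolding diverge_def by (metis append_Cons)

text \<open>
  In both decompositions the prefix is the longest common one, so the letters that follow it agree.
\<close>

lemma diverge_unique:
  assumes "p @ c # x = q @ d # x'" "p @ (\<not> c) # y = q @ (\<not> d) # y'" shows "c = d"
  using assms
proof (induction p arbitrary: q)
  case Nil then show ?case by (cases q) auto
next
  case (Cons e p) then show ?case by (cases q) auto
qed

lemma lex_less_diverge:
  assumes "diverge b u v" shows "lex_less u v \<longleftrightarrow> \<not> b" "lex_less v u \<longleftrightarrow> b"
proof -
  obtain p x y where uv: "u = p @ b # x" "v = p @ (\<not> b) # y" using assms unfolding diverge_def by blast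
  show "lex_less u v \<longleftrightarrow> \<not> b"
  proof
    assume "lex_less u v"
    then show "\<not> b" using diverge_unique[of p b x _ False] uv unfolding lex_less_def by fastforce
  next
    assume "\<not> b" then show "lex_less u v" using uv unfolding lex_less_def by (intro exI) auto
  qed
  show "lex_less v u \<longleftrightarrow> b"
  proof
    assume "lex_less v u"
    then show "b" using diverge_unique[of p "\<not> b" y _ False] uv unfolding lex_less_def by fastforce
  next
    assume "b" then show "lex_less v u" using uv unfolding lex_less_def by (intro exI) auto
  qed
qed

lemma not_lex_less_self: "\<not> lex_less u u"
  by (auto simp: lex_less_def)

lemma sorted_diverge_join:
  assumes "sorted_wrt (diverge b) P" "sorted_wrt (diverge b) Q"
  shows "sorted_wrt (diverge b) (map ((#) b) P @ map ((#) (\<not> b)) Q)"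
  using assms
  by (auto simp: sorted_wrt_append sorted_wrt_map diverge_heads intro: sorted_wrt_mono_rel[rotated] diverge_Cons)

definition covers :: "bool list list \<Rightarrow> bool" where
  "covers P \<longleftrightarrow> (\<forall>z::bool stream. \<exists>u\<in>set P. \<exists>w. z = u @- w)"

lemma covers_join:
  assumes P: "covers P" and Q: "covers Q" shows "covers (map ((#) b) P @ map ((#) (\<not> b)) Q)"
  unfolding covers_def
proof
  fix z :: "bool stream"
  obtain u w where u: "u \<in> set (if shd z = b then P else Q)" "stl z = u @- w"
    using P Q unfolding covers_def by metis
  then have "z = (shd z # u) @- w" by (metis shift.simps(2) stream.collapse)
  moreover have "shd z # u \<in> set (map ((#) b) P @ map ((#) (\<not> b)) Q)" using u(1) by (auto split: if_splits)
  ultimately show "\<exists>u\<in>set (map ((#) b) P @ map ((#) (\<not> b)) Q). \<exists>w. z = u @- w" by blast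
qed

lemma diverge_disjoint: "diverge b u v \<Longrightarrow> u @- w \<noteq> v @- w'"
  unfolding diverge_def by auto

text \<open>
  A list in which any two words diverge has pairwise disjoint cones, so covering the Cantor space is enough.
\<close>

lemma standard_partition_if_sorted_covers:
  assumes S: "sorted_wrt (diverge b) P" and "covers P" shows "standard_partition P"
  unfolding standard_partition_def
proof (intro allI ex_ex1I)
  fix z :: "bool stream"
  show "\<exists>j. j < length P \<and> (\<exists>w. z = P ! j @- w)"
    using assms(2) unfolding covers_def by (metis in_set_conv_nth)
next
  fix z i j
  assume ij: "i < length P \<and> (\<exists>w. z = P ! i @- w)" "j < length P \<and> (\<exists>w. z = P ! j @- w)"
  then have "\<not> i < j" "\<not> j < i" using S diverge_disjoint unfolding sorted_wrt_iff_nth_less by metis+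
  then show "i = j" by simp
qed

lemma lex_less_sorted_diverge:
  assumes "sorted_wrt (diverge b) P" "i < length P" "j < length P"
  shows "lex_less (P ! i) (P ! j) \<longleftrightarrow> (if b then j < i else i < j)"
proof -
  have "diverge b (P ! i) (P ! j)" if "i < j" using assms that by (simp add: sorted_wrt_iff_nth_less)
  moreover have "diverge b (P ! j) (P ! i)" if "j < i" using assms that by (simp add: sorted_wrt_iff_nth_less)
  ultimately show ?thesis
    by (cases i j rule: linorder_cases) (auto simp: lex_less_diverge not_lex_less_self)
qed

text \<open>
  Both lists are monotone in the same direction, so each comparison between entries is decided by the indices alone.
\<close>

lemma linear_table_if_sorted:
  assumes "sorted_wrt (diverge b) P" "covers P" "sorted_wrt (diverge b) Q" "covers Q" "length P = length Q"
  shows "linear_table P Q"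
  using assms standard_partition_if_sorted_covers lex_less_sorted_diverge
  unfolding linear_table_def thompson_table_def by simp

lemma table_unitary_in_F: "linear_table \<mu> \<nu> \<Longrightarrow> table_unitary \<mu> \<nu> \<in> cuntz_copy thompson_F"
  unfolding cuntz_copy_def thompson_F_def linear_table_def by blast

lemma thompson_F_subset_T: "thompson_F \<subseteq> thompson_T"
  unfolding thompson_F_def thompson_T_def linear_table_def cyclic_table_def cyclic_less_def by blast

lemma thompson_T_subset_V: "thompson_T \<subseteq> thompson_V"
  unfolding thompson_T_def thompson_V_def cyclic_table_def by blast

lemma cuntz_copy_mono: "G \<subseteq> H \<Longrightarrow> cuntz_copy G \<subseteq> cuntz_copy H"
  unfolding cuntz_copy_def by blast

text \<open>
  The words \<open>b\<close>, \<open>(\<not> b) b\<close>, \<open>(\<not> b) (\<not> b) b\<close>, and so on, ending with the word of \<open>n\<close> letters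
  \<open>\<not> b\<close>: the leaves of the tree that grows along one boundary ray.
\<close>

primrec comb :: "bool \<Rightarrow> nat \<Rightarrow> bool list list" where
  "comb b 0 = [[]]"
| "comb b (Suc n) = map ((#) b) [[]] @ map ((#) (\<not> b)) (comb b n)"

text \<open>
  The same tree of size \<open>n\<close> below the child \<open>b\<close> of the root, and the other child left as a leaf.
\<close>

definition shifted_comb :: "bool \<Rightarrow> nat \<Rightarrow> bool list list" where
  "shifted_comb b n = map ((#) b) (comb b n) @ map ((#) (\<not> b)) [[]]"

lemma length_comb [simp]: "length (comb b n) = Suc n"
  by (induction n) auto

lemma comb_sorted_covers: "sorted_wrt (diverge b) (comb b n)" "covers (comb b n)"
proof (induction n)
  case 0
  { case 1 show ?case by simp next case 2 show ?case by (auto simp: covers_def) }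
next
  case (Suc n)
  { case 1 show ?case unfolding comb.simps by (intro sorted_diverge_join Suc.IH) simp
  next case 2 show ?case unfolding comb.simps by (intro covers_join Suc.IH) (auto simp: covers_def) }
qed

lemma shifted_comb_sorted_covers: "sorted_wrt (diverge b) (shifted_comb b n)" "covers (shifted_comb b n)"
  unfolding shifted_comb_def
  by (intro sorted_diverge_join comb_sorted_covers; simp)
     (intro covers_join comb_sorted_covers; auto simp: covers_def)

lemma length_shifted_comb: "length (shifted_comb b n) = length (comb b (Suc n))"
  by (simp add: shifted_comb_def)

text \<open>
  The entry \<open>(\<not> b)\<^sup>j b\<close> of the first table is sent to \<open>b (\<not> b)\<^sup>j b\<close> for \<open>j < n\<close>, which is the effect
  of the generator \<open>b\<close>. Only the last two cones are moved differently, and they lie below \<open>(\<not> b)\<^sup>n\<close>.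
\<close>

definition shift_elem :: "bool \<Rightarrow> nat \<Rightarrow> cuntz" where
  "shift_elem b n = table_unitary (comb b (Suc n)) (shifted_comb b n)"

lemma star_sum: "star (sum f A) = (\<Sum>i\<in>A. star (f i :: 'a::pre_cstar_algebra))"
  by (rule linear_sum[OF bounded_linear.linear[OF bounded_linear_star]])

lemma star_table_unitary: "length \<mu> = length \<nu> \<Longrightarrow> star (table_unitary \<mu> \<nu>) = table_unitary \<nu> \<mu>"
  by (simp add: table_unitary_def star_sum star_algebra_class.star_mult star_algebra_class.star_star)

lemma shift_elem_in_F:
  "shift_elem b n \<in> cuntz_copy thompson_F" "star (shift_elem b n) \<in> cuntz_copy thompson_F"
proof -
  have "linear_table (comb b (Suc n)) (shifted_comb b n)" "linear_table (shifted_comb b n) (comb b (Suc n))"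
    by (rule linear_table_if_sorted; rule comb_sorted_covers shifted_comb_sorted_covers length_shifted_comb
          length_shifted_comb[symmetric])+
  then show "shift_elem b n \<in> cuntz_copy thompson_F" "star (shift_elem b n) \<in> cuntz_copy thompson_F"
    unfolding shift_elem_def star_table_unitary[OF length_shifted_comb[symmetric]]
    by (simp_all only: table_unitary_in_F)
qed

text \<open>
  The sum over \<open>j\<close> of \<open>cuntz_word u * star (cuntz_word v)\<close>, where \<open>u\<close> and \<open>v\<close> are the \<open>j\<close>-th entries of the combs of
  size \<open>n\<close> and \<open>n + 1\<close>. All terms but the last have \<open>u = v\<close>, so it differs from \<open>1\<close> only below
  the last word of the smaller comb.
\<close>

primrec comb_remainder :: "bool \<Rightarrow> nat \<Rightarrow> cuntz" where
  "comb_remainder b 0 = star (cuntz_gen b)"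
| "comb_remainder b (Suc n) = cuntz_gen b * star (cuntz_gen b)
     + cuntz_gen (\<not> b) * comb_remainder b n * star (cuntz_gen (\<not> b))"

lemma star_one: "star (1 :: 'a::pre_cstar_algebra) = 1"
  by (metis mult.left_neutral mult.right_neutral star_algebra_class.star_mult star_algebra_class.star_star)

lemma comb_last: "comb b n ! n = replicate n (\<not> b)"
  by (induction n) auto

lemma comb_Suc_nth:
  "comb b (Suc n) ! 0 = [b]" "j < Suc n \<Longrightarrow> comb b (Suc n) ! Suc j = (\<not> b) # comb b n ! j"
  by (simp_all add: nth_append)

lemma comb_sum:
  "(\<Sum>j<Suc n. cuntz_word (comb b n ! j) * star (cuntz_word (comb b (Suc n) ! j))) = comb_remainder b n"
proof (induction n)
  case (Suc n)
  have "(\<Sum>j<Suc (Suc n). cuntz_word (comb b (Suc n) ! j) * star (cuntz_word (comb b (Suc (Suc n)) ! j)))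
     = cuntz_gen b * star (cuntz_gen b) + (\<Sum>j<Suc n. cuntz_gen (\<not> b) *
         (cuntz_word (comb b n ! j) * star (cuntz_word (comb b (Suc n) ! j))) * star (cuntz_gen (\<not> b)))"
    by (subst sum.lessThan_Suc_shift, rule arg_cong2[of _ _ _ _ "(+)"], simp add: comb_Suc_nth star_algebra_class.star_mult star_one del: comb.simps)
      (rule sum.cong, simp_all add: comb_Suc_nth star_algebra_class.star_mult mult.assoc del: comb.simps)
  also have "\<dots> = cuntz_gen b * star (cuntz_gen b) + cuntz_gen (\<not> b) * comb_remainder b n * star (cuntz_gen (\<not> b))"
    by (simp only: Suc.IH[symmetric] sum_distrib_left sum_distrib_right)
  finally show ?case by simp
qed (simp add: star_one)

lemma shift_elem_eq:
  "shift_elem b n = cuntz_gen b * comb_remainder b n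
    + cuntz_gen (\<not> b) * star (cuntz_word (replicate (Suc n) (\<not> b)))"
proof -
  have "shift_elem b n = (\<Sum>j<Suc n. cuntz_word (shifted_comb b n ! j) * star (cuntz_word (comb b (Suc n) ! j)))
     + cuntz_gen (\<not> b) * star (cuntz_word (replicate (Suc n) (\<not> b)))"
    unfolding shift_elem_def table_unitary_def length_comb
    by (subst sum.lessThan_Suc) (simp only: comb_last, simp add: shifted_comb_def nth_append)
  also have "(\<Sum>j<Suc n. cuntz_word (shifted_comb b n ! j) * star (cuntz_word (comb b (Suc n) ! j)))
     = (\<Sum>j<Suc n. cuntz_gen b * (cuntz_word (comb b n ! j) * star (cuntz_word (comb b (Suc n) ! j))))"
    by (rule sum.cong) (simp_all add: shifted_comb_def nth_append mult.assoc del: comb.simps)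
  finally show ?thesis by (simp only: sum_distrib_left[symmetric] comb_sum)
qed

section \<open>From F to the Cuntz algebra\<close>

text \<open>
  The operator and the identity agree on the range of \<open>join b\<close>, and on the range of \<open>join (\<not> b)\<close> the comparison is the
  one for \<open>n - 1\<close>.
\<close>

lemma associated_rep_comb_remainder:
  fixes x :: "'a::pmodule dilation"
  shows "norm (associated_rep (comb_remainder b n) x - x) \<le> 2 * norm ((tau (\<not> b) ^^ n) x)"
proof (induction n arbitrary: x)
  case 0
  show ?case using norm_triangle_ineq4[of "tau b x" x] norm_tau_le[of b x] by (simp add: associated_rep_gen_star)
next
  case (Suc n)
  let ?r = "associated_rep (comb_remainder b n)" and ?y = "tau (\<not> b) x"
  have "join b (tau b x) + join (\<not> b) ?y = x" using dil.ranges[of x] by (cases b) (simp_all add: add.commute)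
  then have "associated_rep (comb_remainder b (Suc n)) x - x = join (\<not> b) (?r ?y - ?y)"
    by (simp add: star_repD[OF associated_rep(1)] associated_rep_gen associated_rep_gen_star join_linear algebra_simps)
  then show ?case using Suc.IH[of ?y] by (simp add: funpow_swap1)
qed

lemma associated_rep_star_power_word:
  "associated_rep (star (cuntz_word (replicate n c))) x = (tau c ^^ n) (x :: 'a::pmodule dilation)"
proof (induction n arbitrary: x)
  case (Suc n)
  then show ?case
    by (simp add: star_algebra_class.star_mult star_repD(4)[OF associated_rep(1)] associated_rep_gen_star funpow_Suc_right
        del: funpow.simps)
qed (simp add: star_one star_repD(5)[OF associated_rep(1)])

text \<open>
  The element factors as the generator \<open>b\<close> times an operator tending strongly to \<open>1\<close>, up to a term of the size
  of \<open>(tau (\<not> b) ^^ Suc n) x\<close>.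
\<close>

lemma shift_elem_tendsto_join:
  fixes x :: "'a::pmodule dilation"
  assumes "diffuse TYPE('a)"
  shows "(\<lambda>n. associated_rep (shift_elem b n) x) \<longlonglongrightarrow> join b x"
proof -
  have eq: "associated_rep (shift_elem b n) x
      = join b (associated_rep (comb_remainder b n) x) + join (\<not> b) ((tau (\<not> b) ^^ Suc n) x)" for n
    by (simp add: shift_elem_eq star_repD[OF associated_rep(1)] associated_rep_gen associated_rep_star_power_word
        del: replicate.simps funpow.simps)
  note lim = tau_power_tendsto_0[OF assms, of "\<not> b" x]
  have "(\<lambda>n. associated_rep (comb_remainder b n) x - x) \<longlonglongrightarrow> 0"
  proof (rule Lim_null_comparison)
    show "\<forall>\<^sub>F n in sequentially. norm (associated_rep (comb_remainder b n) x - x) \<le> 2 * norm ((tau (\<not> b) ^^ n) x)"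
      by (intro always_eventually allI associated_rep_comb_remainder)
    show "(\<lambda>n. 2 * norm ((tau (\<not> b) ^^ n) x)) \<longlonglongrightarrow> 0"
      using tendsto_mult[OF tendsto_const tendsto_norm_zero[OF lim], of 2] by simp
  qed
  then have "(\<lambda>n. associated_rep (comb_remainder b n) x) \<longlonglongrightarrow> x" by (simp add: LIM_zero_iff)
  from tendsto_add[OF tendsto_join[OF this] tendsto_join[OF LIMSEQ_Suc[OF lim], of "\<not> b"]]
  show ?thesis unfolding eq by (simp add: join_linear del: funpow.simps)
qed

text \<open>
  Strong limits give the relation for \<open>join\<close>. For \<open>tau\<close>, apply \<open>\<Theta>\<close> to the decomposition of \<open>x\<close>
  along the ranges of \<open>join False\<close> and \<open>join True\<close> and compare components.
\<close>

lemma F_intertwiner_commutes: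
  fixes \<Theta> :: "'a::pmodule dilation \<Rightarrow> 'b::pmodule dilation"
  assumes "diffuse TYPE('a)" "diffuse TYPE('b)" and \<Theta>: "bounded_clinear \<Theta>"
    and F: "intertwines_on (cuntz_copy thompson_F) associated_rep associated_rep \<Theta>"
  shows "\<Theta> (join b x) = join b (\<Theta> x)" "\<Theta> (tau b x) = tau b (\<Theta> x)"
proof -
  interpret \<Theta>: bounded_linear \<Theta> using \<Theta> by (simp add: bounded_clinear_def)
  show j: "\<Theta> (join b x) = join b (\<Theta> x)" for b x
  proof (rule LIMSEQ_unique)
    show "(\<lambda>n. \<Theta> (associated_rep (shift_elem b n) x)) \<longlonglongrightarrow> \<Theta> (join b x)"
      by (rule \<Theta>.tendsto[OF shift_elem_tendsto_join[OF assms(1)]])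
    have "\<Theta> (associated_rep (shift_elem b n) x) = associated_rep (shift_elem b n) (\<Theta> x)" for n
      using F shift_elem_in_F(1)[of b n] by (auto simp: intertwines_on_def fun_eq_iff)
    then show "(\<lambda>n. \<Theta> (associated_rep (shift_elem b n) x)) \<longlonglongrightarrow> join b (\<Theta> x)"
      using shift_elem_tendsto_join[OF assms(2), of b "\<Theta> x"] by simp
  qed
  have "\<Theta> x = join False (\<Theta> (tau False x)) + join True (\<Theta> (tau True x))"
    unfolding j[symmetric] \<Theta>.add[symmetric] dil.ranges ..
  then show "\<Theta> (tau b x) = tau b (\<Theta> x)" by (cases b) (simp_all add: tau_linear tau_join)
qed

text \<open>
  Invariance under \<open>join\<close> follows from a strong limit. The inverses of the approximating elements in general converge only weakly to
  \<open>tau b\<close>, so the second claim is tested against \<open>orth_compl K\<close> instead: there the elements themselves appear and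
  converge strongly.
\<close>

lemma F_invariant_subspace_reducing:
  fixes K :: "'a::pmodule dilation set"
  assumes diff: "diffuse TYPE('a)" and K: "csubspace K" "closed K"
    and F: "\<And>a. a \<in> cuntz_copy thompson_F \<Longrightarrow> associated_rep a ` K \<subseteq> K" and x: "x \<in> K"
  shows "join b x \<in> K" "tau b x \<in> K"
proof -
  have inv: "associated_rep (shift_elem b n) y \<in> K" "associated_rep (star (shift_elem b n)) y \<in> K" if "y \<in> K" for y n
    using F[OF shift_elem_in_F(1)] F[OF shift_elem_in_F(2)] that by blast+
  show "join b x \<in> K"
    by (rule closed_sequentially[OF K(2) _ shift_elem_tendsto_join[OF diff]]) (use inv x in blast)
  have "tau b x \<in> orth_compl (orth_compl K)"
    unfolding orth_compl_def[of "orth_compl K"]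
  proof (intro CollectI ballI)
    fix y assume y: "y \<in> orth_compl K"
    have "cinner x (associated_rep (shift_elem b n) y) = 0" for n
    proof -
      have "cinner x (associated_rep (shift_elem b n) y) = cinner (associated_rep (star (shift_elem b n)) x) y"
        by (rule star_repD(6)[OF associated_rep(1), unfolded is_adjoint_def, rule_format, symmetric])
      then show ?thesis using y inv(2)[OF x] cinner_eq_0_commute by (auto simp: orth_compl_def)
    qed
    then have "cinner x (join b y) = 0"
      using cinner.tendsto[OF tendsto_const[of x] shift_elem_tendsto_join[OF diff, of b y]] by (simp add: LIMSEQ_const_iff)
    then show "cinner (tau b x) y = 0" by (simp add: cinner_join)
  qed
  then show "tau b x \<in> K" by (simp add: orth_compl_orth_compl[OF K])
qed

subsection \<open>Operators determined on the generators\<close>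

text \<open>
  The expressions in the generators are dense in the Cuntz algebra. A property
  that need not pass to adjoints is handled by asking for it at an element and at its adjoint.
\<close>

lemma closed_star_subalgebra_eq_UNIV:
  fixes S :: "cuntz set"
  assumes gen: "\<And>b. cuntz_gen b \<in> S" and one: "1 \<in> S"
    and add: "\<And>a b. a \<in> S \<Longrightarrow> b \<in> S \<Longrightarrow> a + b \<in> S" and mult: "\<And>a b. a \<in> S \<Longrightarrow> b \<in> S \<Longrightarrow> a * b \<in> S"
    and scale: "\<And>c a. a \<in> S \<Longrightarrow> c *\<^sub>C a \<in> S" and star: "\<And>a. a \<in> S \<Longrightarrow> star a \<in> S"
    and cl: "closed S"
  shows "S = UNIV"
proof -
  have pre: "embed (abs_cuntz_pre x) \<in> S" for x
  proof (induction x rule: cuntz_alg_induct)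
    case (gen b)
    then show ?case using assms(1) by (simp add: cuntz_gen_def)
  next
    case zero
    have "embed (abs_cuntz_pre 0) = 0 *\<^sub>C (1 :: cuntz)"
      by (simp add: zero_cuntz_pre.abs_eq[symmetric]) (metis embed_diff diff_self)
    then show ?case using scale[OF one, of 0] by simp
  next
    case one
    then show ?case using assms(2) by (simp add: one_cuntz_pre.abs_eq[symmetric] embed_one)
  next
    case (add x y)
    then show ?case using assms(3) by (simp add: plus_cuntz_pre.abs_eq[symmetric] embed_add)
  next
    case (mult x y)
    then show ?case using assms(4) by (simp add: times_cuntz_pre.abs_eq[symmetric] embed_times)
  next
    case (scale c x)
    then show ?case using assms(5) by (simp add: scaleC_cuntz_pre.abs_eq[symmetric] embed_scaleC)
  next
    case (star x)
    then show ?case using assms(6) by (simp add: star_cuntz_pre.abs_eq[symmetric] embed_star)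
  qed
  have "embed p \<in> S" for p using pre by (metis Quotient_abs_rep[OF Quotient_cuntz_pre])
  then have "closure (range embed) \<subseteq> S" using cl by (intro closure_minimal) auto
  then show ?thesis unfolding embed_dense by blast
qed

lemma continuous_on_associated_rep:
  "continuous_on UNIV (\<lambda>a. associated_rep a (x :: 'a::pmodule dilation))"
proof -
  have "bounded_linear (\<lambda>a. associated_rep a x)"
    by (rule bounded_linear_intro[where K="norm x"]) (simp_all add: star_repD[OF associated_rep(1)] scaleR_scaleC)
  then show ?thesis by (rule bounded_linear.continuous_on[OF _ continuous_on_id])
qed

lemma continuous_on_associated_rep_star:
  "continuous_on UNIV (\<lambda>a. associated_rep (star a) (x :: 'a::pmodule dilation))"
proof (rule continuous_on_compose2[OF continuous_on_associated_rep[of x]])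
  show "continuous_on UNIV (star :: cuntz \<Rightarrow> cuntz)"
    by (rule bounded_linear.continuous_on[OF bounded_linear_star continuous_on_id])
qed simp

lemma intertwines_all_if_commutes:
  fixes \<Theta> :: "'a::pmodule dilation \<Rightarrow> 'b::pmodule dilation"
  assumes \<Theta>: "bounded_clinear \<Theta>"
    and join: "\<And>b x. \<Theta> (join b x) = join b (\<Theta> x)" and tau: "\<And>b x. \<Theta> (tau b x) = tau b (\<Theta> x)"
  shows "intertwines_on UNIV associated_rep associated_rep \<Theta>"
proof -
  interpret \<Theta>: bounded_linear \<Theta> using \<Theta> by (simp add: bounded_clinear_def)
  let ?C = "\<lambda>a x. \<Theta> (associated_rep a x) = associated_rep a (\<Theta> x)"
  \<comment> \<open>the clause for \<open>star a\<close> makes the set stable under \<open>star\<close>\<close>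
  let ?S = "{a. (\<forall>x. ?C a x) \<and> (\<forall>x. ?C (star a) x)}"
  note rep = star_repD[OF associated_rep(1)]
  have "?S = UNIV"
  proof (rule closed_star_subalgebra_eq_UNIV)
    have eq: "?S = (\<Inter>x. {a. ?C a x}) \<inter> (\<Inter>x. {a. ?C (star a) x})" by auto
    have "closed {a. ?C a x}" "closed {a. ?C (star a) x}" for x
      by (rule closed_Collect_eq[OF \<Theta>.continuous_on]; rule continuous_on_associated_rep continuous_on_associated_rep_star)+
    then show "closed ?S" unfolding eq by (intro closed_Int closed_INT ballI)
  qed (auto simp: rep associated_rep_gen associated_rep_gen_star join tau star_one star_algebra_class.star_mult
      star_algebra_class.star_star star_algebra_class.star_add star_algebra_class.star_scaleC
      \<Theta>.add bounded_clinear_scaleC[OF \<Theta>])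
  then show ?thesis by (auto simp: intertwines_on_def fun_eq_iff)
qed

lemma reducing_subspace_invariant:
  fixes K :: "'a::pmodule dilation set"
  assumes K: "csubspace K" "closed K"
    and join: "\<And>b x. x \<in> K \<Longrightarrow> join b x \<in> K" and tau: "\<And>b x. x \<in> K \<Longrightarrow> tau b x \<in> K"
  shows "associated_rep a ` K \<subseteq> K"
proof -
  let ?S = "{a. (\<forall>x\<in>K. associated_rep a x \<in> K) \<and> (\<forall>x\<in>K. associated_rep (star a) x \<in> K)}"
  note rep = star_repD[OF associated_rep(1)]
  have "?S = UNIV"
  proof (rule closed_star_subalgebra_eq_UNIV)
    have eq: "?S = (\<Inter>x\<in>K. (\<lambda>a. associated_rep a x) -` K) \<inter> (\<Inter>x\<in>K. (\<lambda>a. associated_rep (star a) x) -` K)"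
      by auto
    have "closed ((\<lambda>a. associated_rep a x) -` K)" "closed ((\<lambda>a. associated_rep (star a) x) -` K)" for x
      by (rule closed_vimage[OF K(2)]; rule continuous_on_associated_rep continuous_on_associated_rep_star)+
    then show "closed ?S" unfolding eq by (intro closed_Int closed_INT ballI)
  qed (auto simp: rep associated_rep_gen associated_rep_gen_star join tau star_one star_algebra_class.star_mult
      star_algebra_class.star_star star_algebra_class.star_add star_algebra_class.star_scaleC
      complex_vec.subspace_add[OF K(1)] complex_vec.subspace_scale[OF K(1)])
  then show ?thesis by blast
qed

section \<open>Irreducibility\<close>

lemma closed_level: "closed K \<Longrightarrow> closed (level (K :: 'a::pmodule set) n)"
proof (induction n)
  case (Suc n)
  have "level K (Suc n) = (\<Inter>b. tau b -` level K n)" by auto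
  moreover have "closed (tau b -` level K n)" for b
    by (intro closed_vimage Suc bounded_linear.continuous_on[OF _ continuous_on_id]
        bounded_clinear_tau[unfolded bounded_clinear_def, THEN conjunct1])
  ultimately show ?case by auto
qed simp

lemma submodule_incl_vimage:
  assumes "submodule (K :: 'a::pmodule dilation set)" shows "submodule (incl -` K :: 'a set)"
proof -
  have "bounded_linear (incl :: 'a \<Rightarrow> _)"
    by (rule bounded_linear_intro[where K=1]) (simp_all add: incl_linear scaleR_scaleC)
  then have "closed (incl -` K :: 'a set)"
    using assms by (intro closed_vimage bounded_linear.continuous_on[OF _ continuous_on_id]) (simp_all add: submodule_tau)
  then show ?thesis using assms by (auto simp: submodule_tau complex_vec.subspace_def incl_linear tau_incl[symmetric])
qed

text \<open>
  Let \<open>M\<close> and \<open>L\<close> be orthogonal nonzero sub-modules. The vectors whose images under all words in \<open>tau\<close> are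
  orthogonal to \<open>M\<close> form the orthogonal complement of the reducing subspace generated by \<open>M\<close>. This complement is
  reducing, contains \<open>L\<close>, and is proper because it misses the nonzero vectors of \<open>M\<close>.
\<close>

lemma reducible_if_decomposable:
  assumes "decomposable TYPE('a::pmodule)"
  shows "\<not> irreducible_on X (associated_rep :: cuntz \<Rightarrow> 'a dilation \<Rightarrow> 'a dilation)"
proof -
  obtain M L :: "'a set" where M: "submodule M" "M \<noteq> {0}" and L: "submodule L" "L \<noteq> {0}" and orth: "L \<subseteq> orth_compl M"
    using assms unfolding decomposable_def by blast
  define W where "W = orth_compl (incl ` M :: 'a dilation set)"
  define K where "K = (\<Inter>n. level W n)"
  have W: "csubspace W" "closed W" by (simp_all add: W_def csubspace_orth_compl closed_orth_compl)
  have cs: "csubspace K" unfolding K_def by (rule complex_vec.subspace_Inter) (auto intro: csubspace_level W)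
  have cl: "closed K" unfolding K_def by (intro closed_INT ballI closed_level W)
  have tau: "tau b x \<in> K" if "x \<in> K" for b x
  proof -
    have "x \<in> level W (Suc n)" for n using that unfolding K_def by blast
    then show ?thesis unfolding K_def by simp
  qed
  have join: "join b x \<in> K" if "x \<in> K" for b x
  proof -
    have x: "x \<in> level W n" for n using that unfolding K_def by blast
    have "join b x \<in> level W n" for n
    proof (cases n)
      case 0
      have "tau b m \<in> M" if "m \<in> M" for m using that M(1) by (simp add: submodule_tau)
      then show ?thesis using x[of 0] 0 by (auto simp: W_def orth_compl_def cinner_join tau_incl)
    next
      case (Suc k)
      show ?thesis unfolding Suc by (rule join_level[OF W(1) x])
    qed
    then show ?thesis unfolding K_def by blast
  qed
  have inv: "associated_rep a ` K \<subseteq> K" for a by (rule reducing_subspace_invariant[OF cs cl join tau])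
  have L_in: "incl l \<in> level W n" if "l \<in> L" for l n
    using that
  proof (induction n arbitrary: l)
    case 0
    then show ?case using orth by (auto simp: W_def orth_compl_def cinner_incl)
  next
    case (Suc n)
    then show ?case using L(1) by (simp add: submodule_tau tau_incl)
  qed
  have zero: "0 \<in> M" "0 \<in> L" using M(1) L(1) by (simp_all add: submodule_tau complex_vec.subspace_def)
  obtain l where "l \<in> L" "l \<noteq> 0" using L(2) zero by blast
  then have "incl l \<in> K" "incl l \<noteq> 0" using L_in by (simp_all add: K_def)
  then have "K \<noteq> {0}" by blast
  moreover obtain m where m: "m \<in> M" "m \<noteq> 0" using M(2) zero by blast
  then have "incl m \<notin> W" using self_orthogonal_eq_0[of "incl m" "incl ` M"] by (metis W_def imageI incl_eq_0)
  then have "K \<noteq> UNIV" unfolding K_def using level.simps(1)[of W] by blast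
  ultimately show ?thesis using cs cl inv unfolding irreducible_on_def by blast
qed

text \<open>
  Both \<open>K\<close> and its orthogonal complement are nonzero sub-modules of the dilation, so each contains a nonzero vector of
  the module itself. Their intersections with the module are orthogonal sub-modules.
\<close>

lemma decomposable_if_reducing:
  fixes K :: "'a::pmodule dilation set"
  assumes fd: "finite_dimensional TYPE('a)" and K: "csubspace K" "closed K" "K \<noteq> {0}" "K \<noteq> UNIV"
    and join: "\<And>b x. x \<in> K \<Longrightarrow> join b x \<in> K" and tau: "\<And>b x. x \<in> K \<Longrightarrow> tau b x \<in> K"
  shows "decomposable TYPE('a)"
proof -
  obtain B :: "'a dilation set" where B: "finite B" "range incl = cspan B" by (rule finite_span_range_incl[OF fd])
  have meets: "incl -` L \<noteq> ({0} :: 'a set)" if L: "submodule L" "L \<noteq> {0}" for L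
  proof -
    note c = complete_submodule_range_incl[OF fd]
    obtain \<xi> :: 'a where "incl \<xi> \<in> L" "incl \<xi> \<noteq> 0"
      using exists_common_vector[OF c B(1) equalityD1[OF B(2)] c bounded_clinear_ident _ L] by auto
    then show ?thesis by auto
  qed
  have sub: "submodule K" "submodule (orth_compl K)"
    using K tau join by (auto simp: submodule_tau[of K] intro: submodule_orth_compl)
  have "orth_compl K \<noteq> {0}" using closed_subspace_eq_UNIV K by blast
  moreover have "incl -` orth_compl K \<subseteq> orth_compl (incl -` K :: 'a set)"
    unfolding orth_compl_def by clarsimp (metis cinner_incl)
  ultimately show ?thesis
    unfolding decomposable_def
    by (intro exI[of _ "incl -` K"] exI[of _ "incl -` orth_compl K"] conjI submodule_incl_vimage sub meets K(3))
qed

lemma irreducible_iff_indecomposable: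
  assumes "finite_dimensional TYPE('a::pmodule)" "diffuse TYPE('a)" "cuntz_copy thompson_F \<subseteq> X"
  shows "irreducible_on X (associated_rep :: cuntz \<Rightarrow> 'a dilation \<Rightarrow> 'a dilation) \<longleftrightarrow> indecomposable TYPE('a)"
proof
  show "indecomposable TYPE('a)" if "irreducible_on X (associated_rep :: cuntz \<Rightarrow> 'a dilation \<Rightarrow> 'a dilation)"
    using that reducible_if_decomposable unfolding indecomposable_def by blast
  assume ind: "indecomposable TYPE('a)"
  show "irreducible_on X (associated_rep :: cuntz \<Rightarrow> 'a dilation \<Rightarrow> 'a dilation)"
    unfolding irreducible_on_def
  proof (intro allI impI, elim conjE)
    fix K :: "'a dilation set"
    assume K: "csubspace K" "closed K" "\<forall>a\<in>X. associated_rep a ` K \<subseteq> K"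
    have "join b x \<in> K" "tau b x \<in> K" if "x \<in> K" for b x
      using F_invariant_subspace_reducing[OF assms(2) K(1,2) _ that] K(3) assms(3) by blast+
    then show "K = {0} \<or> K = UNIV"
      using decomposable_if_reducing[OF assms(1) K(1,2)] ind unfolding indecomposable_def by metis
  qed
qed

section \<open>Extending unitary morphisms\<close>

text \<open>
  Polarization: the norm determines the real part of the inner product, and its imaginary part is a real part after
  multiplication by \<open>\<i>\<close>.
\<close>

lemma norm_preserving_imp_cinner_preserving:
  fixes U :: "'a::complex_inner \<Rightarrow> 'b::complex_inner"
  assumes add: "\<And>x y. U (x + y) = U x + U y" and scale: "\<And>c x. U (c *\<^sub>C x) = c *\<^sub>C U x"
    and norm: "\<And>x. norm (U x) = norm x"
  shows "cinner (U x) (U y) = cinner x y"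
proof -
  have re: "Re (cinner (U x) (U y)) = Re (cinner x y)" for x y
    using norm_add_sq[of "U x" "U y"] norm_add_sq[of x y] by (simp add: norm add[symmetric])
  have "Im (cinner (U x) (U y)) = Im (cinner x y)"
    using re[of "\<i> *\<^sub>C x" y] by (simp add: scale cinner_scaleC_left)
  then show ?thesis using re by (simp add: complex_eq_iff)
qed

text \<open>
  The candidate \<open>\<Sum>\<^sub>w s\<^sub>w \<theta> P t\<^sub>w x\<close> for the extension of \<open>\<theta>\<close>, where \<open>w\<close> runs over the words of length
  \<open>n\<close>, \<open>t\<^sub>w\<close> is the adjoint of \<open>s\<^sub>w\<close>, and \<open>P\<close> is the projection onto \<open>K\<close>. The projection makes it a
  contraction on the whole space, so that limits can be taken vector by vector.
\<close>

primrec level_ext :: "'a::pmodule dilation set \<Rightarrow> ('a dilation \<Rightarrow> 'b::pmodule dilation) \<Rightarrow> nat \<Rightarrow> 'a dilation \<Rightarrow> 'b dilation"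
  where
  "level_ext K \<theta> 0 x = \<theta> (proj K x)"
| "level_ext K \<theta> (Suc n) x = join False (level_ext K \<theta> n (tau False x)) + join True (level_ext K \<theta> n (tau True x))"

context
  fixes K :: "'a::pmodule dilation set" and K' :: "'b::pmodule dilation set" and \<theta> :: "'a dilation \<Rightarrow> 'b dilation"
  assumes K: "complete_submodule K" and \<theta>: "pmodule_morphism K K' \<theta>"
    and iso: "\<forall>x\<in>K. \<forall>y\<in>K. cinner (\<theta> x) (\<theta> y) = cinner x y"
begin

lemma domain_facts: "csubspace K" "closed K" "\<And>b x. x \<in> K \<Longrightarrow> tau b x \<in> K"
  using K by (auto simp: complete_submodule_def submodule_tau)

lemma morphism_facts:
  "x \<in> K \<Longrightarrow> y \<in> K \<Longrightarrow> \<theta> (x + y) = \<theta> x + \<theta> y" "x \<in> K \<Longrightarrow> \<theta> (c *\<^sub>C x) = c *\<^sub>C \<theta> x"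
  "x \<in> K \<Longrightarrow> \<theta> (tau b x) = tau b (\<theta> x)"
  using \<theta> by (auto simp: pmodule_morphism_def tau_def)

lemma norm_morphism: "x \<in> K \<Longrightarrow> norm (\<theta> x) = norm x"
proof -
  assume "x \<in> K"
  then have "complex_of_real ((norm (\<theta> x))\<^sup>2) = complex_of_real ((norm x)\<^sup>2)"
    using iso by (simp only: cinner_self[symmetric])
  then show ?thesis by (simp only: of_real_eq_iff) simp
qed

lemma tau_level_ext: "tau b (level_ext K \<theta> (Suc n) x) = level_ext K \<theta> n (tau b x)"
  by (cases b) (simp_all add: tau_linear tau_join)

lemma level_ext_linear:
  "level_ext K \<theta> n (x + y) = level_ext K \<theta> n x + level_ext K \<theta> n y"
  "level_ext K \<theta> n (c *\<^sub>C x) = c *\<^sub>C level_ext K \<theta> n x"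
proof (induction n arbitrary: x y)
  case 0
  note P = bounded_clinear_proj[OF domain_facts(1,2)]
  { case 1 show ?case by (simp add: bounded_clinear_add[OF P] morphism_facts proj_in[OF domain_facts(1,2)])
  next case 2 show ?case by (simp add: bounded_clinear_scaleC[OF P] morphism_facts proj_in[OF domain_facts(1,2)]) }
next
  case (Suc n)
  { case 1 show ?case by (simp add: tau_linear Suc join_linear)
  next case 2 show ?case by (simp add: tau_linear Suc join_linear scaleC_add_right) }
qed

lemma norm_level_ext_le: "norm (level_ext K \<theta> n x) \<le> norm x"
proof (induction n arbitrary: x)
  case 0
  show ?case using norm_proj_le[OF domain_facts(1,2)] by (simp add: norm_morphism proj_in[OF domain_facts(1,2)])
next
  case (Suc n)
  have "(norm (level_ext K \<theta> (Suc n) x))\<^sup>2 \<le> (norm x)\<^sup>2"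
    unfolding norm_tau_sq[of "level_ext K \<theta> (Suc n) x"] norm_tau_sq[of x] tau_level_ext
    by (intro add_mono power_mono Suc.IH) simp_all
  then show ?case by (rule power2_le_imp_le) simp
qed

text \<open>
  On the level \<open>n\<close> the projection acts as the identity, and \<open>\<theta>\<close> commutes with \<open>tau\<close>; so one further step
  splits and reassembles the same vector.
\<close>

lemma level_ext_stable: "x \<in> level K n \<Longrightarrow> level_ext K \<theta> (Suc n) x = level_ext K \<theta> n x"
proof (induction n arbitrary: x)
  case 0
  then have "tau b (level_ext K \<theta> (Suc 0) x) = tau b (level_ext K \<theta> 0 x)" for b
    unfolding tau_level_ext using domain_facts by (simp add: proj_id morphism_facts)
  then show ?case by (rule tau_eqI)
next
  case (Suc n)
  then have "tau b x \<in> level K n" for b by simp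
  then have "tau b (level_ext K \<theta> (Suc (Suc n)) x) = tau b (level_ext K \<theta> (Suc n) x)" for b
    unfolding tau_level_ext by (rule Suc.IH)
  then show ?case by (rule tau_eqI)
qed

lemma level_ext_eventually_const:
  assumes "x \<in> level K n" "n \<le> m" shows "level_ext K \<theta> m x = level_ext K \<theta> n x"
  using assms(2)
proof (induction m rule: dec_induct)
  case (step m)
  have "x \<in> level K m" using K level_mono[of K n m] step.hyps assms(1) by (auto simp: complete_submodule_def)
  then show ?case using level_ext_stable step.IH by simp
qed simp

lemma norm_level_ext_level: "x \<in> level K n \<Longrightarrow> norm (level_ext K \<theta> n x) = norm x"
proof (induction n arbitrary: x)
  case 0
  then show ?case by (simp add: proj_id[OF domain_facts(1,2)] norm_morphism)
next
  case (Suc n)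
  have "(norm (level_ext K \<theta> (Suc n) x))\<^sup>2 = (norm x)\<^sup>2"
    unfolding norm_tau_sq[of "level_ext K \<theta> (Suc n) x"] norm_tau_sq[of x] tau_level_ext
    using Suc by simp
  then show ?case by simp
qed

lemma level_ext_diff: "level_ext K \<theta> n (x - y) = level_ext K \<theta> n x - level_ext K \<theta> n y"
  using level_ext_linear(1)[of n "x - y" y] by simp

text \<open>
  The sequence is eventually constant on the dense union of the levels and consists of contractions.
\<close>

lemma level_ext_convergent: "convergent (\<lambda>n. level_ext K \<theta> n x)"
proof (rule Cauchy_convergent, rule CauchyI)
  fix e :: real assume "e > 0"
  then obtain N u where u: "u \<in> level K N" "norm (x - u) < e / 2" using level_approx[OF K, of "e / 2" x] by auto
  have "norm (level_ext K \<theta> m x - level_ext K \<theta> n x) < e" if "m \<ge> N" "n \<ge> N" for m n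
  proof -
    have "level_ext K \<theta> m x - level_ext K \<theta> n x = level_ext K \<theta> m (x - u) - level_ext K \<theta> n (x - u)"
      by (simp add: level_ext_diff level_ext_eventually_const[OF u(1) that(1)] level_ext_eventually_const[OF u(1) that(2)])
    then show ?thesis
      using norm_triangle_ineq4[of "level_ext K \<theta> m (x - u)" "level_ext K \<theta> n (x - u)"]
        norm_level_ext_le[of m "x - u"] norm_level_ext_le[of n "x - u"] u(2) by simp
  qed
  then show "\<exists>M. \<forall>m\<ge>M. \<forall>n\<ge>M. norm (level_ext K \<theta> m x - level_ext K \<theta> n x) < e" by blast
qed

text \<open>
  The limit of \<open>level_ext\<close> is isometric on every level, hence everywhere, and the relation
  \<open>tau_level_ext\<close> becomes commutation with \<open>tau\<close> in the limit.
\<close>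

lemma isometric_extension_exists:
  "\<exists>U. (\<forall>x y. U (x + y) = U x + U y) \<and> (\<forall>c x. U (c *\<^sub>C x) = c *\<^sub>C U x) \<and> (\<forall>x. norm (U x) = norm x)
    \<and> (\<forall>b x. U (tau b x) = tau b (U x)) \<and> (\<forall>x\<in>K. U x = \<theta> x)"
proof -
  define U where "U x = lim (\<lambda>n. level_ext K \<theta> n x)" for x
  have U: "(\<lambda>n. level_ext K \<theta> n x) \<longlonglongrightarrow> U x" for x
    using level_ext_convergent[of x] by (simp add: U_def convergent_LIMSEQ_iff)
  have add: "U (x + y) = U x + U y" for x y
    using tendsto_add[OF U[of x] U[of y]] by (intro LIMSEQ_unique[OF U]) (simp add: level_ext_linear)
  have scale: "U (c *\<^sub>C x) = c *\<^sub>C U x" for c x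
    using tendsto_scaleC[OF U[of x]] by (intro LIMSEQ_unique[OF U]) (simp add: level_ext_linear)
  have level: "U x = level_ext K \<theta> n x" if "x \<in> level K n" for x n
  proof (rule LIMSEQ_unique[OF U])
    show "(\<lambda>m. level_ext K \<theta> m x) \<longlonglongrightarrow> level_ext K \<theta> n x"
      by (rule tendsto_eventually, unfold eventually_sequentially)
        (intro exI[of _ n] allI impI level_ext_eventually_const[OF that])
  qed
  have le: "norm (U x) \<le> norm x" for x
    by (rule LIMSEQ_le_const2[OF tendsto_norm[OF U]]) (auto intro: norm_level_ext_le)
  have norm: "norm (U x) = norm x" for x
  proof (rule antisym[OF le], rule field_le_epsilon)
    fix e :: real assume "e > 0"
    then obtain n u where u: "u \<in> level K n" "norm (x - u) < e / 2" using level_approx[OF K, of "e / 2" x] by auto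
    have "norm (U u) = norm u" using level[OF u(1)] norm_level_ext_level[OF u(1)] by simp
    moreover have "U x = U u + U (x - u)" using add[of u "x - u"] by simp
    then have "norm (U u) \<le> norm (U x) + norm (U (x - u))" using norm_triangle_ineq4[of "U x" "U (x - u)"] by simp
    moreover have "norm x \<le> norm u + norm (x - u)" using norm_triangle_ineq[of u "x - u"] by simp
    ultimately show "norm x \<le> norm (U x) + e" using le[of "x - u"] u(2) by linarith
  qed
  have tau: "U (tau b x) = tau b (U x)" for b x
    using tendsto_tau[OF LIMSEQ_Suc[OF U[of x]], of b] by (intro LIMSEQ_unique[OF U]) (simp only: tau_level_ext)
  have "U x = \<theta> x" if "x \<in> K" for x using level[of x 0] that by (simp add: proj_id[OF domain_facts(1,2)])
  then show ?thesis using add scale norm tau by (intro exI[of _ U] conjI allI ballI)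
qed

end

text \<open>
  The range of the isometric extension is a reducing subspace that contains the complete sub-module \<open>K'\<close>; its
  orthogonal complement is a sub-module orthogonal to \<open>K'\<close> and therefore zero.
\<close>

lemma unitary_extension_exists:
  fixes K :: "'a::pmodule dilation set" and K' :: "'b::pmodule dilation set"
  assumes K: "complete_submodule K" and K': "complete_submodule K'"
    and "unitarily_equivalent_submodules K K'"
  shows "unitarily_equivalent_on X (associated_rep :: cuntz \<Rightarrow> 'a dilation \<Rightarrow> _) (associated_rep :: cuntz \<Rightarrow> 'b dilation \<Rightarrow> _)"
proof -
  obtain \<theta> where \<theta>: "pmodule_morphism K K' \<theta>" "bij_betw \<theta> K K'" "\<forall>x\<in>K. \<forall>y\<in>K. cinner (\<theta> x) (\<theta> y) = cinner x y"
    using assms(3) unfolding unitarily_equivalent_submodules_def by blast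
  from isometric_extension_exists[OF K \<theta>(1,3)] obtain U :: "'a dilation \<Rightarrow> 'b dilation"
    where U: "\<forall>x y. U (x + y) = U x + U y" "\<forall>c x. U (c *\<^sub>C x) = c *\<^sub>C U x" "\<forall>x. norm (U x) = norm x"
      "\<forall>b x. U (tau b x) = tau b (U x)" "\<forall>x\<in>K. U x = \<theta> x"
    by (elim exE conjE)
  note add = U(1)[rule_format] and scale = U(2)[rule_format] and norm = U(3)[rule_format]
    and tau = U(4)[rule_format] and ext = U(5)[rule_format]
  have bl: "bounded_clinear U" by (rule bounded_clinearI[where K=1]) (simp_all add: add scale norm)
  then interpret U: bounded_linear U by (simp add: bounded_clinear_def)
  have join: "U (join b x) = join b (U x)" for b x
    by (rule tau_eqI) (simp add: tau[symmetric] tau_join U.zero)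
  have "complete (U ` UNIV)"
    by (rule complete_isometric_image[where e=1]) (simp_all add: U.bounded_linear_axioms norm complete_UNIV)
  then have "closed (range U)" by (rule complete_imp_closed)
  moreover have "csubspace (range U)"
    unfolding complex_vec.subspace_def
    by (auto simp: add[symmetric] scale[symmetric]) (metis U.zero rangeI)
  moreover have "orth_compl (range U) = {0}"
  proof -
    have "submodule (orth_compl (range U))" by (rule submodule_orth_compl) (auto simp: join[symmetric])
    moreover have "K' \<subseteq> range U" using \<theta>(2) ext by (metis bij_betw_imp_surj_on image_subset_iff rangeI)
    then have "orth_compl (range U) \<subseteq> orth_compl K'" by (rule orth_compl_antimono)
    ultimately show ?thesis using K' by (simp add: complete_submodule_def)
  qed
  ultimately have "surj U" using closed_subspace_eq_UNIV by blast
  moreover have "inj U"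
  proof (rule injI)
    fix x y assume "U x = U y"
    then have "norm (U (x - y)) = 0" by (simp add: U.diff)
    then show "x = y" by (simp add: norm)
  qed
  ultimately have "unitary_map U"
    using bl norm_preserving_imp_cinner_preserving[OF add scale norm] by (simp add: unitary_map_def bij_def)
  moreover have "intertwines_on X associated_rep associated_rep U"
    using intertwines_all_if_commutes[OF bl join tau] by (simp add: intertwines_on_def)
  ultimately show ?thesis unfolding unitarily_equivalent_on_def by blast
qed

lemma unitary_map_inv:
  fixes U :: "'a::complex_hilbert \<Rightarrow> 'b::complex_hilbert"
  assumes "unitary_map U" shows "bounded_clinear (inv U)"
proof -
  have b: "bij U" and l: "bounded_clinear U" and c: "\<And>x y. cinner (U x) (U y) = cinner x y"
    using assms by (auto simp: unitary_map_def)
  have UV: "U (inv U y) = y" for y using b by (simp add: bij_is_surj surj_f_inv_f)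
  have VU: "inv U (U x) = x" for x using b by (simp add: bij_is_inj)
  show ?thesis
  proof (rule bounded_clinearI[where K=1])
    fix x y :: 'b and a
    show "inv U (x + y) = inv U x + inv U y"
      using VU[of "inv U x + inv U y"] by (simp add: bounded_clinear_add[OF l] UV)
    show "inv U (a *\<^sub>C x) = a *\<^sub>C inv U x"
      using VU[of "a *\<^sub>C inv U x"] by (simp add: bounded_clinear_scaleC[OF l] UV)
    have "complex_of_real ((norm (inv U x))\<^sup>2) = complex_of_real ((norm x)\<^sup>2)"
      unfolding cinner_self[symmetric] using c[of "inv U x" "inv U x"] by (simp add: UV)
    then show "norm (inv U x) \<le> norm x * 1" by (simp only: of_real_eq_iff) simp
  qed
qed

text \<open>
  A unitary intertwiner and its inverse both map the smallest complete sub-module into the other one, so it restricts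
  to a bijection between them.
\<close>

lemma small_submodules_equivalent:
  assumes fd: "finite_dimensional TYPE('a::pmodule)" "finite_dimensional TYPE('b::pmodule)"
    and diff: "diffuse TYPE('a)" "diffuse TYPE('b)" and X: "cuntz_copy thompson_F \<subseteq> X"
    and "unitarily_equivalent_on X (associated_rep :: cuntz \<Rightarrow> 'a dilation \<Rightarrow> _) (associated_rep :: cuntz \<Rightarrow> 'b dilation \<Rightarrow> _)"
  shows "unitarily_equivalent_submodules (small_submodule :: 'a dilation set) (small_submodule :: 'b dilation set)"
proof -
  obtain U :: "'a dilation \<Rightarrow> 'b dilation" where U: "unitary_map U" "intertwines_on X associated_rep associated_rep U"
    using assms(6) unfolding unitarily_equivalent_on_def by blast
  have bl: "bounded_clinear U" and b: "bij U" using U(1) by (auto simp: unitary_map_def)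
  have "intertwines_on (cuntz_copy thompson_F) associated_rep associated_rep U"
    using U(2) X by (auto simp: intertwines_on_def)
  note tau = F_intertwiner_commutes(2)[OF diff bl this]
  have UV: "U (inv U y) = y" for y using b by (simp add: bij_is_surj surj_f_inv_f)
  have VU: "inv U (U x) = x" for x using b by (simp add: bij_is_inj)
  have "inv U (tau b y) = tau b (inv U y)" for b y using VU[of "tau b (inv U y)"] by (simp add: tau UV)
  from intertwiner_maps_small_submodule[OF fd(2,1) unitary_map_inv[OF U(1)] this]
  have V: "inv U ` small_submodule \<subseteq> small_submodule" by (simp add: pmodule_morphism_def)
  note m = intertwiner_maps_small_submodule[OF fd bl tau]
  then have "U ` small_submodule \<subseteq> small_submodule" by (simp add: pmodule_morphism_def)
  moreover have "small_submodule \<subseteq> U ` small_submodule"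
  proof
    fix y :: "'b dilation" assume "y \<in> small_submodule"
    then have "inv U y \<in> small_submodule" using V by blast
    then show "y \<in> U ` small_submodule" using UV[of y] by (metis imageI)
  qed
  ultimately have "U ` small_submodule = small_submodule" by (rule subset_antisym)
  then have "bij_betw U small_submodule small_submodule" using b by (auto simp: bij_betw_def bij_def intro: inj_on_subset)
  then show ?thesis
    unfolding unitarily_equivalent_submodules_def using m U(1) by (auto simp: unitary_map_def)
qed

section \<open>The three assertions together\<close>

theorem theoremC:
  fixes X :: "cuntz set"
  assumes "finite_dimensional TYPE('a::pmodule)" and "diffuse TYPE('a)"
    and "finite_dimensional TYPE('b::pmodule)" and "diffuse TYPE('b)"
    and "X \<in> {cuntz_copy thompson_F, cuntz_copy thompson_T, cuntz_copy thompson_V, UNIV}"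
  shows "complete_submodule (small_submodule :: 'a dilation set) \<and>
    complete_submodule (small_submodule :: 'b dilation set) \<and>
    (irreducible_on X (associated_rep :: cuntz \<Rightarrow> 'a dilation \<Rightarrow> 'a dilation) \<longleftrightarrow>
      indecomposable TYPE('a)) \<and>
    (\<forall>\<Theta> :: 'a dilation \<Rightarrow> 'b dilation.
      bounded_clinear \<Theta> \<and> intertwines_on X associated_rep associated_rep \<Theta> \<longrightarrow>
      pmodule_morphism small_submodule small_submodule \<Theta>) \<and>
    (unitarily_equivalent_on X
        (associated_rep :: cuntz \<Rightarrow> 'a dilation \<Rightarrow> 'a dilation)
        (associated_rep :: cuntz \<Rightarrow> 'b dilation \<Rightarrow> 'b dilation) \<longleftrightarrow>
      unitarily_equivalent_submodules (small_submodule :: 'a dilation set) (small_submodule :: 'b dilation set))"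
proof (intro conjI allI impI)
  have X: "cuntz_copy thompson_F \<subseteq> X"
    using assms(5) cuntz_copy_mono[OF thompson_F_subset_T]
      cuntz_copy_mono[OF order_trans[OF thompson_F_subset_T thompson_T_subset_V]] by auto
  show a: "complete_submodule (small_submodule :: 'a dilation set)"
    by (rule smallest_complete_submodule[OF assms(1)])
  show b: "complete_submodule (small_submodule :: 'b dilation set)"
    by (rule smallest_complete_submodule[OF assms(3)])
  show "irreducible_on X (associated_rep :: cuntz \<Rightarrow> 'a dilation \<Rightarrow> 'a dilation) \<longleftrightarrow> indecomposable TYPE('a)"
    by (rule irreducible_iff_indecomposable[OF assms(1,2) X])
  show "pmodule_morphism small_submodule small_submodule \<Theta>"
    if "bounded_clinear \<Theta> \<and> intertwines_on X associated_rep associated_rep \<Theta>" for \<Theta> :: "'a dilation \<Rightarrow> 'b dilation"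
  proof -
    have bl: "bounded_clinear \<Theta>" and "intertwines_on (cuntz_copy thompson_F) associated_rep associated_rep \<Theta>"
      using that X by (auto simp: intertwines_on_def)
    from F_intertwiner_commutes(2)[OF assms(2,4) this]
    show ?thesis by (rule intertwiner_maps_small_submodule[OF assms(1,3) bl])
  qed
  show "unitarily_equivalent_on X
        (associated_rep :: cuntz \<Rightarrow> 'a dilation \<Rightarrow> 'a dilation)
        (associated_rep :: cuntz \<Rightarrow> 'b dilation \<Rightarrow> 'b dilation) \<longleftrightarrow>
      unitarily_equivalent_submodules (small_submodule :: 'a dilation set) (small_submodule :: 'b dilation set)"
    using unitary_extension_exists[OF a b] small_submodules_equivalent[OF assms(1,3,2,4) X] by blast
qed

end
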